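(* There exist universal constants $0 < c \leq c' < \infty$ such that for every integer $n \geq 1$ and all $1 \leq p < q < \infty$, $$ c\,\sqrt{\frac{q\vee n}{p\vee n}}\left(\frac{n}{(p\wedge n)\,\log\!\big(\mathrm{e}\,\tfrac{n}{q\wedge n}\big)}\right)^{\tau} \;\leq\; \mathsf{A}^\star_{p,q}(\gamma_n) \;\leq\; c'\,\sqrt{\frac{q\vee n}{p\vee n}}\left(\frac{n}{(p\wedge n)\,\log\!\big(\mathrm{e}\,\tfrac{n}{q\wedge n}\big)}\right)^{\tau}, \qquad \tau = \frac12\Big(1-\frac pq\Big). $$
   Context: $\mathcal{C}_n$ is the class of closed convex sets $C \subset \mathbb{R}^n$ containing the origin. For $C \in \mathcal{C}_n$, $\Pi_C(x) = \arg\min_{y\in C}\|x-y\|_2$ is the metric projection. $\gamma_n$ is the standard Gaussian measure on $\mathbb{R}^n$. For a probability measure $\mu$ on $\mathbb{R}^n$ and a measurable vector-valued map $f$, $\|f\|_{L^p(\mu)} = (\mathbf{E}_{\xi\sim\mu}\|f(\xi)\|_2^p)^{1/p}$ for $1\leq p<\infty$. The extremal constant is $$\mathsf{A}^\star_{p,q}(\mu) = \sup_{C\in\mathcal{C}_n,\,C\neq\{0\}} \frac{\|\Pi_C\|_{L^q(\mu)}}{\|\Pi_C\|_{L^p(\mu)}},$$ the supremum being restricted to those $C$ for which the denominator is positive. $r\wedge n = \min\{r,n\}$ and $r\vee n=\max\{r,n\}$. $\log$ is the natural logarithm. *)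

theory Defs
  imports "HOL-Probability.Probability"
begin

text \<open>
  The constants in the theorem are uniform in the dimension, so the dimension is a natural
  number rather than a type: a vector of \<open>\<real>\<^sup>n\<close> is a function \<open>nat \<Rightarrow> real\<close> in
  \<open>{..<n} \<rightarrow>\<^sub>E UNIV\<close>, i.e. with the value \<open>undefined\<close> outside \<open>{..<n}\<close>. This is the carrier both of
  the product measure \<open>\<Pi>\<^sub>M i\<in>{..<n}. M i\<close> and of \<open>product_topology\<close> on \<open>{..<n}\<close>.
\<close>

definition vec_space :: "nat \<Rightarrow> (nat \<Rightarrow> real) set" where
  "vec_space n = {..<n} \<rightarrow>\<^sub>E UNIV"

definition vec_zero :: "nat \<Rightarrow> nat \<Rightarrow> real" where
  "vec_zero n = (\<lambda>i\<in>{..<n}. 0)"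

definition vec_norm :: "nat \<Rightarrow> (nat \<Rightarrow> real) \<Rightarrow> real" where
  "vec_norm n x = L2_set x {..<n}"

definition vec_convex :: "nat \<Rightarrow> (nat \<Rightarrow> real) set \<Rightarrow> bool" where
  "vec_convex n C \<longleftrightarrow>
     (\<forall>x\<in>C. \<forall>y\<in>C. \<forall>u\<ge>0. \<forall>v\<ge>0. u + v = 1 \<longrightarrow> (\<lambda>i\<in>{..<n}. u * x i + v * y i) \<in> C)"

definition closed_convex_sets :: "nat \<Rightarrow> (nat \<Rightarrow> real) set set" where
  "closed_convex_sets n =
     {C. C \<subseteq> vec_space n \<and> closedin (product_topology (\<lambda>_. euclideanreal) {..<n}) C \<and>
         vec_convex n C \<and> vec_zero n \<in> C}"

definition metric_proj :: "nat \<Rightarrow> (nat \<Rightarrow> real) set \<Rightarrow> (nat \<Rightarrow> real) \<Rightarrow> (nat \<Rightarrow> real)" where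
  "metric_proj n C x = arg_min_on (\<lambda>y. vec_norm n (\<lambda>i\<in>{..<n}. x i - y i)) C"

definition std_gaussian :: "nat \<Rightarrow> (nat \<Rightarrow> real) measure" where
  "std_gaussian n = (\<Pi>\<^sub>M i\<in>{..<n}. density lborel std_normal_density)"

text \<open>The norm \<open>(\<integral> \<parallel>f\<parallel>\<^sub>2\<^sup>p d\<mu>)\<^sup>1\<^sup>/\<^sup>p\<close> with values in \<open>[0, \<infinity>]\<close>; the library has no real powers
  on \<open>ennreal\<close>, hence the case distinction.\<close>

definition Lp_norm ::
  "nat \<Rightarrow> (nat \<Rightarrow> real) measure \<Rightarrow> real \<Rightarrow> ((nat \<Rightarrow> real) \<Rightarrow> (nat \<Rightarrow> real)) \<Rightarrow> ennreal" where
  "Lp_norm n \<mu> p f =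
     (let I = (\<integral>\<^sup>+ x. ennreal (vec_norm n (f x) powr p) \<partial>\<mu>)
      in if I = \<infinity> then \<infinity> else ennreal (enn2real I powr (1 / p)))"

text \<open>The supremum is taken in \<open>[0, \<infinity>]\<close>, so an upper bound by a real number includes
  its finiteness.\<close>

definition A_star :: "nat \<Rightarrow> real \<Rightarrow> real \<Rightarrow> (nat \<Rightarrow> real) measure \<Rightarrow> ennreal" where
  "A_star n p q \<mu> =
     (SUP C \<in> {C \<in> closed_convex_sets n. C \<noteq> {vec_zero n} \<and> 0 < Lp_norm n \<mu> p (metric_proj n C)}.
        Lp_norm n \<mu> q (metric_proj n C) / Lp_norm n \<mu> p (metric_proj n C))"

end

theory Submission
  imports Defs "HOL-Real_Asymp.Real_Asymp"
begin

text \<open>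
  Write \<open>\<Lambda> = 1 + ln (n / (q \<and> n))\<close> and \<open>M\<close> for the \<open>L\<^sup>p\<close> norm of the projection.

  Upper bound. The map \<open>x \<mapsto> \<parallel>\<Pi> x\<parallel>\<close> is 1-Lipschitz, so by Gaussian concentration all its
  higher moments are \<open>O(M + \<surd>s)\<close>. On the other hand a point \<open>y \<in> C\<close> of norm \<open>b\<close> forces \<open>M\<close> to be large:
  shifting a typical \<open>x\<close> by \<open>t y / b\<close> either produces a projection of length of order \<open>min b t\<close>, at the price
  of a factor \<open>exp (- t\<^sup>2)\<close> in probability, or shows that \<open>\<parallel>\<Pi> x\<parallel>\<close> is at least of order \<open>b t / \<surd>n\<close>. For \<open>t\<close> of
  order \<open>\<surd>(p \<Lambda>)\<close> this gives \<open>b = O(M \<surd>(n / (p \<Lambda>)))\<close> at all relevant scales \<open>b\<close>, and interpolation between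
  \<open>L\<^sup>p\<close> and this sup bound yields the exponent \<open>\<tau>\<close>.

  Lower bound. For a cone of height \<open>L\<close> over a cube, with apex on the first axis, the opening can be tuned
  so that the first coordinate of the projection behaves like \<open>min L (max 0 (x\<^sub>0 - t))\<close>: the other coordinates
  contribute a push towards the base which is almost deterministic. The base only adds a length of order
  \<open>t L / \<surd>n\<close>. Segments suffice when \<open>q\<close> is at least a fixed multiple of \<open>n\<close>.
\<close>

section \<open>Gaussian concentration\<close>

text \<open>Concentration comes from Maurey's property (tau): if \<open>u x * v y\<close> is at most
  exp of a quarter of the squared distance, the integrals of \<open>u\<close> and \<open>v\<close>
  have product at most 1. This tensorizes, so Prekopa-Leindler is needed only on the line.
  Uniformity in p rests on taking p-th roots: a change of measure costing exp (t^2) is harmless for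
  t^2 = O(p), and enlarging t^2 by a small multiple of p times Lambda is affordable because the
  resulting factor exp (Lambda / 8) is absorbed by a power of n / q. In the lower bound, an event of
  probability exp (- O(q)) costs only a constant in L^q. With threshold t, height L is reached with
  probability about exp (- (t + L)^2 / 2). Hence L = sqrt q is admissible as long as t <= sqrt q,
  that is for p Lambda <= q. Otherwise L = q / t, for which the mixed term t L is q, while exp (-
  t^2 / 2) is no longer negligible. It is tuned to the power - p / 2 of n / (p Lambda); the q-th
  root of this is what lowers the exponent of the ratio from 1/2 to tau.\<close>

abbreviation gauss1 :: "real measure" where
  "gauss1 \<equiv> density lborel (\<lambda>x. ennreal (std_normal_density x))"

abbreviation gaussPi :: "'i set \<Rightarrow> ('i \<Rightarrow> real) measure" where
  "gaussPi I \<equiv> PiM I (\<lambda>_. gauss1)"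

lemma prob_space_gauss1: "prob_space gauss1"
  by (rule prob_space_normal_density) simp

lemma product_sigma_finite_gauss1: "product_sigma_finite (\<lambda>_. gauss1)"
  by (simp add: product_sigma_finite_def prob_space_gauss1 prob_space_imp_sigma_finite)

section \<open>Prekopa-Leindler on the line and its tensorization\<close>

lemma nn_integral_layer_cake_unit:
  fixes G :: "real \<Rightarrow> real"
  assumes [measurable]: "G \<in> borel_measurable borel"
    and G0: "\<And>x. 0 \<le> G x" and G1: "\<And>x. G x \<le> 1"
  shows "(\<integral>\<^sup>+ x. ennreal (G x) \<partial>lborel) =
         (\<integral>\<^sup>+ l. indicator {0<..<1} l * emeasure lborel {x. l < G x} \<partial>lborel)"
proof -
  have "(\<integral>\<^sup>+ x. ennreal (G x) \<partial>lborel) =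
        (\<integral>\<^sup>+ x. (\<integral>\<^sup>+ l. indicator {0<..<1} l * indicator {z. fst z < G (snd z)} (l, x) \<partial>lborel) \<partial>lborel)"
  proof (rule nn_integral_cong)
    fix x :: real
    have "(\<integral>\<^sup>+ l. indicator {0<..<1} l * indicator {z. fst z < G (snd z)} (l, x) \<partial>lborel) =
          (\<integral>\<^sup>+ l. indicator {0<..<G x} l \<partial>lborel)"
      by (rule nn_integral_cong) (use G1[of x] in \<open>auto simp: indicator_def\<close>)
    also have "\<dots> = ennreal (G x)"
      using G0[of x] by (subst nn_integral_indicator) auto
    finally show "ennreal (G x) = (\<integral>\<^sup>+ l. indicator {0<..<1} l * indicator {z. fst z < G (snd z)} (l, x) \<partial>lborel)"
      by simp
  qed
  also have "\<dots> = (\<integral>\<^sup>+ l. (\<integral>\<^sup>+ x. indicator {0<..<1} l * indicator {z. fst z < G (snd z)} (l, x) \<partial>lborel) \<partial>lborel)"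
    by (rule lborel_pair.Fubini'[symmetric]) measurable
  also have "\<dots> = (\<integral>\<^sup>+ l. indicator {0<..<1} l * emeasure lborel {x. l < G x} \<partial>lborel)"
  proof (rule nn_integral_cong)
    fix l :: real
    have "(\<integral>\<^sup>+ x. indicator {0<..<1} l * indicator {z. fst z < G (snd z)} (l, x) \<partial>lborel) =
          indicator {0<..<1} l * (\<integral>\<^sup>+ x. indicator {x. l < G x} x \<partial>lborel)"
      by (subst nn_integral_cmult[symmetric])
         (auto intro!: nn_integral_cong simp: indicator_def)
    also have "(\<integral>\<^sup>+ x. indicator {x. l < G x} x \<partial>lborel) = emeasure lborel {x. l < G x}"
      by (subst nn_integral_indicator) auto
    finally show "(\<integral>\<^sup>+ x. indicator {0<..<1} l * indicator {z. fst z < G (snd z)} (l, x) \<partial>lborel) =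
          indicator {0<..<1} l * emeasure lborel {x. l < G x}" .
  qed
  finally show ?thesis .
qed

text \<open>Enclose each set in the interval from its infimum to its supremum. The suprema add up to
  at most \<open>2 * r\<close> and the infima to at least \<open>- 2 * r\<close>, so the two lengths
  add up to at most \<open>4 * r\<close>.\<close>

lemma emeasure_add_le_of_midpoints_bounded:
  fixes A B :: "real set"
  assumes "A \<noteq> {}" "B \<noteq> {}"
    and AB: "\<And>a b. a \<in> A \<Longrightarrow> b \<in> B \<Longrightarrow> \<bar>(a + b) / 2\<bar> \<le> r"
  shows "emeasure lborel A + emeasure lborel B \<le> ennreal (4 * r)"
proof -
  obtain a0 b0 where ab: "a0 \<in> A" "b0 \<in> B" using assms by blast
  have bA: "bdd_above A" "bdd_below A"
    using AB[OF _ ab(2)] by (auto intro!: bdd_aboveI[where M="2*r - b0"] bdd_belowI[where m="-2*r - b0"] simp: abs_le_iff field_simps)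
       (smt (verit) AB ab(2) field_sum_of_halves)+
  have bB: "bdd_above B" "bdd_below B"
    using AB[OF ab(1)] by (auto intro!: bdd_aboveI[where M="2*r - a0"] bdd_belowI[where m="-2*r - a0"] simp: abs_le_iff field_simps)
       (smt (verit) AB ab(1) field_sum_of_halves)+
  have sub: "A \<subseteq> {Inf A..Sup A}" "B \<subseteq> {Inf B..Sup B}"
    using bA bB by (auto intro: cInf_lower cSup_upper)
  have le: "Inf A \<le> Sup A" "Inf B \<le> Sup B"
    using sub ab by auto
  have S: "Sup A + Sup B \<le> 2 * r"
  proof -
    have "Sup A \<le> 2 * r - Sup B"
    proof (rule cSup_least[OF assms(1)])
      fix a assume a: "a \<in> A"
      have "Sup B \<le> 2 * r - a"
        by (rule cSup_least[OF assms(2)]) (use AB[OF a] in \<open>auto simp: abs_le_iff field_simps\<close>)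
      then show "a \<le> 2 * r - Sup B" by simp
    qed
    then show ?thesis by simp
  qed
  have I: "Inf A + Inf B \<ge> - 2 * r"
  proof -
    have "Inf A \<ge> - 2 * r - Inf B"
    proof (rule cInf_greatest[OF assms(1)])
      fix a assume a: "a \<in> A"
      have "Inf B \<ge> - 2 * r - a"
        by (rule cInf_greatest[OF assms(2)]) (use AB[OF a] in \<open>force simp: abs_le_iff field_simps\<close>)
      then show "- 2 * r - Inf B \<le> a" by simp
    qed
    then show ?thesis by simp
  qed
  have "emeasure lborel A + emeasure lborel B \<le> emeasure lborel {Inf A..Sup A} + emeasure lborel {Inf B..Sup B}"
    by (intro add_mono emeasure_mono sub) auto
  also have "\<dots> = ennreal ((Sup A - Inf A) + (Sup B - Inf B))"
    using le by (simp add: ennreal_plus)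
  also have "\<dots> \<le> ennreal (4 * r)"
    using S I by (intro ennreal_leI) simp
  finally show ?thesis .
qed

text \<open>A Prekopa-Leindler inequality in which the majorant is a Gaussian density: its superlevel sets
  are intervals, so that comparing lengths of level sets needs no Brunn-Minkowski theorem.\<close>

lemma prekopa_leindler_normalized:
  fixes G H :: "real \<Rightarrow> real"
  assumes [measurable]: "G \<in> borel_measurable borel" "H \<in> borel_measurable borel"
    and G: "\<And>x. 0 \<le> G x" "\<And>x. G x \<le> 1" "\<And>l. l < 1 \<Longrightarrow> \<exists>x. l < G x"
    and H: "\<And>x. 0 \<le> H x" "\<And>x. H x \<le> 1" "\<And>l. l < 1 \<Longrightarrow> \<exists>x. l < H x"
    and k: "k > 0"
    and GH: "\<And>x y. G x * H y \<le> (k * std_normal_density ((x + y) / 2))\<^sup>2"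
  shows "(\<integral>\<^sup>+ x. ennreal (G x) \<partial>lborel) + (\<integral>\<^sup>+ x. ennreal (H x) \<partial>lborel) \<le> ennreal (2 * k)"
proof -
  \<comment> \<open>Truncation at 1 does not affect levels \<open>l < 1\<close>, the only ones that
    \<open>G\<close> and \<open>H\<close> exceed, and it makes the layer-cake formula applicable to
    the majorant.\<close>
  define W where "W x = min 1 (k * std_normal_density x)" for x
  have W0: "0 \<le> W x" "W x \<le> 1" for x
    using k by (auto simp: W_def)
  have [measurable]: "W \<in> borel_measurable borel" unfolding W_def by measurable
  have lev: "emeasure lborel {x. l < G x} + emeasure lborel {x. l < H x} \<le> 2 * emeasure lborel {x. l < W x}"
    if l: "0 < l" "l < 1" for l
  proof -
    define c where "c = l * sqrt (2 * pi) / k"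
    have c0: "c > 0" using l k by (simp add: c_def)
    have Wl: "l < W x \<longleftrightarrow> c < exp (- x\<^sup>2 / 2)" for x
      using l k by (auto simp: W_def std_normal_density_def c_def field_simps)
    have mid: "l < W ((a + b) / 2)" if "l < G a" "l < H b" for a b
    proof -
      have "l\<^sup>2 < G a * H b"
        using that l by (simp add: power2_eq_square mult_strict_mono')
      also have "\<dots> \<le> (k * std_normal_density ((a + b) / 2))\<^sup>2" by (rule GH)
      finally have "l < k * std_normal_density ((a + b) / 2)"
        using k by (meson less_eq_real_def mult_nonneg_nonneg normal_density_nonneg power2_less_imp_less)
      with l show ?thesis by (simp add: W_def)
    qed
    \<comment> \<open>Normalizing both suprema to 1 pays off here: below level 1 both superlevel
      sets are nonempty, as the comparison of lengths demands.\<close>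
    obtain a0 b0 where ab: "l < G a0" "l < H b0" using G(3)[OF l(2)] H(3)[OF l(2)] by blast
    have "c < exp (- ((a0 + b0) / 2)\<^sup>2 / 2)" using mid[OF ab] Wl by blast
    also have "\<dots> \<le> 1" by simp
    finally have c1: "c < 1" .
    define r where "r = sqrt (- 2 * ln c)"
    have r2: "r\<^sup>2 = - 2 * ln c" using c0 c1 by (simp add: r_def)
    have r0: "r > 0" using c0 c1 by (simp add: r_def)
    have Wr: "l < W x \<longleftrightarrow> \<bar>x\<bar> < r" for x
    proof -
      have "l < W x \<longleftrightarrow> ln c < - x\<^sup>2 / 2"
        unfolding Wl using c0 by (metis exp_gt_zero ln_exp ln_less_cancel_iff)
      also have "\<dots> \<longleftrightarrow> x\<^sup>2 < r\<^sup>2" using r2 by auto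
      also have "\<dots> \<longleftrightarrow> \<bar>x\<bar> < r" using r0 by (metis abs_of_pos power2_less_eq_zero_iff abs_le_square_iff not_le)
      finally show ?thesis .
    qed
    have "emeasure lborel {x. l < G x} + emeasure lborel {x. l < H x} \<le> ennreal (4 * r)"
      by (rule emeasure_add_le_of_midpoints_bounded) (use ab mid Wr in \<open>auto intro: less_imp_le\<close>)
    also have "ennreal (4 * r) = 2 * emeasure lborel {-r<..<r}"
      using r0 by (simp add: ennreal_mult'[symmetric] flip: ennreal_numeral)
    also have "{-r<..<r} = {x. l < W x}"
      unfolding Wr by auto
    finally show ?thesis .
  qed
  have m: "(\<lambda>l. emeasure lborel {x. l < F x}) \<in> borel_measurable borel"
    if [measurable]: "F \<in> borel_measurable borel" for F :: "real \<Rightarrow> real"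
  proof -
    have eq: "(\<lambda>l. emeasure lborel {x. l < F x}) = (\<lambda>l. \<integral>\<^sup>+ x. indicator {z. fst z < F (snd z)} (l, x) \<partial>lborel)"
    proof
      fix l
      have "(\<integral>\<^sup>+ x. indicator {z. fst z < F (snd z)} (l, x) \<partial>lborel) = (\<integral>\<^sup>+ x. indicator {x. l < F x} x \<partial>lborel)"
        by (rule nn_integral_cong) (auto simp: indicator_def)
      then show "emeasure lborel {x. l < F x} = (\<integral>\<^sup>+ x. indicator {z. fst z < F (snd z)} (l, x) \<partial>lborel)"
        by simp
    qed
    show ?thesis unfolding eq by measurable
  qed
  note [measurable] = m[of G] m[of H] m[of W]
  have "(\<integral>\<^sup>+ x. ennreal (G x) \<partial>lborel) + (\<integral>\<^sup>+ x. ennreal (H x) \<partial>lborel) =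
     (\<integral>\<^sup>+ l. indicator {0<..<1} l * emeasure lborel {x. l < G x} + indicator {0<..<1} l * emeasure lborel {x. l < H x} \<partial>lborel)"
    by (subst nn_integral_add) (auto simp: nn_integral_layer_cake_unit G H)
  also have "\<dots> \<le> (\<integral>\<^sup>+ l. 2 * (indicator {0<..<1} l * emeasure lborel {x. l < W x}) \<partial>lborel)"
    by (rule nn_integral_mono) (auto simp: indicator_def lev)
  also have "\<dots> = 2 * (\<integral>\<^sup>+ x. ennreal (W x) \<partial>lborel)"
    by (subst nn_integral_cmult) (auto simp: nn_integral_layer_cake_unit W0)
  also have "(\<integral>\<^sup>+ x. ennreal (W x) \<partial>lborel) \<le> (\<integral>\<^sup>+ x. ennreal k * ennreal (std_normal_density x) \<partial>lborel)"
    using k by (intro nn_integral_mono) (auto simp: W_def ennreal_mult'[symmetric] intro!: ennreal_leI)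
  also have "\<dots> = ennreal k * 1"
    by (subst nn_integral_cmult) (auto simp: nn_integral_eq_integral)
  finally show ?thesis
    using k by (simp add: ennreal_mult' mult_left_mono)
qed

text \<open>Since (x - y)^2 / 4 = x^2 / 2 + y^2 / 2 - ((x + y) / 2)^2, multiplying \<open>u\<close>
  and \<open>v\<close> by the Gaussian density turns the hypothesis into the Prekopa-Leindler
  condition, with the density at the midpoint as majorant.\<close>

lemma gauss1_product_le_1:
  fixes u v :: "real \<Rightarrow> ennreal"
  assumes [measurable]: "u \<in> borel_measurable borel" "v \<in> borel_measurable borel"
    and uv: "\<And>x y. u x * v y \<le> ennreal (exp ((x - y)\<^sup>2 / 4))"
  shows "(\<integral>\<^sup>+ x. u x \<partial>gauss1) * (\<integral>\<^sup>+ x. v x \<partial>gauss1) \<le> 1"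
proof (cases "(\<forall>x. u x = 0) \<or> (\<forall>x. v x = 0)")
  case True
  then show ?thesis by (auto simp: nn_integral_0_iff_AE)
next
  case False
  then obtain x0 y0 where x0: "u x0 \<noteq> 0" and y0: "v y0 \<noteq> 0" by blast
  have ufin: "u x < \<infinity>" for x
    using uv[of x y0] y0 by (metis ennreal_mult_eq_top_iff ennreal_neq_top infinity_ennreal_def less_top neq_top_trans)
  have vfin: "v x < \<infinity>" for x
    using uv[of x0 x] x0 by (metis ennreal_mult_eq_top_iff ennreal_neq_top infinity_ennreal_def less_top neq_top_trans)
  define G0 H0 where "G0 x = enn2real (u x) * std_normal_density x" and "H0 x = enn2real (v x) * std_normal_density x" for x
  have [measurable]: "G0 \<in> borel_measurable borel" "H0 \<in> borel_measurable borel"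
    unfolding G0_def H0_def by measurable
  have nn: "G0 x \<ge> 0" "H0 x \<ge> 0" for x by (auto simp: G0_def H0_def)
  have GH0: "G0 x * H0 y \<le> (std_normal_density ((x + y) / 2))\<^sup>2" for x y
  proof -
    have "ennreal (enn2real (u x) * enn2real (v y)) \<le> ennreal (exp ((x - y)\<^sup>2 / 4))"
      using uv[of x y] ufin[of x] vfin[of y] by (simp add: ennreal_mult)
    then have "enn2real (u x) * enn2real (v y) \<le> exp ((x - y)\<^sup>2 / 4)" by simp
    then have "G0 x * H0 y \<le> exp ((x - y)\<^sup>2 / 4) * (std_normal_density x * std_normal_density y)"
      unfolding G0_def H0_def by (smt (verit) mult.assoc mult.left_commute mult_right_mono normal_density_nonneg mult_nonneg_nonneg)
    also have "\<dots> = (std_normal_density ((x + y) / 2))\<^sup>2"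
    proof -
      have "exp ((x - y)\<^sup>2 / 4) * (exp (- x\<^sup>2 / 2) * exp (- y\<^sup>2 / 2)) = (exp (- ((x + y) / 2)\<^sup>2 / 2))\<^sup>2"
        unfolding exp_double[symmetric] mult_exp_exp by (rule arg_cong[where f=exp]) (simp add: power2_eq_square field_simps)
      then show ?thesis
        unfolding std_normal_density_def by (simp add: power_mult_distrib field_simps power2_eq_square)
    qed
    finally show ?thesis .
  qed
  have dens1: "std_normal_density z \<le> 1" for z
  proof -
    have "1 \<le> sqrt (2 * pi)" using pi_gt3 by (intro real_le_rsqrt) auto
    moreover have "exp (- z\<^sup>2 / 2) \<le> 1" by simp
    ultimately show ?thesis unfolding std_normal_density_def
      by (smt (verit) divide_le_eq_1 mult_left_le_one_le exp_ge_zero divide_nonneg_nonneg)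
  qed
  have GH1: "G0 x * H0 y \<le> 1" for x y
    using GH0[of x y] power_mono[OF dens1, of "(x+y)/2" 2] by simp
  have px: "G0 x0 > 0" "H0 y0 > 0"
    using x0 y0 ufin[of x0] vfin[of y0] by (auto simp: G0_def H0_def enn2real_positive_iff normal_density_pos zero_less_iff_neq_zero)
  \<comment> \<open>All products \<open>G0 x * H0 y\<close> are at most 1, so one point where a
    factor is positive bounds the other factor. The suprema used for the normalization are therefore
    finite.\<close>
  have bG: "bdd_above (range G0)"
    using GH1[of _ y0] px(2) by (intro bdd_aboveI[where M="1 / H0 y0"]) (auto simp: field_simps)
  have bH: "bdd_above (range H0)"
    using GH1[of x0] px(1) by (intro bdd_aboveI[where M="1 / G0 x0"]) (auto simp: field_simps)
  define \<alpha> \<beta> where "\<alpha> = (SUP x. G0 x)" and "\<beta> = (SUP x. H0 x)"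
  have ub: "G0 x \<le> \<alpha>" "H0 x \<le> \<beta>" for x
    unfolding \<alpha>_def \<beta>_def using bG bH by (auto intro: cSUP_upper)
  have pos: "\<alpha> > 0" "\<beta> > 0" using ub[of x0] ub[of y0] px by auto
  define k where "k = 1 / sqrt (\<alpha> * \<beta>)"
  have k0: "k > 0" using pos by (simp add: k_def)
  have k2: "k\<^sup>2 * (\<alpha> * \<beta>) = 1" using pos by (simp add: k_def power_divide)
  have "(\<integral>\<^sup>+ x. ennreal (G0 x / \<alpha>) \<partial>lborel) + (\<integral>\<^sup>+ x. ennreal (H0 x / \<beta>) \<partial>lborel) \<le> ennreal (2 * k)"
  proof (rule prekopa_leindler_normalized[OF _ _ _ _ _ _ _ _ k0])
    show "\<exists>x. l < G0 x / \<alpha>" if "l < 1" for l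
    proof -
      have "l * \<alpha> < \<alpha>" using that pos by simp
      then obtain x where "l * \<alpha> < G0 x" unfolding \<alpha>_def using less_cSUP_iff[OF _ bG, of "l * Sup (range G0)"] by auto
      then show ?thesis using pos by (auto simp: field_simps)
    qed
    show "\<exists>x. l < H0 x / \<beta>" if "l < 1" for l
    proof -
      have "l * \<beta> < \<beta>" using that pos by simp
      then obtain x where "l * \<beta> < H0 x" unfolding \<beta>_def using less_cSUP_iff[OF _ bH, of "l * Sup (range H0)"] by auto
      then show ?thesis using pos by (auto simp: field_simps)
    qed
    show "G0 x / \<alpha> * (H0 y / \<beta>) \<le> (k * std_normal_density ((x + y) / 2))\<^sup>2" for x y
    proof -
      have "G0 x / \<alpha> * (H0 y / \<beta>) = k\<^sup>2 * (G0 x * H0 y)"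
        using pos by (simp add: k_def power_divide field_simps)
      also have "\<dots> \<le> k\<^sup>2 * (std_normal_density ((x + y) / 2))\<^sup>2"
        by (intro mult_left_mono GH0) auto
      finally show ?thesis by (simp add: power_mult_distrib)
    qed
  qed (use ub nn pos in \<open>auto simp: field_simps\<close>)
  moreover define a b where "a = (\<integral>\<^sup>+ x. ennreal (G0 x / \<alpha>) \<partial>lborel)" and "b = (\<integral>\<^sup>+ x. ennreal (H0 x / \<beta>) \<partial>lborel)"
  ultimately have ab: "a + b \<le> ennreal (2 * k)" by simp
  have "a + b < top" by (rule le_less_trans[OF ab]) simp
  then have "a < \<infinity>" "b < \<infinity>" by simp_all
  then obtain a' b' where a': "a = ennreal a'" "a' \<ge> 0" and b': "b = ennreal b'" "b' \<ge> 0"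
    by (metis enn2real_nonneg ennreal_enn2real infinity_ennreal_def)
  have s: "a' + b' \<le> 2 * k" using ab a' b' k0 by (simp add: ennreal_plus[symmetric] del: ennreal_plus)
  \<comment> \<open>The arithmetic-geometric inequality converts the bound \<open>2 * k\<close> on
    the sum into \<open>k\<^sup>2\<close> on the product, and \<open>k\<^sup>2\<close> is the
    reciprocal of the normalizing factors \<open>\<alpha> * \<beta>\<close>.\<close>
  have "4 * (a' * b') \<le> (a' + b')\<^sup>2" using zero_le_power2[of "a' - b'"] by (simp add: power2_eq_square algebra_simps)
  also have "\<dots> \<le> (2 * k)\<^sup>2" using s a' b' by (intro power_mono) auto
  finally have "a' * b' \<le> k\<^sup>2" by (simp add: power2_eq_square)
  then have "\<alpha> * \<beta> * (a' * b') \<le> 1"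
    using k2 pos mult_left_mono[of "a'*b'" "k\<^sup>2" "\<alpha> * \<beta>"] by (simp add: mult.commute)
  moreover have "(\<integral>\<^sup>+ x. u x \<partial>gauss1) = ennreal (\<alpha> * a')"
  proof -
    have "(\<integral>\<^sup>+ x. u x \<partial>gauss1) = (\<integral>\<^sup>+ x. ennreal \<alpha> * ennreal (G0 x / \<alpha>) \<partial>lborel)"
      unfolding G0_def using pos ufin
      by (subst nn_integral_density) (auto intro!: nn_integral_cong simp: ennreal_mult'[symmetric] ennreal_mult mult.commute)
    also have "\<dots> = ennreal \<alpha> * a" unfolding a_def by (rule nn_integral_cmult) measurable
    finally show ?thesis using a' pos by (simp add: ennreal_mult)
  qed
  moreover have "(\<integral>\<^sup>+ x. v x \<partial>gauss1) = ennreal (\<beta> * b')"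
  proof -
    have "(\<integral>\<^sup>+ x. v x \<partial>gauss1) = (\<integral>\<^sup>+ x. ennreal \<beta> * ennreal (H0 x / \<beta>) \<partial>lborel)"
      unfolding H0_def using pos vfin
      by (subst nn_integral_density) (auto intro!: nn_integral_cong simp: ennreal_mult'[symmetric] ennreal_mult mult.commute)
    also have "\<dots> = ennreal \<beta> * b" unfolding b_def by (rule nn_integral_cmult) measurable
    finally show ?thesis using b' pos by (simp add: ennreal_mult)
  qed
  ultimately show ?thesis
    using a' b' pos by (simp add: ennreal_mult[symmetric] mult_ac)
qed

text \<open>The exponent is additive over coordinates, so the one-dimensional bound tensorizes.\<close>

lemma gauss_product_le_1:
  fixes u v :: "('i \<Rightarrow> real) \<Rightarrow> ennreal"
  assumes "finite I" "u \<in> borel_measurable (gaussPi I)" "v \<in> borel_measurable (gaussPi I)"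
    and "\<And>x y. x \<in> I \<rightarrow>\<^sub>E UNIV \<Longrightarrow> y \<in> I \<rightarrow>\<^sub>E UNIV \<Longrightarrow> u x * v y \<le> ennreal (exp ((\<Sum>i\<in>I. (x i - y i)\<^sup>2) / 4))"
  shows "(\<integral>\<^sup>+ x. u x \<partial>(gaussPi I)) * (\<integral>\<^sup>+ x. v x \<partial>(gaussPi I)) \<le> 1"
  using assms
proof (induction I arbitrary: u v rule: finite_induct)
  case empty
  interpret product_sigma_finite "\<lambda>_::'i. gauss1" by (rule product_sigma_finite_gauss1)
  show ?case using empty(3)[of "\<lambda>_. undefined" "\<lambda>_. undefined"]
    by (simp add: PiM_empty nn_integral_count_space_finite)
next
  case (insert j I)
  interpret product_sigma_finite "\<lambda>_::'i. gauss1" by (rule product_sigma_finite_gauss1)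
  note [measurable] = insert.prems(1,2)
  define U where "U a = (\<integral>\<^sup>+ x. u (x(j := a)) \<partial>(gaussPi I))" for a
  define V where "V a = (\<integral>\<^sup>+ x. v (x(j := a)) \<partial>(gaussPi I))" for a
  interpret PI: sigma_finite_measure "PiM I (\<lambda>_::'i. gauss1)"
    by (rule sigma_finite) (use insert in auto)
  have [measurable]: "U \<in> borel_measurable gauss1" "V \<in> borel_measurable gauss1"
    unfolding U_def V_def by measurable
  have *: "u (x(j := a)) * v (y(j := b)) \<le> ennreal (exp ((a - b)\<^sup>2 / 4)) * ennreal (exp ((\<Sum>i\<in>I. (x i - y i)\<^sup>2) / 4))"
    if "x \<in> I \<rightarrow>\<^sub>E UNIV" "y \<in> I \<rightarrow>\<^sub>E UNIV" for x y a b
  proof -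
    have 1: "u (x(j := a)) * v (y(j := b)) \<le> ennreal (exp ((\<Sum>i\<in>insert j I. ((x(j := a)) i - (y(j:=b)) i)\<^sup>2) / 4))"
      using that by (intro insert.prems(3) PiE_fun_upd) (auto simp: insert.hyps)
    have 2: "(\<Sum>i\<in>insert j I. ((x(j := a)) i - (y(j:=b)) i)\<^sup>2) = (a - b)\<^sup>2 + (\<Sum>i\<in>I. (x i - y i)\<^sup>2)"
      using insert.hyps by (simp, intro sum.cong) auto
    show ?thesis using 1 unfolding 2 add_divide_distrib exp_add by (simp add: ennreal_mult)
  qed
  have UV: "U a * V b \<le> ennreal (exp ((a - b)\<^sup>2 / 4))" for a b
  proof -
    \<comment> \<open>For fixed \<open>a\<close> and \<open>b\<close> the contribution of coordinate
      \<open>j\<close> is the constant \<open>E\<close>. Dividing \<open>u\<close> by it restores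
      the induction hypothesis, whose conclusion is the one-dimensional hypothesis for
      \<open>U\<close> and \<open>V\<close>.\<close>
    define E where "E = exp ((a - b)\<^sup>2 / 4)"
    have E0: "E > 0" by (simp add: E_def)
    have "(\<integral>\<^sup>+ x. ennreal (1/E) * u (x(j := a)) \<partial>(gaussPi I)) * (\<integral>\<^sup>+ x. v (x(j := b)) \<partial>(gaussPi I)) \<le> 1"
    proof (rule insert.IH)
      fix x y :: "'i \<Rightarrow> real" assume "x \<in> I \<rightarrow>\<^sub>E UNIV" "y \<in> I \<rightarrow>\<^sub>E UNIV"
      then have "ennreal (1/E) * (u (x(j := a)) * v (y(j := b))) \<le> ennreal (1/E) * (ennreal E * ennreal (exp ((\<Sum>i\<in>I. (x i - y i)\<^sup>2) / 4)))"
        unfolding E_def by (intro mult_left_mono *) auto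
      also have "\<dots> = ennreal (exp ((\<Sum>i\<in>I. (x i - y i)\<^sup>2) / 4))"
        using E0 by (simp add: ennreal_mult'[symmetric])
      finally show "ennreal (1/E) * u (x(j := a)) * v (y(j := b)) \<le> ennreal (exp ((\<Sum>i\<in>I. (x i - y i)\<^sup>2) / 4))"
        by (simp add: mult.assoc)
    qed measurable
    then have "ennreal (1/E) * (U a * V b) \<le> 1"
      unfolding U_def V_def by (subst (asm) nn_integral_cmult) (auto simp: mult.assoc)
    then have "ennreal E * (ennreal (1/E) * (U a * V b)) \<le> ennreal E * 1"
      by (rule mult_left_mono) auto
    moreover have "ennreal E * (ennreal (1/E) * (U a * V b)) = U a * V b"
      using E0 by (simp add: mult.assoc[symmetric] ennreal_mult'[symmetric])
    ultimately show ?thesis by (simp add: E_def)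
  qed
  have "(\<integral>\<^sup>+ a. U a \<partial>gauss1) * (\<integral>\<^sup>+ a. V a \<partial>gauss1) \<le> 1"
    by (rule gauss1_product_le_1[OF _ _ UV]) (use \<open>U \<in> _\<close> \<open>V \<in> _\<close> in simp_all)
  then show ?case
    using insert.hyps insert.prems by (simp add: product_nn_integral_insert_rev U_def V_def)
qed

section \<open>Deviation and moments of Lipschitz functions\<close>

lemma std_gaussian_eq: "std_gaussian n = gaussPi {..<n}"
  by (simp add: std_gaussian_def)

lemma space_std_gaussian [simp]: "space (std_gaussian n) = vec_space n"
  by (simp add: std_gaussian_def vec_space_def space_PiM)

lemma prob_space_std_gaussian: "prob_space (std_gaussian n)"
  unfolding std_gaussian_def by (intro prob_space_PiM prob_space_gauss1)

text \<open>Take \<open>v\<close> to be the indicator of the set where \<open>f\<close> is at most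
  \<open>r\<close>. By the Lipschitz condition, the excess of \<open>f x\<close> over
  \<open>r\<close> is at most the distance from \<open>x\<close> to any point of that set, so the
  product inequality applies; a mass of at least 1/2 costs the factor 2.\<close>

lemma gaussian_concentration:
  assumes [measurable]: "f \<in> borel_measurable (std_gaussian n)"
    and lip: "\<And>x y. x \<in> vec_space n \<Longrightarrow> y \<in> vec_space n \<Longrightarrow> f x - f y \<le> sqrt (\<Sum>i<n. (x i - y i)\<^sup>2)"
    and half: "emeasure (std_gaussian n) {x \<in> vec_space n. f x \<le> r} \<ge> ennreal (1 / 2)"
  shows "(\<integral>\<^sup>+ x. ennreal (exp ((max 0 (f x - r))\<^sup>2 / 4)) \<partial>std_gaussian n) \<le> 2"
proof -
  let ?I = "\<integral>\<^sup>+ x. ennreal (exp ((max 0 (f x - r))\<^sup>2 / 4)) \<partial>std_gaussian n"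
  let ?A = "{x \<in> vec_space n. f x \<le> r}"
  have [measurable]: "?A \<in> sets (std_gaussian n)"
    unfolding space_std_gaussian[symmetric] by measurable
  have "?I * (\<integral>\<^sup>+ x. indicator ?A x \<partial>std_gaussian n) \<le> 1"
    unfolding std_gaussian_eq
  proof (rule gauss_product_le_1)
    fix x y :: "nat \<Rightarrow> real" assume xy: "x \<in> {..<n} \<rightarrow>\<^sub>E UNIV" "y \<in> {..<n} \<rightarrow>\<^sub>E UNIV"
    then have xy': "x \<in> vec_space n" "y \<in> vec_space n" by (auto simp: vec_space_def)
    show "ennreal (exp ((max 0 (f x - r))\<^sup>2 / 4)) * indicator ?A y \<le> ennreal (exp ((\<Sum>i<n. (x i - y i)\<^sup>2) / 4))"
    proof (cases "y \<in> ?A")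
      case True
      then have "max 0 (f x - r) \<le> sqrt (\<Sum>i<n. (x i - y i)\<^sup>2)"
        using lip[OF xy'] by (auto simp: sum_nonneg)
      then have "(max 0 (f x - r))\<^sup>2 \<le> (sqrt (\<Sum>i<n. (x i - y i)\<^sup>2))\<^sup>2" by (intro power_mono) auto
      then show ?thesis using True by (auto simp: sum_nonneg intro!: ennreal_leI)
    qed simp
  qed (auto simp: std_gaussian_eq[symmetric])
  then have "?I * emeasure (std_gaussian n) ?A \<le> 1" by simp
  moreover have "?I * ennreal (1 / 2) \<le> ?I * emeasure (std_gaussian n) ?A"
    by (rule mult_left_mono[OF half]) simp
  ultimately have "?I * ennreal (1 / 2) \<le> 1" by (rule order_trans[rotated])
  then have "2 * (?I * ennreal (1 / 2)) \<le> 2 * 1" by (rule mult_left_mono) simp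
  moreover have "2 * (?I * ennreal (1 / 2)) = ?I"
  proof -
    have "(2::ennreal) * ennreal (1 / 2) = 1"
      using ennreal_mult'[of 2 "1 / 2", symmetric] by (simp only: ennreal_numeral) simp
    then show ?thesis by (simp only: mult.left_commute[of 2] mult_1_right)
  qed
  ultimately show ?thesis by simp
qed

text \<open>In logarithms, with \<open>w = z\<^sup>2 / s\<close>, the claim is
  \<open>ln w \<le> w / 2\<close>, which follows from the tangent of \<open>ln\<close> at 2.\<close>

lemma powr_le_exp_square:
  fixes z s :: real
  assumes "z \<ge> 0" "s > 0"
  shows "z powr s \<le> sqrt s powr s * exp (z\<^sup>2 / 4)"
proof (cases "z = 0")
  case False
  then have z: "z > 0" using assms by simp
  have "ln (z\<^sup>2 / s) \<le> z\<^sup>2 / s - 1" using z assms by (intro ln_le_minus_one) auto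
  moreover define w where "w = z\<^sup>2 / s"
  have w0: "w > 0" using z assms by (simp add: w_def)
  have "ln (w / 2) \<le> w / 2 - 1" using w0 by (intro ln_le_minus_one) auto
  then have "ln w \<le> w / 2 - 1 + ln 2" using w0 by (simp add: ln_div)
  then have "ln w \<le> w / 2" using ln_2_less_1 by simp
  then have "s / 2 * ln w \<le> s / 2 * (w / 2)" using assms by (intro mult_left_mono) auto
  then have "s / 2 * (2 * ln z - ln s) \<le> z\<^sup>2 / 4"
    using z assms by (simp add: w_def ln_div ln_realpow)
  then have "s * ln z \<le> s * (ln s / 2) + z\<^sup>2 / 4" by (simp add: field_simps)
  then show ?thesis
    using z assms by (simp add: powr_def ln_sqrt exp_add[symmetric])
qed (use assms in auto)

text \<open>Either \<open>r\<close> or the excess of \<open>f\<close> over \<open>r\<close> is at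
  least half of \<open>f\<close>, and the excess has a square-exponential moment. This bounds the
  moment by three times a power with base \<open>2 * (r + sqrt s)\<close>; the 3 moves into the base
  because \<open>3 \<le> 3 powr s\<close>.\<close>

lemma gaussian_moment_le:
  assumes [measurable]: "f \<in> borel_measurable (std_gaussian n)"
    and lip: "\<And>x y. x \<in> vec_space n \<Longrightarrow> y \<in> vec_space n \<Longrightarrow> f x - f y \<le> sqrt (\<Sum>i<n. (x i - y i)\<^sup>2)"
    and half: "emeasure (std_gaussian n) {x \<in> vec_space n. f x \<le> r} \<ge> ennreal (1 / 2)"
    and f0: "\<And>x. f x \<ge> 0" and r: "r \<ge> 0" and s: "s \<ge> 1"
  shows "(\<integral>\<^sup>+ x. ennreal (f x powr s) \<partial>std_gaussian n) \<le> ennreal ((6 * (r + sqrt s)) powr s)"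
proof -
  interpret prob_space "std_gaussian n" by (rule prob_space_std_gaussian)
  let ?a = "2 * (r + sqrt s)"
  have a0: "?a \<ge> 0" using r s by simp
  have pt: "f x powr s \<le> ?a powr s + ?a powr s * exp ((max 0 (f x - r))\<^sup>2 / 4)" for x
  proof -
    define z where "z = max 0 (f x - r)"
    have z0: "z \<ge> 0" by (simp add: z_def)
    have "f x \<le> 2 * r \<or> f x \<le> 2 * z" unfolding z_def max_def using r by auto
    then show ?thesis
    proof
      assume "f x \<le> 2 * r"
      then have "f x \<le> ?a" using s by (simp add: add_increasing2)
      then have "f x powr s \<le> ?a powr s" using s f0[of x] by (intro powr_mono2) auto
      then show ?thesis by (simp add: add_increasing2)
    next
      assume "f x \<le> 2 * z"
      then have "f x powr s \<le> (2 * z) powr s" using s f0[of x] by (intro powr_mono2) auto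
      also have "\<dots> = 2 powr s * z powr s" using z0 by (simp add: powr_mult)
      also have "\<dots> \<le> 2 powr s * (sqrt s powr s * exp (z\<^sup>2 / 4))"
        using s z0 by (intro mult_left_mono powr_le_exp_square) auto
      also have "\<dots> = (2 * sqrt s) powr s * exp (z\<^sup>2 / 4)" using s by (simp add: powr_mult)
      also have "\<dots> \<le> ?a powr s * exp (z\<^sup>2 / 4)" using s r by (intro mult_right_mono powr_mono2) auto
      finally show ?thesis unfolding z_def by (simp add: add_increasing)
    qed
  qed
  have "(\<integral>\<^sup>+ x. ennreal (f x powr s) \<partial>std_gaussian n) \<le>
      (\<integral>\<^sup>+ x. ennreal (?a powr s) + ennreal (?a powr s) * ennreal (exp ((max 0 (f x - r))\<^sup>2 / 4)) \<partial>std_gaussian n)"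
    using pt by (intro nn_integral_mono) (auto simp flip: ennreal_plus ennreal_mult' intro!: ennreal_leI)
  also have "\<dots> = ennreal (?a powr s) + ennreal (?a powr s) * (\<integral>\<^sup>+ x. ennreal (exp ((max 0 (f x - r))\<^sup>2 / 4)) \<partial>std_gaussian n)"
    by (subst nn_integral_add) (auto simp: nn_integral_cmult emeasure_space_1[unfolded space_std_gaussian])
  also have "\<dots> \<le> ennreal (?a powr s) + ennreal (?a powr s) * 2"
    by (intro add_left_mono mult_left_mono gaussian_concentration[OF assms(1) lip half]) auto
  also have "\<dots> = ennreal (3 * ?a powr s)"
    by (simp flip: ennreal_numeral ennreal_mult' ennreal_plus add: algebra_simps)
  also have "\<dots> \<le> ennreal (3 powr s * ?a powr s)"
    using s powr_mono[of 1 s 3] by (intro ennreal_leI mult_right_mono) auto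
  also have "3 powr s * ?a powr s = (6 * (r + sqrt s)) powr s"
    using r s by (simp add: powr_mult[symmetric])
  finally show ?thesis .
qed

section \<open>Translation of the Gaussian measure; exponential and second moments\<close>

lemma gauss1_shift:
  assumes [measurable]: "g \<in> borel_measurable borel"
  shows "(\<integral>\<^sup>+ x. g (x + a) \<partial>gauss1) = (\<integral>\<^sup>+ x. g x * ennreal (exp (a * x - a\<^sup>2 / 2)) \<partial>gauss1)"
proof -
  have "(\<integral>\<^sup>+ x. g x * ennreal (exp (a * x - a\<^sup>2 / 2)) \<partial>gauss1) =
     (\<integral>\<^sup>+ x. ennreal (std_normal_density x) * (g x * ennreal (exp (a * x - a\<^sup>2 / 2))) \<partial>lborel)"
    by (subst nn_integral_density) auto
  also have "\<dots> = (\<integral>\<^sup>+ x. ennreal (std_normal_density (a + x)) * (g (a + x) * ennreal (exp (a * (a + x) - a\<^sup>2 / 2))) \<partial>lborel)"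
    by (subst nn_integral_real_affine[where c=1 and t=a]) auto
  also have "\<dots> = (\<integral>\<^sup>+ x. ennreal (std_normal_density x) * g (x + a) \<partial>lborel)"
  proof (rule nn_integral_cong)
    fix x
    have "std_normal_density (a + x) * exp (a * (a + x) - a\<^sup>2 / 2) = std_normal_density x"
      unfolding std_normal_density_def by (simp add: exp_add[symmetric] field_simps power2_eq_square)
    then have "ennreal (std_normal_density (a + x)) * ennreal (exp (a * (a + x) - a\<^sup>2 / 2)) = ennreal (std_normal_density x)"
      by (simp flip: ennreal_mult')
    then show "ennreal (std_normal_density (a + x)) * (g (a + x) * ennreal (exp (a * (a + x) - a\<^sup>2 / 2))) =
        ennreal (std_normal_density x) * g (x + a)"
      by (metis mult.assoc mult.commute add.commute)
  qed
  also have "\<dots> = (\<integral>\<^sup>+ x. g (x + a) \<partial>gauss1)"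
    by (subst nn_integral_density) auto
  finally show ?thesis by simp
qed

text \<open>The Cameron-Martin formula. The exponential is the ratio of the translated to the
  original density and is a product over coordinates, hence the induction.\<close>

lemma gauss_shift:
  assumes "finite I" "g \<in> borel_measurable (gaussPi I)"
  shows "(\<integral>\<^sup>+ x. g (\<lambda>i\<in>I. x i + v i) \<partial>(gaussPi I)) =
         (\<integral>\<^sup>+ x. g x * ennreal (exp (\<Sum>i\<in>I. v i * x i - (v i)\<^sup>2 / 2)) \<partial>(gaussPi I))"
  using assms
proof (induction I arbitrary: g rule: finite_induct)
  case empty
  show ?case by (simp add: PiM_empty nn_integral_count_space_finite restrict_def)
next
  case (insert j I)
  interpret product_sigma_finite "\<lambda>_::'a. gauss1" by (rule product_sigma_finite_gauss1)
  interpret PI: sigma_finite_measure "PiM I (\<lambda>_::'a. gauss1)"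
    by (rule sigma_finite) (use insert in auto)
  note [measurable] = insert.prems(1)
  have [measurable]: "(\<lambda>x. \<lambda>i\<in>insert j I. x i + v i) \<in> measurable (gaussPi (insert j I)) (gaussPi (insert j I))"
    by (rule measurable_restrict) simp
  have "(\<integral>\<^sup>+ x. g (\<lambda>i\<in>insert j I. x i + v i) \<partial>(gaussPi (insert j I))) =
     (\<integral>\<^sup>+ y. (\<integral>\<^sup>+ x. g (\<lambda>i\<in>insert j I. (x(j := y)) i + v i) \<partial>(gaussPi I)) \<partial>gauss1)"
    using insert.hyps by (subst product_nn_integral_insert_rev) auto
  also have "\<dots> = (\<integral>\<^sup>+ y. (\<integral>\<^sup>+ x. g ((\<lambda>i\<in>I. x i + v i)(j := y + v j)) \<partial>(gaussPi I)) \<partial>gauss1)"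
    using insert.hyps by (intro nn_integral_cong arg_cong[where f=g]) (auto simp: fun_eq_iff)
  also have "\<dots> = (\<integral>\<^sup>+ y. (\<integral>\<^sup>+ x. g (x(j := y + v j)) * ennreal (exp (\<Sum>i\<in>I. v i * x i - (v i)\<^sup>2 / 2)) \<partial>(gaussPi I)) \<partial>gauss1)"
    by (intro nn_integral_cong insert.IH[of "\<lambda>x. g (x(j := y + v j))" for y]) measurable
  also have "\<dots> = (\<integral>\<^sup>+ y. (\<integral>\<^sup>+ x. g (x(j := y)) * ennreal (exp (\<Sum>i\<in>I. v i * x i - (v i)\<^sup>2 / 2)) \<partial>(gaussPi I)) *
       ennreal (exp (v j * y - (v j)\<^sup>2 / 2)) \<partial>gauss1)"
    by (rule gauss1_shift) measurable
  also have "\<dots> = (\<integral>\<^sup>+ y. (\<integral>\<^sup>+ x. g (x(j := y)) * ennreal (exp (\<Sum>i\<in>insert j I. v i * (x(j := y)) i - (v i)\<^sup>2 / 2)) \<partial>(gaussPi I)) \<partial>gauss1)"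
  proof (rule nn_integral_cong)
    fix y
    have s: "(\<Sum>i\<in>insert j I. v i * (x(j := y)) i - (v i)\<^sup>2 / 2) = (\<Sum>i\<in>I. v i * x i - (v i)\<^sup>2 / 2) + (v j * y - (v j)\<^sup>2 / 2)" for x
      using insert.hyps by (simp add: add.commute, intro sum.cong) auto
    show "(\<integral>\<^sup>+ x. g (x(j := y)) * ennreal (exp (\<Sum>i\<in>I. v i * x i - (v i)\<^sup>2 / 2)) \<partial>(gaussPi I)) * ennreal (exp (v j * y - (v j)\<^sup>2 / 2)) =
      (\<integral>\<^sup>+ x. g (x(j := y)) * ennreal (exp (\<Sum>i\<in>insert j I. v i * (x(j := y)) i - (v i)\<^sup>2 / 2)) \<partial>(gaussPi I))"
      unfolding s exp_add by (subst nn_integral_multc[symmetric]) (auto simp: ennreal_mult mult.assoc)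
  qed
  also have "\<dots> = (\<integral>\<^sup>+ x. g x * ennreal (exp (\<Sum>i\<in>insert j I. v i * x i - (v i)\<^sup>2 / 2)) \<partial>(gaussPi (insert j I)))"
    using insert.hyps by (subst product_nn_integral_insert_rev) auto
  finally show ?case .
qed

text \<open>The shift formula for the constant function 1 says that the Cameron-Martin density has
  mean 1.\<close>

lemma gauss_exp_linear:
  assumes "finite I"
  shows "(\<integral>\<^sup>+ x. ennreal (exp (\<Sum>i\<in>I. v i * x i)) \<partial>(gaussPi I)) = ennreal (exp ((\<Sum>i\<in>I. (v i)\<^sup>2) / 2))"
proof -
  interpret prob_space "gaussPi I" by (intro prob_space_PiM prob_space_gauss1)
  have "1 = (\<integral>\<^sup>+ x. ennreal (exp (\<Sum>i\<in>I. v i * x i - (v i)\<^sup>2 / 2)) \<partial>(gaussPi I))"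
    using gauss_shift[OF assms, of "\<lambda>_. 1" v] by (simp add: emeasure_space_1)
  also have "\<dots> = (\<integral>\<^sup>+ x. ennreal (exp (\<Sum>i\<in>I. v i * x i)) * ennreal (exp (- ((\<Sum>i\<in>I. (v i)\<^sup>2) / 2))) \<partial>(gaussPi I))"
    by (intro nn_integral_cong)
       (simp add: ennreal_mult'[symmetric] exp_add[symmetric] sum_subtractf sum_divide_distrib)
  also have "\<dots> = (\<integral>\<^sup>+ x. ennreal (exp (\<Sum>i\<in>I. v i * x i)) \<partial>(gaussPi I)) * ennreal (exp (- ((\<Sum>i\<in>I. (v i)\<^sup>2) / 2)))"
    by (rule nn_integral_multc) measurable
  finally have *: "1 = (\<integral>\<^sup>+ x. ennreal (exp (\<Sum>i\<in>I. v i * x i)) \<partial>(gaussPi I)) *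
      ennreal (exp (- ((\<Sum>i\<in>I. (v i)\<^sup>2) / 2)))" .
  have "ennreal (exp ((\<Sum>i\<in>I. (v i)\<^sup>2) / 2)) = 1 * ennreal (exp ((\<Sum>i\<in>I. (v i)\<^sup>2) / 2))" by simp
  also have "\<dots> = (\<integral>\<^sup>+ x. ennreal (exp (\<Sum>i\<in>I. v i * x i)) \<partial>(gaussPi I)) *
      (ennreal (exp (- ((\<Sum>i\<in>I. (v i)\<^sup>2) / 2))) * ennreal (exp ((\<Sum>i\<in>I. (v i)\<^sup>2) / 2)))"
    by (subst *) (simp only: mult.assoc)
  also have "ennreal (exp (- ((\<Sum>i\<in>I. (v i)\<^sup>2) / 2))) * ennreal (exp ((\<Sum>i\<in>I. (v i)\<^sup>2) / 2)) = 1"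
    by (simp flip: ennreal_mult' exp_add)
  finally show ?thesis by simp
qed

lemma gauss1_second_moment: "(\<integral>\<^sup>+ x. ennreal (x\<^sup>2) \<partial>gauss1) = 1"
proof -
  have "(\<integral>\<^sup>+ x. ennreal (x\<^sup>2) \<partial>gauss1) = (\<integral>\<^sup>+ x. ennreal (std_normal_density x * x ^ (2 * 1)) \<partial>lborel)"
    by (subst nn_integral_density) (auto simp: ennreal_mult')
  also have "\<dots> = 1"
    using std_normal_moment_even[of 1] by (subst has_bochner_integral_iff[THEN nn_integral_eq_integral[OF conjunct1[OF iffD1]]]) (auto simp: has_bochner_integral_iff)
  finally show ?thesis .
qed

lemma gauss_component_second_moment:
  assumes "finite I" "i \<in> I"
  shows "(\<integral>\<^sup>+ x. ennreal ((x i)\<^sup>2) \<partial>(gaussPi I)) = 1"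
proof -
  interpret product_sigma_finite "\<lambda>_::'a. gauss1" by (rule product_sigma_finite_gauss1)
  interpret P: prob_space gauss1 by (rule prob_space_gauss1)
  have "(\<integral>\<^sup>+ x. ennreal ((x i)\<^sup>2) \<partial>(gaussPi I)) =
        (\<integral>\<^sup>+ x. (\<Prod>j\<in>I. (if j = i then ennreal ((x j)\<^sup>2) else 1)) \<partial>(gaussPi I))"
    using assms by (intro nn_integral_cong) (simp add: prod.delta)
  also have "\<dots> = (\<Prod>j\<in>I. (\<integral>\<^sup>+ x. (if j = i then ennreal (x\<^sup>2) else 1) \<partial>gauss1))"
    using assms by (intro product_nn_integral_prod[where f="\<lambda>j y. if j = i then ennreal (y\<^sup>2) else 1"]) auto
  also have "\<dots> = 1"
  proof (intro prod.neutral ballI)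
    fix j assume "j \<in> I"
    show "(\<integral>\<^sup>+ x. (if j = i then ennreal (x\<^sup>2) else 1) \<partial>gauss1) = 1"
      using P.emeasure_space_1 by (cases "j = i") (simp_all add: gauss1_second_moment)
  qed
  finally show ?thesis .
qed

lemma std_gaussian_norm_second_moment:
  "(\<integral>\<^sup>+ x. ennreal (\<Sum>i<n. (x i)\<^sup>2) \<partial>std_gaussian n) = of_nat n"
proof -
  have "(\<integral>\<^sup>+ x. ennreal (\<Sum>i<n. (x i)\<^sup>2) \<partial>std_gaussian n) = (\<integral>\<^sup>+ x. (\<Sum>i<n. ennreal ((x i)\<^sup>2)) \<partial>std_gaussian n)"
    by (intro nn_integral_cong) simp
  also have "\<dots> = (\<Sum>i<n. (\<integral>\<^sup>+ x. ennreal ((x i)\<^sup>2) \<partial>std_gaussian n))"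
    unfolding std_gaussian_eq by (intro nn_integral_sum) measurable
  also have "\<dots> = of_nat n"
    unfolding std_gaussian_eq by (simp add: gauss_component_second_moment)
  finally show ?thesis .
qed

section \<open>Metric projections\<close>

lemma vec_norm_diff_eq: "vec_norm n (\<lambda>i\<in>{..<n}. x i - y i) = sqrt (\<Sum>i<n. (x i - y i)\<^sup>2)"
  by (simp add: vec_norm_def L2_set_def)


lemma closed_convex_sets_subset: "C \<in> closed_convex_sets n \<Longrightarrow> C \<subseteq> vec_space n"
  by (simp add: closed_convex_sets_def)

lemma zero_in_closed_convex_sets: "C \<in> closed_convex_sets n \<Longrightarrow> vec_zero n \<in> C"
  by (simp add: closed_convex_sets_def)

lemma closed_convex_sets_combination:
  assumes "C \<in> closed_convex_sets n" "x \<in> C" "y \<in> C" "0 \<le> u" "u \<le> 1"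
  shows "(\<lambda>i\<in>{..<n}. (1 - u) * x i + u * y i) \<in> C"
proof -
  have "vec_convex n C" using assms(1) by (simp add: closed_convex_sets_def)
  then show ?thesis using assms unfolding vec_convex_def
    by (metis add.commute diff_add_cancel diff_ge_0_iff_ge)
qed

lemma closed_convex_sets_scale:
  assumes "C \<in> closed_convex_sets n" "x \<in> C" "0 \<le> u" "u \<le> 1"
  shows "(\<lambda>i\<in>{..<n}. u * x i) \<in> C"
proof -
  have "(\<lambda>i\<in>{..<n}. (1 - u) * vec_zero n i + u * x i) \<in> C"
    by (rule closed_convex_sets_combination[OF assms(1) zero_in_closed_convex_sets[OF assms(1)] assms(2-4)])
  moreover have "(\<lambda>i\<in>{..<n}. (1 - u) * vec_zero n i + u * x i) = (\<lambda>i\<in>{..<n}. u * x i)"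
    by (auto simp: vec_zero_def fun_eq_iff restrict_def)
  ultimately show ?thesis by simp
qed

lemma vec_norm_scale: "u \<ge> 0 \<Longrightarrow> vec_norm n (\<lambda>i\<in>{..<n}. u * x i) = u * vec_norm n x"
  by (simp add: vec_norm_def L2_set_def power_mult_distrib sum_distrib_left[symmetric] real_sqrt_mult)

lemma vec_norm_nonneg [simp]: "vec_norm n x \<ge> 0"
  by (simp add: vec_norm_def)

lemma vec_norm_square: "(vec_norm n x)\<^sup>2 = (\<Sum>i<n. (x i)\<^sup>2)"
  by (simp add: vec_norm_def L2_set_def sum_nonneg)

lemma vec_inner_le: "(\<Sum>i<n. x i * y i) \<le> vec_norm n x * vec_norm n y"
proof -
  have "(\<Sum>i<n. x i * y i) \<le> (\<Sum>i<n. \<bar>x i\<bar> * \<bar>y i\<bar>)"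
    by (intro sum_mono) (metis abs_ge_self abs_mult)
  also have "\<dots> \<le> vec_norm n x * vec_norm n y"
    unfolding vec_norm_def by (rule L2_set_mult_ineq)
  finally show ?thesis .
qed

text \<open>\<open>metric_proj\<close> is defined by choice, so nothing can be said about it before
  a minimizer is known. Only competitors at least as close to \<open>x\<close> as the origin matter;
  they lie in the compact box \<open>K\<close>, where the continuous squared distance attains its
  minimum.\<close>

lemma metric_proj_exists:
  assumes C: "C \<in> closed_convex_sets n"
  shows "\<exists>p\<in>C. \<forall>y\<in>C. vec_norm n (\<lambda>i\<in>{..<n}. x i - p i) \<le> vec_norm n (\<lambda>i\<in>{..<n}. x i - y i)"
proof -
  let ?T = "product_topology (\<lambda>_. euclideanreal) {..<n}"
  let ?d = "\<lambda>y. \<Sum>i<n. (x i - y i)\<^sup>2"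
  define R where "R = sqrt (?d (vec_zero n))"
  define K where "K = PiE {..<n} (\<lambda>i. {x i - R..x i + R})"
  have inK: "y \<in> K" if "y \<in> C" "?d y \<le> ?d (vec_zero n)" for y
  proof -
    have "\<bar>x i - y i\<bar> \<le> R" if i: "i < n" for i
    proof -
      have "(x i - y i)\<^sup>2 \<le> ?d y" using i by (intro member_le_sum) auto
      then show ?thesis using \<open>?d y \<le> _\<close> unfolding R_def by (intro real_le_rsqrt) (simp add: power2_abs)
    qed
    moreover have "y \<in> vec_space n" using closed_convex_sets_subset[OF C] that by blast
    ultimately show ?thesis by (fastforce simp: K_def vec_space_def PiE_iff abs_le_iff)
  qed
  have "compactin ?T K"
    unfolding K_def by (subst compactin_PiE) auto
  moreover have "closedin ?T C" using C by (simp add: closed_convex_sets_def)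
  ultimately have "compactin ?T (C \<inter> K)" by (rule closed_Int_compactin[rotated])
  moreover have "continuous_map ?T euclideanreal ?d"
    by (intro continuous_map_sum continuous_map_real_pow continuous_map_diff continuous_map_product_projection) auto
  ultimately have "compactin euclideanreal (?d ` (C \<inter> K))" by (rule image_compactin)
  then have cpt: "compact (?d ` (C \<inter> K))" by simp
  have z: "vec_zero n \<in> C \<inter> K" using zero_in_closed_convex_sets[OF C] inK by blast
  obtain p where p: "p \<in> C \<inter> K" "\<And>y. y \<in> C \<inter> K \<Longrightarrow> ?d p \<le> ?d y"
    using compact_attains_inf[OF cpt] z by blast
  have "?d p \<le> ?d y" if "y \<in> C" for y
  proof (cases "?d y \<le> ?d (vec_zero n)")
    case True
    then show ?thesis using p(2) inK that by blast
  next
    case False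
    then show ?thesis using p(2)[OF z] by linarith
  qed
  then show ?thesis using p(1) by (auto simp: vec_norm_def L2_set_def)
qed

lemma metric_proj_is_arg_min:
  assumes C: "C \<in> closed_convex_sets n"
  shows "is_arg_min (\<lambda>y. vec_norm n (\<lambda>i\<in>{..<n}. x i - y i)) (\<lambda>y. y \<in> C) (metric_proj n C x)"
proof -
  obtain p where "p \<in> C" "\<forall>y\<in>C. vec_norm n (\<lambda>i\<in>{..<n}. x i - p i) \<le> vec_norm n (\<lambda>i\<in>{..<n}. x i - y i)"
    using metric_proj_exists[OF C, of x] by blast
  then have "is_arg_min (\<lambda>y. vec_norm n (\<lambda>i\<in>{..<n}. x i - y i)) (\<lambda>y. y \<in> C) p"
    unfolding is_arg_min_def by (meson not_less)
  then show ?thesis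
    unfolding metric_proj_def arg_min_on_def arg_min_def
    by (rule someI[where P="is_arg_min (\<lambda>y. vec_norm n (\<lambda>i\<in>{..<n}. x i - y i)) (\<lambda>y. y \<in> C)"])
qed

lemma metric_proj_in: "C \<in> closed_convex_sets n \<Longrightarrow> metric_proj n C x \<in> C"
  using metric_proj_is_arg_min[of C n x] by (simp add: is_arg_min_def)

lemma metric_proj_le:
  "C \<in> closed_convex_sets n \<Longrightarrow> y \<in> C \<Longrightarrow>
   (\<Sum>i<n. (x i - metric_proj n C x i)\<^sup>2) \<le> (\<Sum>i<n. (x i - y i)\<^sup>2)"
  using metric_proj_is_arg_min[of C n x] unfolding is_arg_min_def vec_norm_diff_eq
  by (meson not_less real_sqrt_le_iff)

text \<open>First-order optimality: moving from the projection a fraction \<open>u\<close> towards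
  \<open>z\<close> stays in \<open>C\<close> and must not decrease the distance, so
  \<open>2 * A \<le> u * B\<close> for all small \<open>u\<close>.\<close>

lemma metric_proj_variational:
  assumes C: "C \<in> closed_convex_sets n" and z: "z \<in> C"
  shows "(\<Sum>i<n. (x i - metric_proj n C x i) * (z i - metric_proj n C x i)) \<le> 0"
proof (rule ccontr)
  define p where "p = metric_proj n C x"
  define A where "A = (\<Sum>i<n. (x i - p i) * (z i - p i))"
  define B where "B = (\<Sum>i<n. (z i - p i)\<^sup>2)"
  assume "\<not> ?thesis"
  then have A: "A > 0" by (simp add: A_def p_def)
  have B: "B \<ge> 0" by (simp add: B_def sum_nonneg)
  have key: "2 * A \<le> u * B" if u: "0 < u" "u \<le> 1" for u
  proof -
    have "(\<lambda>i\<in>{..<n}. (1 - u) * p i + u * z i) \<in> C"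
      using u metric_proj_in[OF C] by (intro closed_convex_sets_combination[OF C _ z]) (auto simp: p_def)
    then have "(\<Sum>i<n. (x i - p i)\<^sup>2) \<le> (\<Sum>i<n. (x i - ((1 - u) * p i + u * z i))\<^sup>2)"
      unfolding p_def using metric_proj_le[OF C] by fastforce
    also have "\<dots> = (\<Sum>i<n. (x i - p i)\<^sup>2 - 2 * u * ((x i - p i) * (z i - p i)) + u\<^sup>2 * (z i - p i)\<^sup>2)"
      by (intro sum.cong refl) (simp add: power2_eq_square algebra_simps)
    also have "\<dots> = (\<Sum>i<n. (x i - p i)\<^sup>2) - 2 * u * A + u\<^sup>2 * B"
      by (simp add: A_def B_def sum.distrib sum_subtractf sum_distrib_left)
    finally have "u * (2 * A) \<le> u * (u * B)" by (simp add: power2_eq_square)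
    then show ?thesis using u by (simp add: mult_le_cancel_left)
  qed
  \<comment> \<open>This choice of \<open>u\<close> makes \<open>u * B\<close> at most
    \<open>A\<close>, against \<open>A > 0\<close>.\<close>
  have "2 * A \<le> min 1 (A / (B + 1)) * B"
    using A B by (intro key) auto
  also have "\<dots> \<le> A / (B + 1) * B" using B by (intro mult_right_mono) auto
  also have "\<dots> \<le> A" using A B by (simp add: field_simps)
  finally show False using A by simp
qed

lemma vec_norm_triangle_diff: "vec_norm n x - vec_norm n y \<le> vec_norm n (\<lambda>i. x i - y i)"
  using L2_set_triangle_ineq[of "\<lambda>i. x i - y i" y "{..<n}"] by (simp add: vec_norm_def)

text \<open>Adding the variational inequalities at \<open>x\<close> and at \<open>y\<close>, each
  tested with the other projection, shows that the projection itself is nonexpansive; the triangle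
  inequality passes to norms.\<close>

lemma metric_proj_norm_lipschitz:
  assumes C: "C \<in> closed_convex_sets n"
  shows "vec_norm n (metric_proj n C x) - vec_norm n (metric_proj n C y) \<le> sqrt (\<Sum>i<n. (x i - y i)\<^sup>2)"
proof -
  define p q where "p = metric_proj n C x" and "q = metric_proj n C y"
  have "(\<Sum>i<n. (x i - p i) * (q i - p i)) \<le> 0" "(\<Sum>i<n. (y i - q i) * (p i - q i)) \<le> 0"
    unfolding p_def q_def by (intro metric_proj_variational[OF C] metric_proj_in[OF C])+
  then have "(\<Sum>i<n. (x i - p i) * (q i - p i) + (y i - q i) * (p i - q i)) \<le> 0" by (simp add: sum.distrib)
  also have "(\<Sum>i<n. (x i - p i) * (q i - p i) + (y i - q i) * (p i - q i)) =
     (\<Sum>i<n. (p i - q i)\<^sup>2 - (x i - y i) * (p i - q i))"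
    by (intro sum.cong refl) (simp add: power2_eq_square algebra_simps)
  finally have "(vec_norm n (\<lambda>i. p i - q i))\<^sup>2 \<le> (\<Sum>i<n. (x i - y i) * (p i - q i))"
    by (simp add: sum_subtractf vec_norm_square)
  also have "\<dots> \<le> vec_norm n (\<lambda>i. x i - y i) * vec_norm n (\<lambda>i. p i - q i)" by (rule vec_inner_le)
  finally have "vec_norm n (\<lambda>i. p i - q i) \<le> vec_norm n (\<lambda>i. x i - y i)"
    using vec_norm_nonneg[of n "\<lambda>i. p i - q i"] vec_norm_nonneg[of n "\<lambda>i. x i - y i"]
    by (metis mult_right_le_imp_le order_le_less power2_eq_square)
  then show ?thesis
    using vec_norm_triangle_diff[of n p q] unfolding p_def q_def
    by (simp add: vec_norm_def L2_set_def del: real_sqrt_le_iff)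
qed

text \<open>The carrier consists of functions that are \<open>undefined\<close> beyond
  \<open>n\<close>, whereas Borel measurability from continuity is at hand on all of
  \<open>nat \<Rightarrow> real\<close>. So \<open>f\<close> is extended by restricting the
  argument, the extension is continuous for the product topology, and padding with zeros pulls it
  back.\<close>

lemma lipschitz_measurable_std_gaussian:
  fixes f :: "(nat \<Rightarrow> real) \<Rightarrow> real"
  assumes lip: "\<And>x y. x \<in> vec_space n \<Longrightarrow> y \<in> vec_space n \<Longrightarrow> f x - f y \<le> sqrt (\<Sum>i<n. (x i - y i)\<^sup>2)"
  shows "f \<in> borel_measurable (std_gaussian n)"
proof -
  define g where "g z = f (restrict z {..<n})" for z :: "nat \<Rightarrow> real"
  have g: "\<bar>g z - g x\<bar> \<le> sqrt (\<Sum>i<n. (z i - x i)\<^sup>2)" for x z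
  proof -
    have "restrict x {..<n} \<in> vec_space n" "restrict z {..<n} \<in> vec_space n" by (auto simp: vec_space_def)
    from lip[OF this] lip[OF this(2,1)] show ?thesis
      unfolding g_def by (auto simp: abs_le_iff power2_commute)
  qed
  have "continuous_on UNIV g"
    unfolding continuous_on_def
  proof
    fix x :: "nat \<Rightarrow> real"
    have "continuous_on UNIV (\<lambda>z::nat \<Rightarrow> real. sqrt (\<Sum>i<n. (z i - x i)\<^sup>2))"
      by (intro continuous_intros continuous_on_product_coordinates)
    then have "((\<lambda>z::nat \<Rightarrow> real. sqrt (\<Sum>i<n. (z i - x i)\<^sup>2)) \<longlongrightarrow> sqrt (\<Sum>i<n. (x i - x i)\<^sup>2)) (at x within UNIV)"
      unfolding continuous_on_def by blast
    then have "((\<lambda>z::nat \<Rightarrow> real. sqrt (\<Sum>i<n. (z i - x i)\<^sup>2)) \<longlongrightarrow> 0) (at x within UNIV)" by simp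
    then have "((\<lambda>z. g z - g x) \<longlongrightarrow> 0) (at x within UNIV)"
      by (rule Lim_null_comparison[rotated]) (use g in auto)
    then show "(g \<longlongrightarrow> g x) (at x within UNIV)" by (simp add: LIM_zero_iff)
  qed
  then have [measurable]: "g \<in> borel_measurable borel" by (rule borel_measurable_continuous_onI)
  have "(\<lambda>x i. if i < n then x i else 0) \<in> borel_measurable (std_gaussian n)"
  proof (rule measurable_coordinatewise_then_product)
    fix i show "(\<lambda>x. if i < n then x i else 0) \<in> borel_measurable (std_gaussian n)"
      unfolding std_gaussian_def by (cases "i < n") auto
  qed
  then have "(\<lambda>x. g (\<lambda>i. if i < n then x i else 0)) \<in> borel_measurable (std_gaussian n)" by measurable
  also have "?this \<longleftrightarrow> f \<in> borel_measurable (std_gaussian n)"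
    by (rule measurable_cong)
       (auto simp: g_def std_gaussian_def space_PiM PiE_iff extensional_def restrict_def intro!: arg_cong[where f=f])
  finally show ?thesis .
qed

lemma metric_proj_norm_measurable:
  "C \<in> closed_convex_sets n \<Longrightarrow> (\<lambda>x. vec_norm n (metric_proj n C x)) \<in> borel_measurable (std_gaussian n)"
  by (intro lipschitz_measurable_std_gaussian metric_proj_norm_lipschitz)

text \<open>If the projection of \<open>x + t y / \<parallel>y\<parallel>\<close> is short, then its inner product with \<open>x\<close> is of order
  \<open>\<parallel>y\<parallel> t\<close>, because moving towards \<open>y\<close> must not improve it; hence so is \<open>\<parallel>\<Pi> x\<parallel> \<parallel>x\<parallel>\<close>.\<close>

lemma metric_proj_dichotomy:
  assumes C: "C \<in> closed_convex_sets n" and y: "y \<in> C" and b: "vec_norm n y = b" "b > 0" and t: "t > 0"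
    and xe: "(\<Sum>i<n. x i * (y i / b)) \<ge> - t / 2"
    and small: "vec_norm n (metric_proj n C (\<lambda>i\<in>{..<n}. x i + t * (y i / b))) \<le> min b t / 8"
  shows "b * t / 8 \<le> vec_norm n (metric_proj n C x) * vec_norm n x"
proof -
  define z where "z = (\<lambda>i\<in>{..<n}. x i + t * (y i / b))"
  define p where "p = metric_proj n C z"
  define k where "k = min b t / 8"
  define q where "q = metric_proj n C x"
  have pk: "vec_norm n p \<le> k" using small by (simp add: p_def z_def k_def)
  have k0: "k \<ge> 0" using b t by (simp add: k_def)
  \<comment> \<open>The factor 1/8 in \<open>k\<close> serves here: the two error terms
    \<open>k * b\<close> and \<open>t * k\<close> below together use at most half of the gain
    \<open>b * t / 2\<close>.\<close>
  have kb: "k * (b + t) \<le> b * t / 4"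
  proof -
    have "k * (b + t) \<le> k * (2 * max b t)" using k0 by (intro mult_left_mono) auto
    also have "\<dots> = b * t / 4" by (simp add: k_def min_def max_def)
    finally show ?thesis .
  qed
  have kk: "k * k \<le> b * t / 64"
  proof -
    have "k * k \<le> (b / 8) * (t / 8)" using k0 b t by (intro mult_mono) (auto simp: k_def)
    then show ?thesis by simp
  qed
  have ip: "(\<Sum>i<n. p i * y i) \<le> k * b"
    using vec_inner_le[of p y n] pk b by (smt (verit) mult_right_mono)
  have pp: "(\<Sum>i<n. p i * y i) / b \<le> k"
    using ip b by (simp add: field_simps)
  \<comment> \<open>Testing the projection of the shifted point with \<open>y\<close> makes its
    inner product with \<open>z\<close>, and after removal of the shift also with \<open>x\<close>,
    of order \<open>b * t\<close>.\<close>
  have "(\<Sum>i<n. (z i - p i) * (y i - p i)) \<le> 0"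
    unfolding p_def by (rule metric_proj_variational[OF C y])
  also have "(\<Sum>i<n. (z i - p i) * (y i - p i)) =
     (\<Sum>i<n. z i * y i) - (\<Sum>i<n. p i * y i) - (\<Sum>i<n. z i * p i) + (\<Sum>i<n. (p i)\<^sup>2)"
    unfolding sum_subtractf[symmetric] sum.distrib[symmetric]
    by (intro sum.cong refl) (simp add: power2_eq_square algebra_simps)
  finally have zp: "(\<Sum>i<n. z i * p i) \<ge> (\<Sum>i<n. z i * y i) - k * b"
    using ip sum_nonneg[of "{..<n}" "\<lambda>i. (p i)\<^sup>2"] by simp
  have yy: "(\<Sum>i<n. y i * y i) = b\<^sup>2" using vec_norm_square[of n y] b by (simp add: power2_eq_square)
  have "(\<Sum>i<n. z i * y i) = (\<Sum>i<n. b * (x i * (y i / b)) + t / b * (y i * y i))"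
    unfolding z_def using b by (intro sum.cong refl) (simp add: field_simps)
  also have "\<dots> = b * (\<Sum>i<n. x i * (y i / b)) + t * b"
    unfolding sum.distrib sum_distrib_left[symmetric] yy using b by (simp add: power2_eq_square)
  finally have zy: "(\<Sum>i<n. z i * y i) \<ge> b * t / 2"
    using mult_left_mono[OF xe, of b] b by (simp add: algebra_simps)
  have "(\<Sum>i<n. z i * p i) = (\<Sum>i<n. x i * p i + t * (p i * y i / b))"
    unfolding z_def using b by (intro sum.cong refl) (simp add: field_simps)
  also have "\<dots> = (\<Sum>i<n. x i * p i) + t * ((\<Sum>i<n. p i * y i) / b)"
    by (simp add: sum.distrib sum_distrib_left sum_divide_distrib)
  finally have "(\<Sum>i<n. z i * p i) \<le> (\<Sum>i<n. x i * p i) + t * k"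
    using mult_left_mono[OF pp, of t] t by simp
  with zp zy kb have xp: "(\<Sum>i<n. x i * p i) \<ge> b * t / 4" by (simp add: algebra_simps)
  \<comment> \<open>Now \<open>p\<close> serves as a test point for the projection \<open>q\<close>
    of the unshifted \<open>x\<close>; this transfers the lower bound on the inner product of
    \<open>x\<close> and \<open>p\<close> to the norm of \<open>q\<close>.\<close>
  have "(\<Sum>i<n. (x i - q i) * (p i - q i)) \<le> 0"
    unfolding q_def p_def by (rule metric_proj_variational[OF C metric_proj_in[OF C]])
  also have "(\<Sum>i<n. (x i - q i) * (p i - q i)) =
     (\<Sum>i<n. x i * p i) - (\<Sum>i<n. q i * p i) - (\<Sum>i<n. q i * x i) + (\<Sum>i<n. (q i)\<^sup>2)"
    unfolding sum_subtractf[symmetric] sum.distrib[symmetric]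
    by (intro sum.cong refl) (simp add: power2_eq_square algebra_simps)
  finally have "(\<Sum>i<n. x i * p i) \<le> (\<Sum>i<n. q i * p i) + (\<Sum>i<n. q i * x i) - (vec_norm n q)\<^sup>2"
    by (simp add: vec_norm_square)
  also have "\<dots> \<le> vec_norm n q * k + vec_norm n q * vec_norm n x - (vec_norm n q)\<^sup>2"
    using vec_inner_le[of q p n] vec_inner_le[of q x n] mult_left_mono[OF pk, of "vec_norm n q"] by simp
  also have "\<dots> \<le> k * k + vec_norm n q * vec_norm n x"
  proof -
    have "vec_norm n q * k - (vec_norm n q)\<^sup>2 \<le> k * k"
      using sum_squares_ge_zero[of "vec_norm n q - k" 0] mult_nonneg_nonneg[OF k0 vec_norm_nonneg[of n q]] by (simp add: power2_eq_square algebra_simps)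
    then show ?thesis by simp
  qed
  finally have "(\<Sum>i<n. x i * p i) \<le> b * t / 64 + vec_norm n q * vec_norm n x" using kk by simp
  with xp mult_pos_pos[OF b(2) t] show ?thesis unfolding q_def by simp
qed

section \<open>Moments of the projection from below\<close>

lemma (in prob_space) moment_markov:
  assumes [measurable]: "f \<in> borel_measurable M"
    and I: "(\<integral>\<^sup>+ x. ennreal (f x powr p) \<partial>M) \<le> ennreal (m powr p)"
    and "m \<ge> 0" "p > 0" "a > 0"
  shows "prob {x \<in> space M. a \<le> f x} \<le> (m / a) powr p"
proof -
  let ?S = "{x \<in> space M. a \<le> f x}"
  have "ennreal (a powr p * prob ?S) = ennreal (a powr p) * emeasure M ?S"
    by (simp add: ennreal_mult emeasure_eq_measure)
  also have "\<dots> = (\<integral>\<^sup>+ x. ennreal (a powr p) * indicator ?S x \<partial>M)"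
    by (subst nn_integral_cmult_indicator) auto
  also have "\<dots> \<le> (\<integral>\<^sup>+ x. ennreal (f x powr p) \<partial>M)"
    using assms by (intro nn_integral_mono) (auto simp: indicator_def intro!: ennreal_leI powr_mono2)
  also note I
  finally have "a powr p * prob ?S \<le> m powr p" by simp
  then show ?thesis using assms by (simp add: powr_divide field_simps)
qed

text \<open>Chernoff's bound with parameter 4 gives probability at most \<open>exp (8 - 16)\<close>,
  and \<open>exp 8 \<ge> 8\<close>.\<close>

lemma std_gaussian_linear_tail:
  assumes e: "(\<Sum>i<n. (e i)\<^sup>2) = 1"
  shows "measure (std_gaussian n) {x \<in> vec_space n. 4 \<le> (\<Sum>i<n. x i * e i)} \<le> 1 / 8"
proof -
  interpret prob_space "std_gaussian n" by (rule prob_space_std_gaussian)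
  have [measurable]: "(\<lambda>x. \<Sum>i<n. x i * e i) \<in> borel_measurable (std_gaussian n)"
    unfolding std_gaussian_def by measurable
  let ?S = "{x \<in> vec_space n. 4 \<le> (\<Sum>i<n. x i * e i)}"
  have [measurable]: "?S \<in> sets (std_gaussian n)"
    unfolding space_std_gaussian[symmetric] by measurable
  have "ennreal (exp 16 * measure (std_gaussian n) ?S) = ennreal (exp 16) * emeasure (std_gaussian n) ?S"
    by (simp add: ennreal_mult emeasure_eq_measure)
  also have "\<dots> = (\<integral>\<^sup>+ x. ennreal (exp 16) * indicator ?S x \<partial>std_gaussian n)"
    by (subst nn_integral_cmult_indicator) auto
  also have "\<dots> \<le> (\<integral>\<^sup>+ x. ennreal (exp (\<Sum>i<n. (4 * e i) * x i)) \<partial>std_gaussian n)"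
  proof (intro nn_integral_mono)
    fix x
    have "(\<Sum>i<n. (4 * e i) * x i) = 4 * (\<Sum>i<n. x i * e i)"
      unfolding sum_distrib_left by (intro sum.cong) auto
    then show "ennreal (exp 16) * indicator ?S x \<le> ennreal (exp (\<Sum>i<n. (4 * e i) * x i))"
      by (auto simp: indicator_def intro!: ennreal_leI)
  qed
  also have "\<dots> = ennreal (exp ((\<Sum>i<n. (4 * e i)\<^sup>2) / 2))"
    unfolding std_gaussian_eq by (rule gauss_exp_linear) simp
  also have "(\<Sum>i<n. (4 * e i)\<^sup>2) = 16"
    using e by (simp add: power_mult_distrib sum_distrib_left[symmetric])
  finally have "exp 16 * measure (std_gaussian n) ?S \<le> exp 8" by simp
  also have "exp (16::real) = exp 8 * exp 8" by (simp flip: exp_add)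
  finally have "exp 8 * measure (std_gaussian n) ?S \<le> 1" by simp
  moreover have "(8::real) \<le> exp 8" using exp_ge_add_one_self[of "8::real"] by simp
  then have "8 * measure (std_gaussian n) ?S \<le> exp 8 * measure (std_gaussian n) ?S"
    by (intro mult_right_mono) auto
  ultimately show ?thesis by simp
qed

lemma std_gaussian_norm_tail:
  assumes n: "n \<ge> 1"
  shows "measure (std_gaussian n) {x \<in> vec_space n. 2 * sqrt n \<le> vec_norm n x} \<le> 1 / 4"
proof -
  interpret prob_space "std_gaussian n" by (rule prob_space_std_gaussian)
  have "prob {x \<in> space (std_gaussian n). 2 * sqrt n \<le> vec_norm n x} \<le> (sqrt n / (2 * sqrt n)) powr 2"
  proof (rule moment_markov)
    show "vec_norm n \<in> borel_measurable (std_gaussian n)"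
      unfolding vec_norm_def L2_set_def std_gaussian_def by measurable
    have "(\<integral>\<^sup>+ x. ennreal (vec_norm n x powr 2) \<partial>std_gaussian n) = (\<integral>\<^sup>+ x. ennreal (\<Sum>i<n. (x i)\<^sup>2) \<partial>std_gaussian n)"
      by (intro nn_integral_cong) (simp add: vec_norm_square)
    also have "\<dots> = of_nat n" by (rule std_gaussian_norm_second_moment)
    finally show "(\<integral>\<^sup>+ x. ennreal (vec_norm n x powr 2) \<partial>std_gaussian n) \<le> ennreal (sqrt n powr 2)"
      by (simp add: ennreal_of_nat_eq_real_of_nat)
  qed (use n in auto)
  also have "\<dots> = 1 / 4" using n by (simp add: power_divide)
  finally show ?thesis by simp
qed

abbreviation proj_moment :: "nat \<Rightarrow> (nat \<Rightarrow> real) set \<Rightarrow> real \<Rightarrow> ennreal" where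
  "proj_moment n C p \<equiv> \<integral>\<^sup>+ x. ennreal (vec_norm n (metric_proj n C x) powr p) \<partial>std_gaussian n"

text \<open>By the pointwise dichotomy, outside exceptional events of total probability 1/2 either
  the projection of \<open>x\<close> has norm at least \<open>a\<close> (event \<open>S1\<close>) or
  that of the shifted point has norm at least \<open>k\<close> (event \<open>S2\<close>). If both
  alternatives failed, Markov's inequality would make each of these probabilities at most 1/8. The
  shift costs \<open>exp (t\<^sup>2)\<close> in probability, which becomes
  \<open>exp (t\<^sup>2 / p)\<close> after the p-th root.\<close>

lemma metric_proj_moment_lower:
  assumes n: "n \<ge> 1" and p: "p \<ge> 1" and C: "C \<in> closed_convex_sets n"
    and y: "y \<in> C" and b: "vec_norm n y = b" "b > 0" and t: "t \<ge> 8" and m: "m \<ge> 0"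
    and I: "proj_moment n C p \<le> ennreal (m powr p)"
  shows "b * t / sqrt n \<le> 128 * m \<or> min b t * exp (- t\<^sup>2 / p) \<le> 64 * m"
proof (rule ccontr)
  assume neg: "\<not> ?thesis"
  interpret prob_space "std_gaussian n" by (rule prob_space_std_gaussian)
  define f where "f x = vec_norm n (metric_proj n C x)" for x
  define e where "e i = y i / b" for i
  define k where "k = min b t / 8"
  \<comment> \<open>Chosen so that \<open>a * (2 * sqrt n)\<close> is \<open>b * t / 8\<close>, the
    bound of the dichotomy for a point of norm at most \<open>2 * sqrt n\<close>.\<close>
  define a where "a = b * t / (16 * sqrt n)"
  have k0: "k > 0" and a0: "a > 0" using b t n by (auto simp: k_def a_def)
  have ma: "m < a / 8" using neg by (simp add: a_def field_simps)
  have mk: "m < k * exp (- t\<^sup>2 / p) / 8" using neg by (simp add: k_def field_simps)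
  have e1: "(\<Sum>i<n. (e i)\<^sup>2) = 1"
  proof -
    have "(\<Sum>i<n. (e i)\<^sup>2) = (\<Sum>i<n. (y i)\<^sup>2) / b\<^sup>2"
      by (simp add: e_def power_divide sum_divide_distrib)
    also have "\<dots> = 1" unfolding vec_norm_square[symmetric] b(1) using b by simp
    finally show ?thesis .
  qed
  have fm [measurable]: "f \<in> borel_measurable (std_gaussian n)"
    unfolding f_def by (rule metric_proj_norm_measurable[OF C])
  have [measurable]: "(\<lambda>x. \<Sum>i<n. x i * e i) \<in> borel_measurable (std_gaussian n)" for e :: "nat \<Rightarrow> real"
    unfolding std_gaussian_def by measurable
  have [measurable]: "vec_norm n \<in> borel_measurable (std_gaussian n)"
    unfolding vec_norm_def L2_set_def std_gaussian_def by measurable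
  have sh [measurable]: "(\<lambda>x. \<lambda>i\<in>{..<n}. x i + t * e i) \<in> measurable (std_gaussian n) (std_gaussian n)"
    unfolding std_gaussian_def by (rule measurable_restrict) simp
  let ?V = "space (std_gaussian n)"
  define S1 where "S1 = {x \<in> ?V. a \<le> f x}"
  define B where "B = {x \<in> ?V. k \<le> f x}"
  \<comment> \<open>The Cameron-Martin density is unbounded on \<open>B\<close>. Where the component
    along \<open>e\<close> is at most \<open>t + 4\<close>, its exponent is at most
    \<open>t * (t + 4) - t\<^sup>2 / 2\<close>, and this is at most \<open>t\<^sup>2\<close>
    precisely because \<open>t \<ge> 8\<close>.\<close>
  define G where "G = {x \<in> B. (\<Sum>i<n. x i * e i) \<le> t + 4}"
  define S2 where "S2 = {x \<in> ?V. (\<lambda>i\<in>{..<n}. x i + t * e i) \<in> G}"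
  define N1 where "N1 = {x \<in> ?V. 2 * sqrt n \<le> vec_norm n x}"
  define N2 where "N2 = {x \<in> ?V. 4 \<le> (\<Sum>i<n. x i * e i)}"
  define N3 where "N3 = {x \<in> ?V. 4 \<le> (\<Sum>i<n. x i * (- e i))}"
  have [measurable]: "S1 \<in> events" "B \<in> events" "N1 \<in> events" "N2 \<in> events" "N3 \<in> events"
    unfolding S1_def B_def N1_def N2_def N3_def by measurable
  have "G = B \<inter> {x \<in> ?V. (\<Sum>i<n. x i * e i) \<le> t + 4}" by (auto simp: G_def B_def)
  moreover have "{x \<in> ?V. (\<Sum>i<n. x i * e i) \<le> t + 4} \<in> events" by measurable
  ultimately have Gm [measurable]: "G \<in> events" using \<open>B \<in> events\<close> by (simp only: sets.Int)
  have "S2 = (\<lambda>x. \<lambda>i\<in>{..<n}. x i + t * e i) -` G \<inter> ?V" by (auto simp: S2_def)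
  then have [measurable]: "S2 \<in> events" using measurable_sets[OF sh Gm] by (simp only:)
  have pN: "prob N1 \<le> 1 / 4" "prob N2 \<le> 1 / 8" "prob N3 \<le> 1 / 8"
    unfolding N1_def N2_def N3_def using std_gaussian_norm_tail[OF n] std_gaussian_linear_tail[OF e1]
      std_gaussian_linear_tail[of "\<lambda>i. - e i" n] e1 by simp_all
  have pS1: "prob S1 \<le> (m / a) powr p"
    unfolding S1_def using I p m a0 by (intro moment_markov[OF fm]) (auto simp: f_def)
  have pB: "prob B \<le> (m / k) powr p"
    unfolding B_def using I p m k0 by (intro moment_markov[OF fm]) (auto simp: f_def)
  have pS2: "prob S2 \<le> exp (t\<^sup>2) * prob B"
  proof -
    have "ennreal (prob S2) = (\<integral>\<^sup>+ x. indicator G (\<lambda>i\<in>{..<n}. x i + t * e i) \<partial>std_gaussian n)"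
      unfolding emeasure_eq_measure[symmetric] nn_integral_indicator[symmetric, OF \<open>S2 \<in> events\<close>]
      by (intro nn_integral_cong) (auto simp: S2_def indicator_def)
    also have "\<dots> = (\<integral>\<^sup>+ x. indicator G x * ennreal (exp (\<Sum>i<n. (t * e i) * x i - (t * e i)\<^sup>2 / 2)) \<partial>std_gaussian n)"
      unfolding std_gaussian_eq by (rule gauss_shift) (auto simp flip: std_gaussian_eq)
    also have "\<dots> \<le> (\<integral>\<^sup>+ x. ennreal (exp (t\<^sup>2)) * indicator B x \<partial>std_gaussian n)"
    proof (intro nn_integral_mono)
      fix x
      have "(\<Sum>i<n. (t * e i) * x i - (t * e i)\<^sup>2 / 2) = t * (\<Sum>i<n. x i * e i) - t\<^sup>2 / 2 * (\<Sum>i<n. (e i)\<^sup>2)"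
        unfolding sum_distrib_left sum_subtractf[symmetric] by (intro sum.cong) (auto simp: power_mult_distrib)
      then have eq: "(\<Sum>i<n. (t * e i) * x i - (t * e i)\<^sup>2 / 2) = t * (\<Sum>i<n. x i * e i) - t\<^sup>2 / 2" using e1 by simp
      have "t * (\<Sum>i<n. x i * e i) - t\<^sup>2 / 2 \<le> t\<^sup>2" if "x \<in> G"
      proof -
        have "t * (\<Sum>i<n. x i * e i) \<le> t * (t + 4)" using that t by (intro mult_left_mono) (auto simp: G_def)
        moreover have "4 * t \<le> t * t / 2" using t by simp
        ultimately show ?thesis by (simp add: power2_eq_square algebra_simps)
      qed
      moreover have "G \<subseteq> B" by (auto simp: G_def)
      ultimately show "indicator G x * ennreal (exp (\<Sum>i<n. (t * e i) * x i - (t * e i)\<^sup>2 / 2)) \<le> ennreal (exp (t\<^sup>2)) * indicator B x"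
        unfolding eq by (auto simp: indicator_def intro!: ennreal_leI)
    qed
    also have "\<dots> = ennreal (exp (t\<^sup>2) * prob B)"
      by (subst nn_integral_cmult_indicator) (auto simp: emeasure_eq_measure ennreal_mult)
    finally show ?thesis by simp
  qed
  have cover: "?V \<subseteq> S1 \<union> (S2 \<union> (N1 \<union> (N2 \<union> N3)))"
  proof
    fix x assume x: "x \<in> ?V"
    show "x \<in> S1 \<union> (S2 \<union> (N1 \<union> (N2 \<union> N3)))"
    proof (rule ccontr)
      assume no: "x \<notin> S1 \<union> (S2 \<union> (N1 \<union> (N2 \<union> N3)))"
      have lo: "(\<Sum>i<n. x i * e i) \<ge> - t / 2" and hi: "(\<Sum>i<n. x i * e i) \<le> 4"
        using no x t by (auto simp: N2_def N3_def sum_negf)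
      have nx: "vec_norm n x < 2 * sqrt n" using no x by (auto simp: N1_def)
      have fx: "f x < a" using no x by (auto simp: S1_def)
      define z where "z = (\<lambda>i\<in>{..<n}. x i + t * e i)"
      have zV: "z \<in> ?V" using x by (auto simp: z_def vec_space_def)
      have "(\<Sum>i<n. z i * e i) = (\<Sum>i<n. x i * e i + t * (e i)\<^sup>2)"
        by (intro sum.cong) (auto simp: z_def power2_eq_square algebra_simps)
      also have "\<dots> = (\<Sum>i<n. x i * e i) + t" using e1 by (simp add: sum.distrib sum_distrib_left[symmetric])
      finally have zt: "(\<Sum>i<n. z i * e i) \<le> t + 4" using hi by simp
      have "z \<notin> G" using no x unfolding S2_def z_def by blast
      then have "z \<notin> B" using zt unfolding G_def by blast
      then have "f z \<le> min b t / 8" using zV by (auto simp: B_def k_def)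
      then have "b * t / 8 \<le> f x * vec_norm n x"
        unfolding f_def z_def e_def using lo t
        by (intro metric_proj_dichotomy[OF C y b]) (auto simp: e_def)
      also have "\<dots> \<le> f x * (2 * sqrt n)" using nx by (intro mult_left_mono) (auto simp: f_def)
      also have "\<dots> < a * (2 * sqrt n)" using fx n by (intro mult_strict_right_mono) auto
      also have "\<dots> = b * t / 8" using n by (simp add: a_def)
      finally show False by simp
    qed
  qed
  have "1 = prob ?V" by (simp add: prob_space del: space_std_gaussian)
  also have "\<dots> \<le> prob (S1 \<union> (S2 \<union> (N1 \<union> (N2 \<union> N3))))"
    using cover by (intro finite_measure_mono) auto
  also have "\<dots> \<le> prob S1 + (prob S2 + (prob N1 + (prob N2 + prob N3)))"
    by (intro order_trans[OF measure_Un_le] add_left_mono order_refl) auto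
  finally have "1 / 2 \<le> prob S1 + prob S2" using pN by simp
  also have "\<dots> \<le> (m / a) powr p + exp (t\<^sup>2) * (m / k) powr p"
    by (intro add_mono pS1 order_trans[OF pS2] mult_left_mono pB) simp
  also have "exp (t\<^sup>2) * (m / k) powr p = (exp (t\<^sup>2 / p) * (m / k)) powr p"
    using m k0 p by (subst powr_mult) (auto simp: exp_powr_real)
  also have "(m / a) powr p + (exp (t\<^sup>2 / p) * (m / k)) powr p \<le> (1 / 8) powr p + (1 / 8) powr p"
  proof (intro add_mono powr_mono2)
    show "m / a \<le> 1 / 8" using ma a0 by (simp add: field_simps)
    have "exp (t\<^sup>2 / p) * (m / k) \<le> exp (t\<^sup>2 / p) * (exp (- t\<^sup>2 / p) / 8)"
      using mk k0 by (intro mult_left_mono) (auto simp: field_simps)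
    also have "\<dots> = 1 / 8" by (simp flip: exp_add)
    finally show "exp (t\<^sup>2 / p) * (m / k) \<le> 1 / 8" .
  qed (use p m a0 k0 in auto)
  also have "(1 / 8 :: real) powr p \<le> (1 / 8) powr 1" using p by (intro powr_mono') auto
  finally show False by simp
qed

section \<open>The upper bound\<close>

lemma exp_half_le_2: "exp (1 / 2 :: real) \<le> 2"
proof -
  have "exp (1 / 2 :: real) * exp (1/2) \<le> 2 * 2" using exp_le by (simp flip: exp_add)
  then show ?thesis by (metis abs_of_nonneg exp_ge_zero power2_eq_square power2_le_imp_le zero_le_numeral)
qed

definition rate :: "nat \<Rightarrow> real \<Rightarrow> real \<Rightarrow> real" where
  "rate n p q = sqrt (max q (real n) / max p (real n)) *
     (real n / (min p (real n) * ln (exp 1 * (real n / min q (real n))))) powr (1 / 2 * (1 - p / q))"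

lemma rate_ge:
  assumes "n \<ge> 1" "1 \<le> p" "p < q" "real n \<le> q"
  shows "rate n p q = sqrt (max q (real n) / max p (real n)) * (real n / min p (real n)) powr (1 / 2 * (1 - p / q))"
  using assms by (simp add: rate_def min_absorb2)

lemma rate_less:
  assumes "n \<ge> 1" "1 \<le> p" "p < q" "q < real n"
  shows "rate n p q = (real n / (p * (1 + ln (real n / q)))) powr (1 / 2 * (1 - p / q))"
proof -
  have "ln (exp 1 * (real n / q)) = 1 + ln (real n / q)"
    using assms by (subst ln_mult) auto
  then show ?thesis
    using assms by (simp add: rate_def min_absorb1 max_absorb2)
qed

text \<open>Solves the moment alternative for the length \<open>b\<close> of \<open>y\<close>, with
  amplification \<open>\<rho>\<close>. The conditions \<open>r1\<close>, \<open>r2\<close>,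
  \<open>r3\<close> serve the three cases: first alternative; second with \<open>b \<le> t\<close>;
  second with \<open>t < b\<close>. In the last case the alternative only bounds \<open>t\<close>,
  and the a priori length \<open>s\<close> is needed to get back to \<open>b\<close>.\<close>

lemma metric_proj_length_bound:
  assumes n: "n \<ge> 1" and p: "p \<ge> 1" and C: "C \<in> closed_convex_sets n" and m: "m \<ge> 0"
    and I: "proj_moment n C p \<le> ennreal (m powr p)"
    and t: "t \<ge> 8" and K: "K \<ge> 0" "\<rho> \<ge> 0"
    and r1: "sqrt n \<le> K * \<rho> * t" and r2: "exp (t\<^sup>2 / p) \<le> K * \<rho>" and r3: "s * exp (t\<^sup>2 / p) \<le> K * \<rho> * t"
    and y: "y \<in> C" "vec_norm n y \<le> s"
  shows "vec_norm n y \<le> 128 * K * \<rho> * m"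
proof (cases "vec_norm n y = 0")
  case True
  then show ?thesis using K m by simp
next
  case False
  define b where "b = vec_norm n y"
  have b: "b > 0" using False vec_norm_nonneg[of n y] by (simp add: b_def order_less_le)
  have Km: "K * \<rho> * m \<ge> 0" using K m by simp
  have E: "min b t \<le> 64 * m * exp (t\<^sup>2 / p)" if "min b t * exp (- t\<^sup>2 / p) \<le> 64 * m"
  proof -
    have "min b t * exp (- t\<^sup>2 / p) * exp (t\<^sup>2 / p) \<le> 64 * m * exp (t\<^sup>2 / p)"
      by (rule mult_right_mono[OF that]) simp
    then show ?thesis by (simp add: mult.assoc flip: exp_add)
  qed
  from metric_proj_moment_lower[OF n p C y(1) b_def[symmetric] b t m I]
  consider "b * t / sqrt n \<le> 128 * m" | "b \<le> t" "min b t * exp (- t\<^sup>2 / p) \<le> 64 * m" | "t < b" "min b t * exp (- t\<^sup>2 / p) \<le> 64 * m"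
    by linarith
  then have "b \<le> 128 * K * \<rho> * m"
  proof cases
    case 1
    then have "b * t \<le> 128 * m * sqrt n" using n by (simp add: field_simps)
    also have "\<dots> \<le> 128 * m * (K * \<rho> * t)" using r1 m by (intro mult_left_mono) auto
    finally have "t * b \<le> t * (128 * K * \<rho> * m)" by (simp add: mult_ac)
    then show ?thesis using t by simp
  next
    case 2
    then have "b \<le> 64 * m * exp (t\<^sup>2 / p)" using E[OF 2(2)] by simp
    also have "\<dots> \<le> 64 * m * (K * \<rho>)" using r2 m by (intro mult_left_mono) auto
    also have "\<dots> \<le> 128 * K * \<rho> * m" using Km by (simp add: mult_ac)
    finally show ?thesis .
  next
    case 3
    then have "t \<le> 64 * m * exp (t\<^sup>2 / p)" using E[OF 3(2)] by simp
    then have "t * b \<le> (64 * m * exp (t\<^sup>2 / p)) * s" using b y t by (intro mult_mono) (auto simp: b_def)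
    also have "\<dots> = 64 * m * (s * exp (t\<^sup>2 / p))" by simp
    also have "\<dots> \<le> 64 * m * (K * \<rho> * t)" using r3 m by (intro mult_left_mono) auto
    also have "\<dots> \<le> t * (128 * K * \<rho> * m)" using Km t mult_nonneg_nonneg[OF Km, of t] by (simp add: mult_ac)
    finally show ?thesis using t by simp
  qed
  then show ?thesis by (simp add: b_def)
qed

lemma closed_convex_sets_norm_eq:
  assumes C: "C \<in> closed_convex_sets n" and "y \<in> C" "s \<le> vec_norm n y" "s > 0"
  shows "\<exists>z\<in>C. vec_norm n z = s"
proof
  define u where "u = s / vec_norm n y"
  have u: "0 \<le> u" "u \<le> 1" using assms by (auto simp: u_def)
  show "(\<lambda>i\<in>{..<n}. u * y i) \<in> C" by (rule closed_convex_sets_scale[OF C \<open>y \<in> C\<close> u])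
  show "vec_norm n (\<lambda>i\<in>{..<n}. u * y i) = s"
    using assms u by (simp add: vec_norm_scale) (simp add: u_def)
qed

text \<open>By Markov's inequality the projection has norm at most \<open>2 * m\<close> with
  probability at least 1/2, so concentration applies with \<open>r = 2 * m\<close>.\<close>

lemma metric_proj_moment_le:
  assumes n: "n \<ge> 1" and p: "p \<ge> 1" and C: "C \<in> closed_convex_sets n" and m: "m > 0"
    and I: "proj_moment n C p \<le> ennreal (m powr p)"
    and s: "s \<ge> 1"
  shows "proj_moment n C s \<le> ennreal ((12 * (m + sqrt s)) powr s)"
proof -
  interpret prob_space "std_gaussian n" by (rule prob_space_std_gaussian)
  define f where "f x = vec_norm n (metric_proj n C x)" for x
  have fm [measurable]: "f \<in> borel_measurable (std_gaussian n)"
    unfolding f_def by (rule metric_proj_norm_measurable[OF C])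
  have "prob {x \<in> space (std_gaussian n). 2 * m \<le> f x} \<le> (m / (2 * m)) powr p"
    using I p m by (intro moment_markov[OF fm]) (auto simp: f_def)
  also have "m / (2 * m) = 1 / 2" using m by simp
  also have "(1 / 2 :: real) powr p \<le> (1 / 2) powr 1" using p by (intro powr_mono') auto
  finally have le: "prob {x \<in> space (std_gaussian n). 2 * m \<le> f x} \<le> 1 / 2" by simp
  have "prob {x \<in> space (std_gaussian n). \<not> 2 * m \<le> f x} = 1 - prob {x \<in> space (std_gaussian n). 2 * m \<le> f x}"
    by (rule prob_neg) measurable
  moreover have "prob {x \<in> space (std_gaussian n). \<not> 2 * m \<le> f x} \<le> prob {x \<in> space (std_gaussian n). f x \<le> 2 * m}"
    by (intro finite_measure_mono) (auto simp del: space_std_gaussian)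
  ultimately have "1 / 2 \<le> prob {x \<in> space (std_gaussian n). f x \<le> 2 * m}" using le by linarith
  then have half: "ennreal (1 / 2) \<le> emeasure (std_gaussian n) {x \<in> vec_space n. f x \<le> 2 * m}"
    unfolding emeasure_eq_measure by (intro ennreal_leI) simp
  have "(\<integral>\<^sup>+ x. ennreal (f x powr s) \<partial>std_gaussian n) \<le> ennreal ((6 * (2 * m + sqrt s)) powr s)"
    using m s half by (intro gaussian_moment_le[OF fm]) (auto simp: f_def intro: metric_proj_norm_lipschitz[OF C])
  also have "\<dots> \<le> ennreal ((12 * (m + sqrt s)) powr s)"
    using m s by (intro ennreal_leI powr_mono2) auto
  finally show ?thesis by (simp add: f_def)
qed

text \<open>Interpolation by splitting off \<open>q - p\<close> of the \<open>q\<close> powers.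
  After the q-th root the bound \<open>\<beta>\<close> enters with exponent
  \<open>1 - p / q\<close>, which is the origin of the exponent in the upper bound.\<close>

lemma nn_integral_truncated_powr_le:
  assumes "0 < m" "p < q" "\<beta> \<ge> 0" "\<And>x. 0 \<le> f x"
    and I: "(\<integral>\<^sup>+ x. ennreal (f x powr p) \<partial>M) \<le> ennreal (m powr p)"
    and [measurable]: "f \<in> borel_measurable M"
    and S: "\<And>x. x \<in> S \<Longrightarrow> f x \<le> \<beta>"
  shows "(\<integral>\<^sup>+ x. ennreal (f x powr q) * indicator S x \<partial>M) \<le> ennreal (\<beta> powr (q - p) * m powr p)"
proof -
  have "(\<integral>\<^sup>+ x. ennreal (f x powr q) * indicator S x \<partial>M) \<le> (\<integral>\<^sup>+ x. ennreal (\<beta> powr (q - p)) * ennreal (f x powr p) \<partial>M)"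
  proof (intro nn_integral_mono)
    fix x
    have "f x powr q = f x powr (q - p) * f x powr p" by (simp add: powr_add[symmetric])
    also have "\<dots> \<le> \<beta> powr (q - p) * f x powr p" if "x \<in> S"
      using assms that by (intro mult_right_mono powr_mono2) auto
    finally show "ennreal (f x powr q) * indicator S x \<le> ennreal (\<beta> powr (q - p)) * ennreal (f x powr p)"
      by (auto simp: indicator_def simp flip: ennreal_mult' intro!: ennreal_leI)
  qed
  also have "\<dots> = ennreal (\<beta> powr (q - p)) * (\<integral>\<^sup>+ x. ennreal (f x powr p) \<partial>M)"
    by (rule nn_integral_cmult) measurable
  also have "\<dots> \<le> ennreal (\<beta> powr (q - p)) * ennreal (m powr p)"
    by (rule mult_left_mono[OF I]) simp
  finally show ?thesis by (simp add: ennreal_mult')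
qed

text \<open>Here the logarithmic factor is 1, so \<open>t = 8 * sqrt p\<close> suffices and the
  shift costs the constant \<open>exp 64\<close>. Either \<open>C\<close> lies in the ball of radius
  \<open>s0\<close>, and interpolation applies; or it contains a point of norm \<open>s0\<close>,
  which forces \<open>sqrt p\<close> to be O(m), and then the concentration bound
  \<open>m + sqrt q\<close> is already of order \<open>m * sqrt (q / p)\<close>.\<close>

lemma rate_upper_large:
  assumes n: "n \<ge> 1" and p: "1 \<le> p" "p < q" and nq: "real n \<le> q"
    and C: "C \<in> closed_convex_sets n" and m: "m > 0"
    and I: "proj_moment n C p \<le> ennreal (m powr p)"
  shows "proj_moment n C q
     \<le> ennreal ((48 * 128 * exp 64 * rate n p q * m) powr q)"
proof -
  define f where "f x = vec_norm n (metric_proj n C x)" for x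
  have fm [measurable]: "f \<in> borel_measurable (std_gaussian n)"
    unfolding f_def by (rule metric_proj_norm_measurable[OF C])
  define \<kappa> where "\<kappa> = real n / min p (real n)"
  have \<kappa>1: "\<kappa> \<ge> 1" using n p by (simp add: \<kappa>_def)
  define s0 where "s0 = sqrt (max p (real n))"
  have s0: "s0 > 0" using n p by (simp add: s0_def)
  have mm: "max p (real n) = p * \<kappa>" using n p by (auto simp: \<kappa>_def max_def min_def)
  have s0': "s0 = sqrt p * sqrt \<kappa>" unfolding s0_def mm by (simp add: real_sqrt_mult)
  have nk: "sqrt n \<le> sqrt p * sqrt \<kappa>" unfolding s0'[symmetric] s0_def by simp
  define K :: real where "K = exp 64"
  have K1: "K \<ge> 1" by (simp add: K_def)
  have tp: "(8 * sqrt p)\<^sup>2 / p = 64" using p by (simp add: power_mult_distrib)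
  define \<beta> where "\<beta> = 128 * K * sqrt \<kappa> * m"
  have \<beta>0: "\<beta> > 0" using K1 \<kappa>1 m by (simp add: \<beta>_def)
  have len: "vec_norm n y \<le> \<beta>" if "y \<in> C" "vec_norm n y \<le> s0" for y
    unfolding \<beta>_def
  proof (rule metric_proj_length_bound[OF n p(1) C _ I, where t="8 * sqrt p" and s=s0])
    have "sqrt p * sqrt \<kappa> \<ge> 0" using p \<kappa>1 by simp
    then have "sqrt p * sqrt \<kappa> \<le> K * (8 * (sqrt p * sqrt \<kappa>))"
      using K1 mult_right_mono[of 1 "8 * K" "sqrt p * sqrt \<kappa>"] by simp
    then show "sqrt n \<le> K * sqrt \<kappa> * (8 * sqrt p)" using nk by (simp add: mult_ac)
    have "s0 \<le> 8 * s0" using s0 by simp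
    then have "K * s0 \<le> K * (8 * s0)" using K1 by (intro mult_left_mono) auto
    then show "s0 * exp ((8 * sqrt p)\<^sup>2 / p) \<le> K * sqrt \<kappa> * (8 * sqrt p)"
      unfolding tp s0' by (simp add: K_def mult_ac)
    show "exp ((8 * sqrt p)\<^sup>2 / p) \<le> K * sqrt \<kappa>"
      unfolding tp using \<kappa>1 by (simp add: K_def)
  qed (use p K1 \<kappa>1 m that in auto)
  have rt: "rate n p q = sqrt (q / (p * \<kappa>)) * \<kappa> powr (1 / 2 * (1 - p / q))"
    unfolding rate_ge[OF n p nq] mm \<kappa>_def[symmetric] using nq by (simp add: max_absorb1)
  have rpos: "rate n p q > 0" unfolding rt using p \<kappa>1 by simp
  show ?thesis
  proof (cases "\<forall>y\<in>C. vec_norm n y \<le> s0")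
    case True
    have "(\<integral>\<^sup>+ x. ennreal (f x powr q) \<partial>std_gaussian n) = (\<integral>\<^sup>+ x. ennreal (f x powr q) * indicator UNIV x \<partial>std_gaussian n)"
      by simp
    also have "\<dots> \<le> ennreal (\<beta> powr (q - p) * m powr p)"
    proof (rule nn_integral_truncated_powr_le)
      fix x show "f x \<le> \<beta>" unfolding f_def using True metric_proj_in[OF C] len by blast
    qed (use m p \<beta>0 I in \<open>auto simp: f_def[symmetric]\<close>, simp add: f_def)
    also have "\<beta> powr (q - p) * m powr p \<le> (48 * 128 * exp 64 * rate n p q * m) powr q"
    proof -
      have "\<beta> powr (q - p) * m powr p = (128 * K) powr (q - p) * sqrt \<kappa> powr (q - p) * m powr q"
        using K1 \<kappa>1 m by (simp add: \<beta>_def powr_mult powr_diff)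
      also have "\<dots> \<le> (128 * K) powr q * (rate n p q) powr q * m powr q"
      proof (intro mult_right_mono mult_mono)
        show "(128 * K) powr (q - p) \<le> (128 * K) powr q" using K1 p by (intro powr_mono) auto
        have "sqrt \<kappa> powr (q - p) = (\<kappa> powr (1 / 2 * (1 - p / q))) powr q"
        proof -
          have "1 / 2 * (1 - p / q) * q = (q - p) / 2" using p by (simp add: field_simps)
          then show ?thesis using \<kappa>1 by (simp only: powr_powr) (simp add: powr_half_sqrt[symmetric] powr_powr)
        qed
        also have "\<dots> \<le> rate n p q powr q"
        proof (intro powr_mono2)
          have "p * \<kappa> \<le> q" unfolding mm[symmetric] using p nq by simp
          then have "1 \<le> sqrt (q / (p * \<kappa>))" using p \<kappa>1 by (simp add: field_simps)
          then show "\<kappa> powr (1 / 2 * (1 - p / q)) \<le> rate n p q" unfolding rt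
            using mult_right_mono[of 1 "sqrt (q / (p * \<kappa>))" "\<kappa> powr (1 / 2 * (1 - p / q))"] by simp
        qed (use p in auto)
        finally show "sqrt \<kappa> powr (q - p) \<le> rate n p q powr q" .
      qed auto
      also have "\<dots> = (128 * K * rate n p q * m) powr q"
        using K1 rpos m by (simp add: powr_mult)
      also have "\<dots> \<le> (48 * 128 * exp 64 * rate n p q * m) powr q"
        using rpos m p by (intro powr_mono2) (auto simp: K_def)
      finally show ?thesis .
    qed
    finally show ?thesis by (simp add: f_def ennreal_leI)
  next
    case False
    then obtain y where y: "y \<in> C" "s0 \<le> vec_norm n y" by force
    obtain z where z: "z \<in> C" "vec_norm n z = s0" using closed_convex_sets_norm_eq[OF C y s0] by blast
    have "sqrt p * sqrt \<kappa> \<le> 128 * K * m * sqrt \<kappa>"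
      using len[of z] z by (simp add: s0' \<beta>_def mult_ac)
    then have pm: "sqrt p \<le> 128 * K * m" using \<kappa>1 by simp
    define g where "g = sqrt (q / p)"
    have g1: "g \<ge> 1" using p by (simp add: g_def)
    \<comment> \<open>The rate is \<open>sqrt (q / p)\<close> divided by this power. For
      \<open>p \<le> n\<close> it is bounded since \<open>ln \<kappa> \<le> \<kappa>\<close> and
      \<open>p * \<kappa> = n \<le> q\<close>; otherwise \<open>\<kappa> = 1\<close>.\<close>
    have "\<kappa> powr (p / (2 * q)) \<le> exp (1 / 2)"
    proof (cases "p \<le> n")
      case True
      then have k: "\<kappa> = n / p" by (simp add: \<kappa>_def)
      have "p / (2 * q) * ln \<kappa> \<le> p / (2 * q) * \<kappa>"
        using \<kappa>1 p ln_le_minus_one[of \<kappa>] by (intro mult_left_mono) auto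
      also have "\<dots> \<le> 1 / 2" using p nq by (simp add: k field_simps)
      finally show ?thesis using \<kappa>1 by (simp add: powr_def)
    next
      case False
      then show ?thesis using n by (simp add: \<kappa>_def)
    qed
    also have "exp (1 / 2 :: real) \<le> 2" by (rule exp_half_le_2)
    finally have kp: "\<kappa> powr (p / (2 * q)) \<le> 2" .
    have "g = rate n p q * \<kappa> powr (p / (2 * q))"
    proof -
      have "\<kappa> powr (1 / 2 * (1 - p / q)) * \<kappa> powr (p / (2 * q)) = sqrt \<kappa>"
        unfolding powr_add[symmetric] using p \<kappa>1 by (simp add: field_simps powr_half_sqrt)
      then show ?thesis unfolding rt g_def mult.assoc using p \<kappa>1 by (simp add: real_sqrt_divide real_sqrt_mult)
    qed
    also have "\<dots> \<le> rate n p q * 2" using kp rpos by (intro mult_left_mono) auto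
    finally have gr: "g \<le> 2 * rate n p q" by simp
    have "12 * (m + sqrt q) \<le> 24 * (128 * K * m) * g"
    proof -
      have "sqrt q = sqrt p * g" using p by (simp add: g_def real_sqrt_divide)
      also have "\<dots> \<le> (128 * K * m) * g" using pm g1 by (intro mult_right_mono) auto
      finally have 1: "sqrt q \<le> (128 * K * m) * g" .
      have "m * 1 \<le> (128 * K * m) * g" using K1 m g1 by (intro mult_mono) auto
      with 1 show ?thesis by simp
    qed
    also have "\<dots> \<le> 24 * (128 * K * m) * (2 * rate n p q)" using gr K1 m by (intro mult_left_mono) auto
    finally have fin: "12 * (m + sqrt q) \<le> 48 * 128 * exp 64 * rate n p q * m" by (simp add: K_def mult_ac)
    have "(\<integral>\<^sup>+ x. ennreal (f x powr q) \<partial>std_gaussian n) \<le> ennreal ((12 * (m + sqrt q)) powr q)"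
      unfolding f_def using p by (intro metric_proj_moment_le[OF n p(1) C m I]) auto
    also have "\<dots> \<le> ennreal ((48 * 128 * exp 64 * rate n p q * m) powr q)"
      using m p fin by (intro ennreal_leI powr_mono2) auto
    finally show ?thesis by (simp add: f_def)
  qed
qed

text \<open>For \<open>l = 1 + ln (n / q)\<close> the right-hand side is \<open>2 \<surd>(n / q)\<close>.\<close>

lemma log_factor_absorbed:
  fixes l :: real
  assumes "l \<ge> 1"
  shows "sqrt l * exp (l / 8) \<le> 2 * sqrt (exp (l - 1))"
proof -
  have "l * 1 \<le> (4 / exp 1) * exp (3 * l / 4)"
  proof -
    have e: "exp 1 \<le> (3::real)" by (rule exp_le)
    have "l \<le> 4 / 3 * (1 + 3 * l / 4)" by simp
    also have "\<dots> \<le> 4 / 3 * exp (3 * l / 4)" by (intro mult_left_mono exp_ge_add_one_self) auto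
    also have "\<dots> \<le> 4 / exp 1 * exp (3 * l / 4)"
      using e by (intro mult_right_mono) (auto simp: field_simps)
    finally show ?thesis by simp
  qed
  then have "l * exp (l / 4) \<le> (4 / exp 1) * exp (3 * l / 4) * exp (l / 4)"
    by (intro mult_right_mono) auto
  also have "\<dots> = 4 * exp (l - 1)"
    by (simp add: exp_diff field_simps flip: exp_add)
  finally have "sqrt (l * exp (l / 4)) \<le> sqrt (4 * exp (l - 1))" by simp
  moreover have "sqrt (exp (l / 4)) = exp (l / 8)"
    by (intro real_sqrt_unique) (simp_all flip: exp_of_nat_mult)
  ultimately show ?thesis by (simp add: real_sqrt_mult)
qed

text \<open>If \<open>m\<close> is at least \<open>sqrt q'\<close>, concentration alone suffices,
  since the rate is at least 1. Otherwise the integral is split at \<open>s0\<close>. Below it,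
  lengths are at most \<open>\<beta>\<close> and interpolation applies. Above it, the moment of
  order \<open>q'\<close> takes over; if that part is present at all, \<open>C\<close> has a point
  of norm \<open>s0\<close>, so \<open>s0 \<le> \<beta>\<close>.\<close>

lemma rate_upper_small:
  fixes n :: nat and p q m :: real and C :: "(nat \<Rightarrow> real) set"
  defines "K \<equiv> 1600 * exp 129"
  assumes n: "n \<ge> 1" and p: "1 \<le> p" "p < q" and nq: "q < real n"
    and C: "C \<in> closed_convex_sets n" and m: "m > 0"
    and I: "proj_moment n C p \<le> ennreal (m powr p)"
  shows "proj_moment n C q
     \<le> ennreal ((512 * K * rate n p q * m) powr q)"
proof -
  interpret prob_space "std_gaussian n" by (rule prob_space_std_gaussian)
  define f where "f x = vec_norm n (metric_proj n C x)" for x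
  have f0: "f x \<ge> 0" for x by (simp add: f_def)
  have fm [measurable]: "f \<in> borel_measurable (std_gaussian n)"
    unfolding f_def by (rule metric_proj_norm_measurable[OF C])
  have e1: "exp (129::real) \<ge> 1" by simp
  then have K1: "K \<ge> 1" unfolding K_def by linarith
  define l where "l = 1 + ln (real n / q)"
  have l1: "l \<ge> 1" using p nq by (simp add: l_def)
  have nl: "real n = q * exp (l - 1)" using p nq by (simp add: l_def)
  have ql: "q * l \<le> n"
    unfolding nl using p exp_ge_add_one_self[of "l - 1"] by (intro mult_left_mono) auto
  have pl: "p * l \<le> q * l" using p l1 by (intro mult_right_mono) auto
  define W where "W = real n / (p * l)"
  have W1: "W \<ge> 1" using p l1 order_trans[OF pl ql] by (simp add: W_def)
  define \<tau> where "\<tau> = 1 / 2 * (1 - p / q)"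
  have \<tau>0: "\<tau> \<ge> 0" using p by (simp add: \<tau>_def)
  have \<tau>q: "\<tau> * q = (q - p) / 2" using p by (simp add: \<tau>_def field_simps)
  have rt: "rate n p q = W powr \<tau>"
    unfolding rate_less[OF n p nq] W_def l_def \<tau>_def ..
  have r1: "rate n p q \<ge> 1" unfolding rt using W1 \<tau>0 by (rule ge_one_powr_ge_zero)
  have rq: "rate n p q powr q = sqrt W powr (q - p)"
    unfolding rt powr_powr \<tau>q using W1 by (simp add: powr_half_sqrt[symmetric] powr_powr)
  \<comment> \<open>A moment of order at least \<open>p * l\<close> gains a factor
    \<open>exp (- (p * l))\<close> beyond \<open>s0\<close>. This compensates for the
    \<open>p\<close> powers of \<open>sqrt W\<close> by which \<open>\<beta> powr q\<close> exceeds
    what the rate allows.\<close>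
  define q' where "q' = max q (p * l)"
  have q': "q' \<ge> q" "q' \<ge> p * l" "q' \<ge> 1" "q' \<le> q * l"
    using p pl l1 by (auto simp: q'_def intro: mult_left_mono[of 1 l q, simplified])
  show ?thesis
  proof (cases "sqrt q' \<le> m")
    case True
    have "(\<integral>\<^sup>+ x. ennreal (f x powr q) \<partial>std_gaussian n) \<le> ennreal ((12 * (m + sqrt q)) powr q)"
      unfolding f_def using p by (intro metric_proj_moment_le[OF n p(1) C m I]) auto
    also have "\<dots> \<le> ennreal ((512 * K * rate n p q * m) powr q)"
    proof (intro ennreal_leI powr_mono2)
      have "sqrt q \<le> m" using True q' order_trans[of "sqrt q" "sqrt q'" m] by simp
      then have "12 * (m + sqrt q) \<le> 24 * m" by simp
      also have "\<dots> \<le> 512 * (K * rate n p q) * m"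
        using m mult_mono[OF K1 r1] K1 by (intro mult_right_mono) auto
      finally show "12 * (m + sqrt q) \<le> 512 * K * rate n p q * m" by (simp add: mult_ac)
    qed (use p m in auto)
    finally show ?thesis by (simp add: f_def)
  next
    case False
    then have mq: "m < sqrt q'" by simp
    \<comment> \<open>For \<open>m < sqrt q'\<close> the base \<open>12 * (m + sqrt q')\<close> of
      the concentration bound is at most \<open>s0 / exp 1\<close>; the extra \<open>exp 1\<close>
      is the source of the gain \<open>exp (- q')\<close>.\<close>
    define s0 where "s0 = 24 * exp 1 * sqrt q'"
    have s0: "s0 > 0" using q' by (simp add: s0_def)
    \<comment> \<open>The first term ensures \<open>t \<ge> 8\<close>. The coefficient 1/4 of the
      second makes its share of \<open>exp (t\<^sup>2 / p)\<close> only \<open>exp (l / 8)\<close>,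
      the amount that \<open>log_factor_absorbed\<close> can take.\<close>
    define t where "t = 8 * sqrt p + sqrt (p * l) / 4"
    have t8: "t \<ge> 8" using p l1 by (simp add: t_def add_increasing2)
    have tpl: "t \<ge> sqrt (p * l) / 4" using p by (simp add: t_def)
    have t2: "t\<^sup>2 / p \<le> 128 + l / 8"
    proof -
      have "(a + b)\<^sup>2 \<le> 2 * a\<^sup>2 + 2 * b\<^sup>2" for a b :: real
        using zero_le_power2[of "a - b"] by (simp add: power2_eq_square algebra_simps)
      then have "t\<^sup>2 \<le> 2 * (8 * sqrt p)\<^sup>2 + 2 * (sqrt (p * l) / 4)\<^sup>2"
        unfolding t_def .
      also have "\<dots> = p * (128 + l / 8)"
        using p l1 by (simp add: power_mult_distrib power_divide algebra_simps)
      finally show ?thesis using p by (simp add: field_simps)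
    qed
    have et: "exp (t\<^sup>2 / p) \<le> exp 128 * exp (l / 8)"
      using t2 by (simp flip: exp_add)
    have lf: "sqrt l * exp (l / 8) \<le> 2 * sqrt (exp (l - 1))" by (rule log_factor_absorbed[OF l1])
    have sW: "sqrt W * sqrt (p * l) = sqrt n" using p l1 by (simp add: W_def real_sqrt_mult[symmetric])
    have sn: "sqrt n = sqrt q * sqrt (exp (l - 1))" by (simp add: nl real_sqrt_mult)
    have Wt: "sqrt n / 4 \<le> sqrt W * t"
    proof -
      have "sqrt n / 4 = sqrt W * (sqrt (p * l) / 4)" using sW by simp
      also have "\<dots> \<le> sqrt W * t" using tpl W1 by (intro mult_left_mono) auto
      finally show ?thesis .
    qed
    have e129: "exp 129 = exp 1 * exp (128::real)" by (simp flip: exp_add)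
    define \<beta> where "\<beta> = 128 * K * sqrt W * m"
    have \<beta>0: "\<beta> > 0" using K1 W1 m by (simp add: \<beta>_def)
    have len: "vec_norm n y \<le> \<beta>" if "y \<in> C" "vec_norm n y \<le> s0" for y
      unfolding \<beta>_def
    proof (rule metric_proj_length_bound[OF n p(1) C _ I t8, where s=s0])
      have K4: "K \<ge> 4" using e1 unfolding K_def by linarith
      have "sqrt n = 4 * (sqrt n / 4)" by simp
      also have "\<dots> \<le> K * (sqrt W * t)" using K4 Wt n by (intro mult_mono[OF _ Wt]) auto
      finally show "sqrt n \<le> K * sqrt W * t" by (simp add: mult.assoc)
      have "exp (l / 8) \<le> 2 * sqrt W"
      proof -
        have "sqrt l * exp (l / 8) * sqrt p \<le> 2 * sqrt (exp (l - 1)) * sqrt q"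
          using p by (intro mult_mono[OF lf]) auto
        also have "\<dots> = 2 * sqrt W * (sqrt l * sqrt p)"
          using sW sn by (simp add: real_sqrt_mult mult_ac)
        finally have "exp (l / 8) * (sqrt l * sqrt p) \<le> 2 * sqrt W * (sqrt l * sqrt p)" by (simp add: mult_ac)
        then show ?thesis using l1 p by simp
      qed
      then have "exp 128 * exp (l / 8) \<le> exp 128 * (2 * sqrt W)" by (intro mult_left_mono) auto
      also have "\<dots> = 2 * exp 128 * sqrt W" by simp
      also have "\<dots> \<le> K * sqrt W"
      proof (intro mult_right_mono)
        have "exp 128 \<le> exp (129::real)" by simp
        then show "2 * exp 128 \<le> K" using e1 unfolding K_def by linarith
      qed (use W1 in auto)
      finally show "exp (t\<^sup>2 / p) \<le> K * sqrt W" using et by simp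
      have "s0 * exp (t\<^sup>2 / p) \<le> (24 * exp 1 * sqrt (q * l)) * (exp 128 * exp (l / 8))"
        unfolding s0_def using et q' by (intro mult_mono) auto
      also have "\<dots> = 24 * exp 129 * sqrt q * (sqrt l * exp (l / 8))"
        unfolding e129 by (simp add: real_sqrt_mult)
      also have "\<dots> \<le> 24 * exp 129 * sqrt q * (2 * sqrt (exp (l - 1)))"
        using p by (intro mult_left_mono[OF lf]) auto
      also have "\<dots> = 192 * exp 129 * (sqrt n / 4)" by (simp add: sn)
      also have "\<dots> \<le> K * (sqrt W * t)" by (intro mult_mono[OF _ Wt]) (auto simp: K_def)
      finally show "s0 * exp (t\<^sup>2 / p) \<le> K * sqrt W * t" by (simp add: mult.assoc)
    qed (use K1 W1 m that in auto)
    define B where "B = {x. f x \<le> s0}"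
    have fin1: "(\<integral>\<^sup>+ x. ennreal (f x powr q) * indicator B x \<partial>std_gaussian n) \<le> ennreal (\<beta> powr (q - p) * m powr p)"
    proof (rule nn_integral_truncated_powr_le)
      fix x assume "x \<in> B"
      then show "f x \<le> \<beta>" using len metric_proj_in[OF C] by (auto simp: B_def f_def)
    qed (use m p \<beta>0 I f0 in \<open>auto simp: f_def[symmetric]\<close>)
    have bb: "\<beta> powr (q - p) * m powr p \<le> (128 * K * rate n p q * m) powr q"
    proof -
      have "\<beta> powr (q - p) * m powr p = (128 * K) powr (q - p) * sqrt W powr (q - p) * m powr q"
        using K1 W1 m by (simp add: \<beta>_def powr_mult powr_diff)
      also have "\<dots> \<le> (128 * K) powr q * (rate n p q) powr q * m powr q"
        unfolding rq using K1 p by (intro mult_right_mono powr_mono) auto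
      also have "\<dots> = (128 * K * rate n p q * m) powr q"
        using K1 r1 m by (simp add: powr_mult)
      finally show ?thesis .
    qed
    have fin2: "(\<integral>\<^sup>+ x. ennreal (f x powr q) * indicator (- B) x \<partial>std_gaussian n) \<le> ennreal ((128 * K * exp (1 / 2) * rate n p q * m) powr q)"
    proof (cases "\<forall>y\<in>C. vec_norm n y \<le> s0")
      case True
      then have "B = UNIV" using metric_proj_in[OF C] by (auto simp: B_def f_def)
      then show ?thesis by simp
    next
      case False
      then obtain y where y: "y \<in> C" "s0 \<le> vec_norm n y" by force
      obtain z where z: "z \<in> C" "vec_norm n z = s0" using closed_convex_sets_norm_eq[OF C y s0] by blast
      have s\<beta>: "s0 \<le> \<beta>" using len[of z] z by simp
      have "(\<integral>\<^sup>+ x. ennreal (f x powr q) * indicator (- B) x \<partial>std_gaussian n) \<le>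
          (\<integral>\<^sup>+ x. ennreal (s0 powr (q - q')) * ennreal (f x powr q') \<partial>std_gaussian n)"
      proof (intro nn_integral_mono)
        fix x
        have "f x powr q \<le> s0 powr (q - q') * f x powr q'" if "x \<notin> B"
        proof -
          have fs: "f x > s0" using that by (simp add: B_def)
          have "f x powr q = f x powr (q - q') * f x powr q'" by (simp add: powr_add[symmetric])
          also have "\<dots> \<le> s0 powr (q - q') * f x powr q'"
            using fs s0 q' by (intro mult_right_mono powr_mono2') auto
          finally show ?thesis .
        qed
        then show "ennreal (f x powr q) * indicator (- B) x \<le> ennreal (s0 powr (q - q')) * ennreal (f x powr q')"
          by (auto simp: indicator_def simp flip: ennreal_mult' intro!: ennreal_leI)
      qed
      also have "\<dots> = ennreal (s0 powr (q - q')) * (\<integral>\<^sup>+ x. ennreal (f x powr q') \<partial>std_gaussian n)"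
        by (rule nn_integral_cmult) measurable
      also have "\<dots> \<le> ennreal (s0 powr (q - q')) * ennreal ((12 * (m + sqrt q')) powr q')"
        unfolding f_def using q' by (intro mult_left_mono metric_proj_moment_le[OF n p(1) C m I]) auto
      also have "\<dots> = ennreal (s0 powr (q - q') * (12 * (m + sqrt q')) powr q')"
        by (simp add: ennreal_mult')
      also have "s0 powr (q - q') * (12 * (m + sqrt q')) powr q' \<le> s0 powr (q - q') * (24 * sqrt q') powr q'"
        using mq m q' by (intro mult_left_mono powr_mono2) auto
      also have "24 * sqrt q' = s0 * exp (- 1)" by (simp add: s0_def exp_minus)
      also have "s0 powr (q - q') * (s0 * exp (- 1)) powr q' = s0 powr q * exp (- q')"
        using s0 by (simp add: powr_mult powr_diff exp_powr_real)
      also have "\<dots> \<le> \<beta> powr q * exp (- (p * l))"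
        using s\<beta> s0 p q' by (intro mult_mono powr_mono2) auto
      also have "\<dots> = (128 * K) powr q * sqrt W powr (q - p) * m powr q * (sqrt W powr p * exp (- (p * l)))"
        using K1 W1 m by (simp add: \<beta>_def powr_mult powr_diff)
      also have "\<dots> \<le> (128 * K) powr q * sqrt W powr (q - p) * m powr q * exp (1 / 2) powr q"
      proof (intro mult_left_mono)
        \<comment> \<open>It suffices that \<open>p / 2 * ln W\<close> is at most
          \<open>p * l + q / 2\<close>: the term \<open>q / 2\<close> survives the q-th root only as
          the constant \<open>exp (1 / 2)\<close>.\<close>
        have "ln W \<le> ln (exp (l - 1) * (q / p))"
          using W1 p l1 by (intro ln_mono) (auto simp: W_def nl field_simps mult_left_mono[of 1 l, simplified])
        also have "\<dots> = l - 1 + ln (q / p)" using p by (subst ln_mult) auto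
        also have "\<dots> \<le> l + q / p" using p ln_le_minus_one[of "q / p"] by simp
        finally have "p / 2 * ln W \<le> p / 2 * (l + q / p)" using p by (intro mult_left_mono) auto
        also have "\<dots> = p * l / 2 + q / 2" using p by (simp add: field_simps)
        also have "\<dots> \<le> p * l + q / 2" using p l1 by simp
        finally have "p / 2 * ln W - p * l \<le> q / 2" by simp
        then have "exp (p / 2 * ln W - p * l) \<le> exp (q / 2)" by simp
        then show "sqrt W powr p * exp (- (p * l)) \<le> exp (1 / 2) powr q"
          using W1 by (simp add: powr_def ln_sqrt exp_powr_real flip: exp_add)
      qed auto
      also have "\<dots> = (128 * K * exp (1 / 2) * rate n p q * m) powr q"
        using K1 r1 m by (simp add: powr_mult rq)
      finally show ?thesis by (simp add: ennreal_leI)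
    qed
    have Bs: "B \<inter> space (std_gaussian n) \<in> sets (std_gaussian n)"
    proof -
      have "{x \<in> space (std_gaussian n). f x \<le> s0} \<in> sets (std_gaussian n)" by measurable
      moreover have "B \<inter> space (std_gaussian n) = {x \<in> space (std_gaussian n). f x \<le> s0}" by (auto simp: B_def)
      ultimately show ?thesis by (simp only:)
    qed
    have [measurable]: "(\<lambda>x. indicator B x :: ennreal) \<in> borel_measurable (std_gaussian n)" "(\<lambda>x. indicator (- B) x :: ennreal) \<in> borel_measurable (std_gaussian n)"
      unfolding B_def indicator_def by (auto simp: not_le)
    have "(\<integral>\<^sup>+ x. ennreal (f x powr q) \<partial>std_gaussian n) =
      (\<integral>\<^sup>+ x. ennreal (f x powr q) * indicator B x + ennreal (f x powr q) * indicator (- B) x \<partial>std_gaussian n)"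
      by (intro nn_integral_cong) (auto simp: indicator_def)
    also have "\<dots> = (\<integral>\<^sup>+ x. ennreal (f x powr q) * indicator B x \<partial>std_gaussian n) + (\<integral>\<^sup>+ x. ennreal (f x powr q) * indicator (- B) x \<partial>std_gaussian n)"
      by (rule nn_integral_add) measurable
    also have "\<dots> \<le> ennreal ((128 * K * rate n p q * m) powr q) + ennreal ((128 * K * exp (1 / 2) * rate n p q * m) powr q)"
      using bb by (intro add_mono fin2 order_trans[OF fin1] ennreal_leI)
    also have "\<dots> \<le> ennreal ((256 * K * rate n p q * m) powr q) + ennreal ((256 * K * rate n p q * m) powr q)"
    proof (intro add_mono ennreal_leI powr_mono2)
      have "128 * K * exp (1 / 2) * rate n p q * m = exp (1 / 2) * (128 * K * rate n p q * m)" by simp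
      also have "\<dots> \<le> 2 * (128 * K * rate n p q * m)" using exp_half_le_2 K1 r1 m by (intro mult_right_mono) auto
      finally show "128 * K * exp (1 / 2) * rate n p q * m \<le> 256 * K * rate n p q * m" by simp
    qed (use p K1 r1 m in auto)
    also have "\<dots> = ennreal (2 * (256 * K * rate n p q * m) powr q)"
      by (simp flip: ennreal_plus)
    also have "\<dots> \<le> ennreal (2 powr q * (256 * K * rate n p q * m) powr q)"
      using p powr_mono[of 1 q 2] by (intro ennreal_leI mult_right_mono) auto
    also have "2 powr q * (256 * K * rate n p q * m) powr q = (512 * K * rate n p q * m) powr q"
      using K1 r1 m by (simp add: powr_mult[symmetric] mult.assoc)
    finally show ?thesis by (simp add: f_def)
  qed
qed

section \<open>Cones over cubes\<close>

text \<open>The half-width of the cross-section shrinks from \<open>b * L\<close> at the base, whose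
  centre is the origin, to 0 at the apex. For \<open>b = 0\<close> the set is a segment of length
  \<open>L\<close>.\<close>

definition cube_cone :: "nat \<Rightarrow> real \<Rightarrow> real \<Rightarrow> (nat \<Rightarrow> real) set" where
  "cube_cone n L b = {x \<in> vec_space n. 0 \<le> x 0 \<and> x 0 \<le> L \<and> (\<forall>i\<in>{1..<n}. \<bar>x i\<bar> \<le> b * (L - x 0))}"

lemma sum_lessThan_split_first: "n \<ge> 1 \<Longrightarrow> (\<Sum>i<n. g i) = g 0 + (\<Sum>i\<in>{1..<n}. g i)"
  for g :: "nat \<Rightarrow> real"
  unfolding lessThan_atLeast0 by (subst sum.atLeast_Suc_lessThan) auto

lemma cube_cone_closed_convex:
  assumes n: "n \<ge> 1" and L: "L > 0" and b: "b \<ge> 0"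
  shows "cube_cone n L b \<in> closed_convex_sets n"
proof -
  let ?T = "product_topology (\<lambda>_. euclideanreal) {..<n}"
  have ts: "topspace ?T = vec_space n" by (simp add: vec_space_def)
  define D where "D i = (if i = 0 then {x \<in> topspace ?T. x 0 \<in> {0..L}} else {x \<in> topspace ?T. b * (L - x 0) - \<bar>x i\<bar> \<in> {0..}})" for i
  have pr: "continuous_map ?T euclideanreal (\<lambda>x. x i)" if "i < n" for i
    using that by (intro continuous_map_product_projection) auto
  have "closedin ?T (D i)" if i: "i < n" for i
  proof (cases "i = 0")
    case True
    have "closedin ?T {x \<in> topspace ?T. x 0 \<in> {0..L}}"
      by (rule closedin_continuous_map_preimage[OF pr]) (use n in auto)
    then show ?thesis using True by (simp only: D_def simp_thms if_True)
  next
    case False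
    have "closedin ?T {x \<in> topspace ?T. b * (L - x 0) - \<bar>x i\<bar> \<in> {0..}}"
      by (rule closedin_continuous_map_preimage[where Y=euclideanreal],
          intro continuous_map_diff continuous_map_real_mult continuous_map_real_abs pr continuous_map_const[THEN iffD2])
         (use n i in auto)
    then show ?thesis using False by (simp only: D_def simp_thms if_False)
  qed
  then have "closedin ?T (\<Inter>(D ` {..<n}))" using n by (intro closedin_Inter) (auto simp: lessThan_empty_iff)
  also have "\<Inter>(D ` {..<n}) = cube_cone n L b"
  proof (intro equalityI subsetI)
    fix x assume x: "x \<in> \<Inter>(D ` {..<n})"
    then have "x \<in> D 0" using n by auto
    moreover have "\<bar>x i\<bar> \<le> b * (L - x 0)" if "i \<in> {1..<n}" for i
    proof -
      have "x \<in> D i" using x that by auto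
      then show ?thesis using that by (simp add: D_def)
    qed
    ultimately show "x \<in> cube_cone n L b" unfolding ts[symmetric] cube_cone_def by (simp add: D_def)
  qed (auto simp: cube_cone_def D_def ts vec_space_def)
  finally have cl: "closedin ?T (cube_cone n L b)" .
  have "vec_convex n (cube_cone n L b)"
    unfolding vec_convex_def
  proof (intro ballI allI impI)
    fix x y :: "nat \<Rightarrow> real" and u v :: real
    assume x: "x \<in> cube_cone n L b" and y: "y \<in> cube_cone n L b" and uv: "0 \<le> u" "0 \<le> v" "u + v = 1"
    define z where "z = (\<lambda>i\<in>{..<n}. u * x i + v * y i)"
    have z0: "z 0 = u * x 0 + v * y 0" using n by (simp add: z_def)
    have v: "L = u * L + v * L" using uv by (simp flip: distrib_right)
    have "0 \<le> z 0" using x y uv unfolding z0 by (simp add: cube_cone_def)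
    moreover have "u * x 0 + v * y 0 \<le> u * L + v * L"
      using x y uv by (intro add_mono mult_left_mono) (auto simp: cube_cone_def)
    then have "z 0 \<le> L" using v z0 by simp
    moreover have "\<bar>z i\<bar> \<le> b * (L - z 0)" if i: "i \<in> {1..<n}" for i
    proof -
      have "\<bar>z i\<bar> \<le> u * \<bar>x i\<bar> + v * \<bar>y i\<bar>"
        using i uv abs_triangle_ineq[of "u * x i" "v * y i"] by (simp add: z_def abs_mult)
      also have "\<dots> \<le> u * (b * (L - x 0)) + v * (b * (L - y 0))"
        using x y uv i by (intro add_mono mult_left_mono) (auto simp: cube_cone_def)
      also have "\<dots> = b * ((u * L + v * L) - z 0)" by (simp add: z0 algebra_simps)
      finally show ?thesis using v by simp
    qed
    moreover have "z \<in> vec_space n" by (auto simp: z_def vec_space_def)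
    ultimately show "(\<lambda>i\<in>{..<n}. u * x i + v * y i) \<in> cube_cone n L b"
      unfolding z_def[symmetric] by (simp add: cube_cone_def)
  qed
  moreover have "vec_zero n \<in> cube_cone n L b"
    using n L b by (auto simp: cube_cone_def vec_zero_def vec_space_def)
  moreover have "cube_cone n L b \<subseteq> vec_space n" by (auto simp: cube_cone_def)
  ultimately show ?thesis using cl by (simp add: closed_convex_sets_def)
qed

lemma cube_cone_apex:
  assumes "n \<ge> 1" "L > 0"
  shows "(\<lambda>i\<in>{..<n}. if i = 0 then L else 0) \<in> cube_cone n L b"
  using assms by (auto simp: cube_cone_def vec_space_def)

lemma cube_cone_nontrivial:
  assumes "n \<ge> 1" "L > 0"
  shows "cube_cone n L b \<noteq> {vec_zero n}"
proof
  assume "cube_cone n L b = {vec_zero n}"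
  then have "(\<lambda>i\<in>{..<n}. if i = 0 then L else 0) = vec_zero n" using cube_cone_apex[OF assms, of b] by blast
  then have "(\<lambda>i\<in>{..<n}. if i = 0 then L else 0) 0 = vec_zero n 0" by (rule fun_cong)
  then show False using assms by (simp add: vec_zero_def)
qed

text \<open>Compare the projection with the point of the base reached by sliding it down along the face
  selected by the signs of the remaining coordinates.\<close>

lemma metric_proj_cube_cone_upper:
  assumes n: "n \<ge> 1" and L: "L > 0" and b: "b \<ge> 0"
  shows "vec_norm n (metric_proj n (cube_cone n L b) x) \<le>
         b * L * sqrt n + max 0 (x 0 - b * (\<Sum>i\<in>{1..<n}. \<bar>x i\<bar>) + b\<^sup>2 * n * L)"
proof -
  define P where "P = metric_proj n (cube_cone n L b) x"
  note C = cube_cone_closed_convex[OF n L b]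
  have PC: "P \<in> cube_cone n L b" unfolding P_def by (rule metric_proj_in[OF C])
  define s where "s = P 0"
  have s: "0 \<le> s" "s \<le> L" and Pi: "\<And>i. i \<in> {1..<n} \<Longrightarrow> \<bar>P i\<bar> \<le> b * (L - s)"
    using PC by (auto simp: cube_cone_def s_def)
  have bL: "b * (L - s) \<le> b * L" "0 \<le> b * (L - s)" using b s by (auto intro: mult_left_mono)
  have "(vec_norm n P)\<^sup>2 = s\<^sup>2 + (\<Sum>i\<in>{1..<n}. (P i)\<^sup>2)"
    unfolding vec_norm_square s_def by (rule sum_lessThan_split_first[OF n])
  also have "(\<Sum>i\<in>{1..<n}. (P i)\<^sup>2) \<le> (\<Sum>i\<in>{1..<n}. (b * L)\<^sup>2)"
  proof (intro sum_mono)
    fix i assume "i \<in> {1..<n}"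
    then have "\<bar>P i\<bar> \<le> b * L" using Pi bL by fastforce
    then show "(P i)\<^sup>2 \<le> (b * L)\<^sup>2" using power_mono[of "\<bar>P i\<bar>" "b * L" 2] by simp
  qed
  also have "(\<Sum>i\<in>{1..<n}. (b * L)\<^sup>2) \<le> n * (b * L)\<^sup>2" by (simp add: mult_right_mono)
  also have "s\<^sup>2 + n * (b * L)\<^sup>2 \<le> (b * L * sqrt n + s)\<^sup>2"
  proof -
    have "(b * L * sqrt n + s)\<^sup>2 = n * (b * L)\<^sup>2 + s\<^sup>2 + 2 * (b * L * sqrt n * s)"
      by (simp add: power2_eq_square algebra_simps)
    moreover have "b * L * sqrt n * s \<ge> 0" using b L s by simp
    ultimately show ?thesis by simp
  qed
  finally have nP: "vec_norm n P \<le> b * L * sqrt n + s"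
    using b L s by (intro power2_le_imp_le[of "vec_norm n P"]) auto
  have "s \<le> x 0 - b * (\<Sum>i\<in>{1..<n}. \<bar>x i\<bar>) + b\<^sup>2 * n * L" if "s > 0"
  proof -
    \<comment> \<open>While the height drops by \<open>s\<close>, the cone widens by
      \<open>b * s\<close>, which is exactly the outward move of each coordinate; hence
      \<open>z\<close> stays in the base.\<close>
    define z where "z = (\<lambda>i\<in>{..<n}. if i = 0 then 0 else P i + b * s * sgn (x i))"
    have "z \<in> cube_cone n L b"
    proof -
      have "\<bar>z i\<bar> \<le> b * L" if i: "i \<in> {1..<n}" for i
      proof -
        have "\<bar>z i\<bar> \<le> \<bar>P i\<bar> + \<bar>b * s * sgn (x i)\<bar>" using i by (simp add: z_def abs_triangle_ineq)
        also have "\<bar>b * s * sgn (x i)\<bar> \<le> b * s" using b s by (simp add: abs_mult abs_sgn_eq)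
        also have "\<bar>P i\<bar> + b * s \<le> b * L" using Pi[OF i] by (simp add: algebra_simps)
        finally show ?thesis by simp
      qed
      then show ?thesis using n L b by (auto simp: cube_cone_def z_def vec_space_def)
    qed
    then have "(\<Sum>i<n. (x i - P i) * (z i - P i)) \<le> 0"
      unfolding P_def by (rule metric_proj_variational[OF C])
    also have "(\<Sum>i<n. (x i - P i) * (z i - P i)) = (x 0 - s) * (- s) + (\<Sum>i\<in>{1..<n}. (x i - P i) * (z i - P i))"
      using n by (subst sum_lessThan_split_first[OF n]) (simp add: z_def s_def)
    also have "(\<Sum>i\<in>{1..<n}. (x i - P i) * (z i - P i)) = (\<Sum>i\<in>{1..<n}. s * (b * (\<bar>x i\<bar> - P i * sgn (x i))))"
      by (intro sum.cong) (auto simp: z_def sgn_real_def algebra_simps)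
    also have "\<dots> = s * (\<Sum>i\<in>{1..<n}. b * (\<bar>x i\<bar> - P i * sgn (x i)))" by (simp add: sum_distrib_left)
    finally have "s * (s + (\<Sum>i\<in>{1..<n}. b * (\<bar>x i\<bar> - P i * sgn (x i)))) \<le> s * x 0" by (simp add: algebra_simps)
    then have "s \<le> x 0 - (\<Sum>i\<in>{1..<n}. b * (\<bar>x i\<bar> - P i * sgn (x i)))" using that by simp
    also have "(\<Sum>i\<in>{1..<n}. b * (\<bar>x i\<bar> - P i * sgn (x i))) \<ge> (\<Sum>i\<in>{1..<n}. b * (\<bar>x i\<bar> - b * L))"
    proof (intro sum_mono mult_left_mono diff_left_mono b)
      fix i assume i: "i \<in> {1..<n}"
      have "P i * sgn (x i) \<le> \<bar>P i\<bar>" by (auto simp: sgn_real_def)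
      then show "P i * sgn (x i) \<le> b * L" using Pi[OF i] bL by linarith
    qed
    then have "x 0 - (\<Sum>i\<in>{1..<n}. b * (\<bar>x i\<bar> - P i * sgn (x i))) \<le> x 0 - (\<Sum>i\<in>{1..<n}. b * (\<bar>x i\<bar> - b * L))" by simp
    also have "(\<Sum>i\<in>{1..<n}. b * (\<bar>x i\<bar> - b * L)) = b * (\<Sum>i\<in>{1..<n}. \<bar>x i\<bar>) - (real n - 1) * (b\<^sup>2 * L)"
      using n by (simp add: right_diff_distrib sum_subtractf sum_distrib_left[symmetric] power2_eq_square of_nat_diff)
    also have "x 0 - (b * (\<Sum>i\<in>{1..<n}. \<bar>x i\<bar>) - (real n - 1) * (b\<^sup>2 * L)) \<le> x 0 - b * (\<Sum>i\<in>{1..<n}. \<bar>x i\<bar>) + b\<^sup>2 * n * L"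
      using b L by (simp add: algebra_simps)
    finally show ?thesis .
  qed
  then have "s \<le> max 0 (x 0 - b * (\<Sum>i\<in>{1..<n}. \<bar>x i\<bar>) + b\<^sup>2 * n * L)"
    using s by (cases "s > 0") auto
  then show ?thesis using nP unfolding P_def by linarith
qed

text \<open>Test with the apex. If the projection had height \<open>s < L\<close>, its other
  coordinates would be at most \<open>b * (L - s)\<close> in modulus; dividing the variational
  inequality by \<open>L - s\<close> then bounds \<open>x 0\<close> below the assumed
  threshold.\<close>

lemma metric_proj_cube_cone_lower:
  assumes n: "n \<ge> 1" and L: "L > 0" and b: "b \<ge> 0"
    and x: "L + b * (\<Sum>i\<in>{1..<n}. \<bar>x i\<bar>) \<le> x 0"
  shows "L \<le> vec_norm n (metric_proj n (cube_cone n L b) x)"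
proof -
  define P where "P = metric_proj n (cube_cone n L b) x"
  note C = cube_cone_closed_convex[OF n L b]
  have PC: "P \<in> cube_cone n L b" unfolding P_def by (rule metric_proj_in[OF C])
  define s where "s = P 0"
  have s: "0 \<le> s" "s \<le> L" and Pi: "\<And>i. i \<in> {1..<n} \<Longrightarrow> \<bar>P i\<bar> \<le> b * (L - s)"
    using PC by (auto simp: cube_cone_def s_def)
  have "L \<le> s"
  proof (rule ccontr)
    assume "\<not> L \<le> s"
    then have sL: "s < L" by simp
    have "(\<Sum>i<n. (x i - P i) * ((\<lambda>i\<in>{..<n}. if i = 0 then L else 0) i - P i)) \<le> 0"
      unfolding P_def by (rule metric_proj_variational[OF C cube_cone_apex[OF n L]])
    also have "(\<Sum>i<n. (x i - P i) * ((\<lambda>i\<in>{..<n}. if i = 0 then L else 0) i - P i)) =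
        (x 0 - s) * (L - s) - (\<Sum>i\<in>{1..<n}. (x i - P i) * P i)"
      unfolding sum_negf[symmetric] diff_conv_add_uminus[of "(x 0 - s) * (L - s)"]
      using n by (subst sum_lessThan_split_first[OF n]) (auto simp: s_def intro!: sum.cong)
    finally have "(x 0 - s) * (L - s) \<le> (\<Sum>i\<in>{1..<n}. (x i - P i) * P i)" by simp
    also have "\<dots> \<le> (\<Sum>i\<in>{1..<n}. \<bar>x i\<bar> * (b * (L - s)))"
    proof (intro sum_mono)
      fix i assume i: "i \<in> {1..<n}"
      have "(x i - P i) * P i = x i * P i - (P i)\<^sup>2" by (simp add: power2_eq_square algebra_simps)
      also have "\<dots> \<le> \<bar>x i * P i\<bar>" using zero_le_power2[of "P i"] by linarith
      also have "\<dots> = \<bar>x i\<bar> * \<bar>P i\<bar>" by (simp add: abs_mult)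
      also have "\<dots> \<le> \<bar>x i\<bar> * (b * (L - s))" using Pi[OF i] by (intro mult_left_mono) auto
      finally show "(x i - P i) * P i \<le> \<bar>x i\<bar> * (b * (L - s))" .
    qed
    also have "\<dots> = (b * (\<Sum>i\<in>{1..<n}. \<bar>x i\<bar>)) * (L - s)" by (simp add: sum_distrib_left sum_distrib_right mult_ac)
    finally have "x 0 - s \<le> b * (\<Sum>i\<in>{1..<n}. \<bar>x i\<bar>)" using sL by simp
    then show False using x sL by simp
  qed
  also have "s \<le> vec_norm n P"
    unfolding s_def vec_norm_def using n by (intro member_le_L2_set) auto
  finally show ?thesis by (simp add: P_def)
qed

section \<open>One-dimensional Gaussian estimates\<close>

text \<open>The mean of the modulus of a standard normal variable. The sum of moduli that pushes the
  projection towards the base is close to \<open>n\<close> times this value, which calibrates the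
  opening of the cone.\<close>

abbreviation gauss_abs_mean :: real where "gauss_abs_mean \<equiv> sqrt (2 / pi)"

lemma gauss_abs_mean_bounds: "1 / 2 \<le> gauss_abs_mean" "gauss_abs_mean \<le> 1"
proof -
  have "(1 / 2)\<^sup>2 \<le> 2 / pi" using pi_less_4 pi_gt_zero by (simp add: field_simps power2_eq_square)
  then show "1 / 2 \<le> gauss_abs_mean" by (rule real_le_rsqrt)
  have "2 / pi \<le> 1" using pi_gt3 by simp
  then show "gauss_abs_mean \<le> 1" by (simp add: real_sqrt_le_iff)
qed

lemma gauss1_nn_integral_eq:
  fixes h :: "real \<Rightarrow> real"
  assumes "has_bochner_integral lborel (\<lambda>x. std_normal_density x * h x) c" and "\<And>x. h x \<ge> 0"
    and [measurable]: "h \<in> borel_measurable borel"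
  shows "(\<integral>\<^sup>+ x. ennreal (h x) \<partial>gauss1) = ennreal c"
proof -
  have "(\<integral>\<^sup>+ x. ennreal (h x) \<partial>gauss1) = (\<integral>\<^sup>+ x. ennreal (std_normal_density x * h x) \<partial>lborel)"
    using assms(2) by (subst nn_integral_density) (auto simp: ennreal_mult')
  also have "\<dots> = ennreal c"
    using assms by (subst nn_integral_eq_integral) (auto simp: has_bochner_integral_iff)
  finally show ?thesis .
qed

lemma std_normal_has_integral_quadratic:
  "has_bochner_integral lborel (\<lambda>x. std_normal_density x * (1 + u * \<bar>x\<bar> + v * x\<^sup>2)) (1 + u * gauss_abs_mean + v)"
proof -
  have 0: "has_bochner_integral lborel std_normal_density 1"
    by (simp add: has_bochner_integral_iff)
  have 1: "has_bochner_integral lborel (\<lambda>x. std_normal_density x * \<bar>x\<bar>) gauss_abs_mean"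
    using std_normal_moment_abs_odd[of 0] by simp
  have 2: "has_bochner_integral lborel (\<lambda>x. std_normal_density x * x\<^sup>2) 1"
    using std_normal_moment_even[of 1] by simp
  have "has_bochner_integral lborel (\<lambda>x. std_normal_density x + u * (std_normal_density x * \<bar>x\<bar>) + v * (std_normal_density x * x\<^sup>2))
     (1 + u * gauss_abs_mean + v * 1)"
    by (intro has_bochner_integral_add has_bochner_integral_mult_right 0 1 2)
  then show ?thesis by (simp add: algebra_simps)
qed

lemma gauss1_exp_neg_abs:
  assumes "\<mu> \<ge> 0"
  shows "(\<integral>\<^sup>+ x. ennreal (exp (- \<mu> * \<bar>x\<bar>)) \<partial>gauss1) \<le> ennreal (exp (- \<mu> * gauss_abs_mean + \<mu>\<^sup>2 / 2))"
proof -
  have pt: "exp (- a) \<le> 1 - a + a\<^sup>2 / 2" if "a \<ge> 0" for a :: real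
  proof -
    \<comment> \<open>The product equals 1 + a^4 / 4, so the quadratic Taylor bound for
      \<open>exp a\<close> yields one for \<open>exp (- a)\<close>.\<close>
    have "1 \<le> (1 - a + a\<^sup>2 / 2) * (1 + a + a\<^sup>2 / 2)"
      using that by (simp add: power2_eq_square algebra_simps)
    also have "0 \<le> 1 - a + a\<^sup>2 / 2"
      using zero_le_power2[of "a - 1"] by (simp add: power2_eq_square algebra_simps)
    then have "(1 - a + a\<^sup>2 / 2) * (1 + a + a\<^sup>2 / 2) \<le> (1 - a + a\<^sup>2 / 2) * exp a"
      using exp_lower_Taylor_quadratic[OF that] by (intro mult_left_mono) auto
    finally show ?thesis by (simp add: exp_minus field_simps)
  qed
  have nn: "0 \<le> 1 + (- \<mu>) * \<bar>x\<bar> + \<mu>\<^sup>2 / 2 * x\<^sup>2" for x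
    using order_trans[OF exp_ge_zero pt[of "\<mu> * \<bar>x\<bar>"]] assms by (simp add: power_mult_distrib)
  have "(\<integral>\<^sup>+ x. ennreal (exp (- \<mu> * \<bar>x\<bar>)) \<partial>gauss1) \<le> (\<integral>\<^sup>+ x. ennreal (1 + (- \<mu>) * \<bar>x\<bar> + \<mu>\<^sup>2 / 2 * x\<^sup>2) \<partial>gauss1)"
    using pt[of "\<mu> * \<bar>x\<bar>" for x] assms by (intro nn_integral_mono ennreal_leI) (simp add: power_mult_distrib)
  also have "\<dots> = ennreal (1 + (- \<mu>) * gauss_abs_mean + \<mu>\<^sup>2 / 2)"
    by (intro gauss1_nn_integral_eq std_normal_has_integral_quadratic nn) measurable
  also have "\<dots> \<le> ennreal (exp (- \<mu> * gauss_abs_mean + \<mu>\<^sup>2 / 2))"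
    using exp_ge_add_one_self[of "- \<mu> * gauss_abs_mean + \<mu>\<^sup>2 / 2"] by (intro ennreal_leI) linarith
  finally show ?thesis .
qed

lemma gauss1_exp_linear: "(\<integral>\<^sup>+ x. ennreal (exp (v * x)) \<partial>gauss1) = ennreal (exp (v\<^sup>2 / 2))"
proof -
  interpret prob_space gauss1 by (rule prob_space_gauss1)
  have "1 = (\<integral>\<^sup>+ x. ennreal (exp (v * x - v\<^sup>2 / 2)) \<partial>gauss1)"
    using gauss1_shift[of "\<lambda>_. 1" v] emeasure_space_1 by simp
  then have "ennreal (exp (v\<^sup>2 / 2)) = ennreal (exp (v\<^sup>2 / 2)) * (\<integral>\<^sup>+ x. ennreal (exp (v * x - v\<^sup>2 / 2)) \<partial>gauss1)"
    by simp
  also have "\<dots> = (\<integral>\<^sup>+ x. ennreal (exp (v\<^sup>2 / 2)) * ennreal (exp (v * x - v\<^sup>2 / 2)) \<partial>gauss1)"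
    by (rule nn_integral_cmult[symmetric]) measurable
  also have "\<dots> = (\<integral>\<^sup>+ x. ennreal (exp (v * x)) \<partial>gauss1)"
    by (intro nn_integral_cong) (simp flip: ennreal_mult' exp_add)
  finally show ?thesis by simp
qed

text \<open>Integrates \<open>exp a \<le> 1 + a + a\<^sup>2 * exp a\<close>. The remainder is at
  most \<open>2 * \<mu>\<^sup>2 * exp (2 * \<bar>x\<bar>)\<close>, whose mean is at most
  \<open>4 * exp 2 * \<mu>\<^sup>2\<close>; \<open>exp 2 \<le> 9\<close> gives 36.\<close>

lemma gauss1_exp_pos_abs:
  assumes "0 \<le> \<mu>" "\<mu> \<le> 1"
  shows "(\<integral>\<^sup>+ x. ennreal (exp (\<mu> * \<bar>x\<bar>)) \<partial>gauss1) \<le> ennreal (exp (\<mu> * gauss_abs_mean + 36 * \<mu>\<^sup>2))"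
proof -
  have pt: "exp a \<le> 1 + a + a\<^sup>2 * exp a" if "a \<ge> 0" for a :: real
  proof -
    have "(1 + a) * (1 - a) \<le> (1 + a) * exp (- a)"
      using exp_ge_add_one_self[of "- a"] that by (intro mult_left_mono) auto
    then have "1 \<le> (1 + a) * exp (- a) + a\<^sup>2" by (simp add: power2_eq_square algebra_simps)
    then have "1 * exp a \<le> ((1 + a) * exp (- a) + a\<^sup>2) * exp a" by (rule mult_right_mono) simp
    also have "\<dots> = 1 + a + a\<^sup>2 * exp a" by (simp add: distrib_right mult.assoc flip: exp_add)
    finally show ?thesis by simp
  qed
  have pt2: "exp (\<mu> * \<bar>x\<bar>) \<le> 1 + \<mu> * \<bar>x\<bar> + 0 * x\<^sup>2 + 2 * \<mu>\<^sup>2 * (exp (2 * x) + exp (- 2 * x))" for x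
  proof -
    have "exp (\<mu> * \<bar>x\<bar>) \<le> 1 + \<mu> * \<bar>x\<bar> + (\<mu> * \<bar>x\<bar>)\<^sup>2 * exp (\<mu> * \<bar>x\<bar>)" using assms by (intro pt) auto
    also have "(\<mu> * \<bar>x\<bar>)\<^sup>2 * exp (\<mu> * \<bar>x\<bar>) \<le> (\<mu>\<^sup>2 * (2 * exp \<bar>x\<bar>)) * exp \<bar>x\<bar>"
    proof (intro mult_mono)
      have "x\<^sup>2 \<le> 2 * exp \<bar>x\<bar>" using exp_lower_Taylor_quadratic[of "\<bar>x\<bar>"] by simp
      then show "(\<mu> * \<bar>x\<bar>)\<^sup>2 \<le> \<mu>\<^sup>2 * (2 * exp \<bar>x\<bar>)" by (simp add: power_mult_distrib mult_left_mono)
      show "exp (\<mu> * \<bar>x\<bar>) \<le> exp \<bar>x\<bar>" using assms by (simp add: mult_left_le_one_le)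
    qed auto
    also have "\<dots> = 2 * \<mu>\<^sup>2 * exp (2 * \<bar>x\<bar>)" by (simp flip: exp_add)
    also have "\<dots> \<le> 2 * \<mu>\<^sup>2 * (exp (2 * x) + exp (- 2 * x))"
      by (intro mult_left_mono) (auto simp: abs_if)
    finally show ?thesis by simp
  qed
  have "(\<integral>\<^sup>+ x. ennreal (exp (\<mu> * \<bar>x\<bar>)) \<partial>gauss1) \<le>
     (\<integral>\<^sup>+ x. ennreal (1 + \<mu> * \<bar>x\<bar> + 0 * x\<^sup>2) + ennreal (2 * \<mu>\<^sup>2) * (ennreal (exp (2 * x)) + ennreal (exp ((- 2) * x))) \<partial>gauss1)"
    using pt2 assms by (intro nn_integral_mono) (auto simp flip: ennreal_plus ennreal_mult' intro!: ennreal_leI)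
  also have "\<dots> = ennreal (1 + \<mu> * gauss_abs_mean + 0) + ennreal (2 * \<mu>\<^sup>2) * (ennreal (exp (2\<^sup>2 / 2)) + ennreal (exp ((- 2)\<^sup>2 / 2)))"
  proof -
    have "(\<integral>\<^sup>+ x. ennreal (1 + \<mu> * \<bar>x\<bar> + 0 * x\<^sup>2) \<partial>gauss1) = ennreal (1 + \<mu> * gauss_abs_mean + 0)"
      using assms by (intro gauss1_nn_integral_eq std_normal_has_integral_quadratic) auto
    moreover have "(\<integral>\<^sup>+ x. ennreal (2 * \<mu>\<^sup>2) * (ennreal (exp (2 * x)) + ennreal (exp ((- 2) * x))) \<partial>gauss1) =
        ennreal (2 * \<mu>\<^sup>2) * (ennreal (exp (2\<^sup>2 / 2)) + ennreal (exp ((- 2)\<^sup>2 / 2)))"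
      unfolding gauss1_exp_linear[symmetric] by (subst nn_integral_add[symmetric]) (auto simp: nn_integral_cmult)
    ultimately show ?thesis by (subst nn_integral_add) (auto simp only: measurable_lborel1, measurable)
  qed
  also have "\<dots> = ennreal (1 + \<mu> * gauss_abs_mean + 4 * exp 2 * \<mu>\<^sup>2)"
    using assms by (simp flip: ennreal_plus ennreal_mult' add: algebra_simps)
  also have "\<dots> \<le> ennreal (exp (\<mu> * gauss_abs_mean + 36 * \<mu>\<^sup>2))"
  proof (intro ennreal_leI)
    have "exp (2::real) \<le> 3 * 3"
    proof -
      have "exp (2::real) = exp 1 * exp 1" by (simp flip: exp_add)
      also have "\<dots> \<le> 3 * 3" by (intro mult_mono exp_le) auto
      finally show ?thesis .
    qed
    then have "4 * exp 2 * \<mu>\<^sup>2 \<le> 36 * \<mu>\<^sup>2" by (intro mult_right_mono) auto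
    then show "1 + \<mu> * gauss_abs_mean + 4 * exp 2 * \<mu>\<^sup>2 \<le> exp (\<mu> * gauss_abs_mean + 36 * \<mu>\<^sup>2)"
      using exp_ge_add_one_self[of "\<mu> * gauss_abs_mean + 36 * \<mu>\<^sup>2"] by linarith
  qed
  finally show ?thesis .
qed

text \<open>The density is at most \<open>exp (t\<^sup>2 / 2 - t * x) / 2\<close>. Half of the decay
  beyond \<open>a\<close> absorbs the power, the other half integrates to \<open>2 / t\<close>. The
  dependence \<open>exp (- t * a)\<close> on the threshold is what later allows averaging over a
  random threshold; the prefactor \<open>1 / t\<close> matters for narrow cones.\<close>

lemma gauss1_excess_moment:
  assumes t: "t > 0" and p: "p > 0"
  shows "(\<integral>\<^sup>+ x. ennreal ((max 0 (x - a)) powr p) \<partial>gauss1) \<le> ennreal ((p / t) powr p / t * exp (t\<^sup>2 / 2 - t * a))"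
proof -
  have pw: "z powr p \<le> (p / t) powr p * exp (t * z / 2)" if z: "z > 0" for z
  proof -
    define w where "w = t * z / p"
    have w0: "w > 0" using t z p by (simp add: w_def)
    have "ln (w / 2) \<le> w / 2 - 1" using w0 by (intro ln_le_minus_one) auto
    then have "ln w \<le> w / 2" using w0 ln_2_less_1 by (simp add: ln_div)
    then have "p * ln w \<le> p * (w / 2)" using p by (intro mult_left_mono) auto
    then have "w powr p \<le> exp (t * z / 2)" using w0 p by (simp add: powr_def w_def)
    then have "(p / t) powr p * w powr p \<le> (p / t) powr p * exp (t * z / 2)" by (intro mult_left_mono) auto
    moreover have "(p / t) powr p * w powr p = z powr p"
      using t z p by (simp add: w_def powr_mult[symmetric])
    ultimately show ?thesis by simp
  qed
  define K where "K = (p / t) powr p * exp (t\<^sup>2 / 2 - t * a) / 2"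
  have K0: "K \<ge> 0" by (simp add: K_def)
  have dens: "std_normal_density x \<le> exp (t\<^sup>2 / 2 - t * x) / 2" for x
  proof -
    have s2: "sqrt (2 * pi) \<ge> 2" using pi_gt3 by (intro real_le_rsqrt) auto
    have "- x\<^sup>2 / 2 \<le> t\<^sup>2 / 2 - t * x" using zero_le_power2[of "x - t"] by (simp add: power2_eq_square algebra_simps)
    then have "exp (- x\<^sup>2 / 2) \<le> exp (t\<^sup>2 / 2 - t * x)" by simp
    then have "1 / sqrt (2 * pi) * exp (- x\<^sup>2 / 2) \<le> 1 / 2 * exp (t\<^sup>2 / 2 - t * x)"
      using s2 by (intro mult_mono) (auto simp: field_simps)
    then show ?thesis by (simp add: std_normal_density_def)
  qed
  have "(\<integral>\<^sup>+ x. ennreal ((max 0 (x - a)) powr p) \<partial>gauss1) =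
      (\<integral>\<^sup>+ x. ennreal (std_normal_density x * (max 0 (x - a)) powr p) \<partial>lborel)"
    by (subst nn_integral_density) (auto simp: ennreal_mult')
  also have "\<dots> \<le> (\<integral>\<^sup>+ x. ennreal K * (ennreal (exp (- t * (x - a) / 2)) * indicator {a..} x) \<partial>lborel)"
  proof (intro nn_integral_mono)
    fix x
    have "std_normal_density x * (max 0 (x - a)) powr p \<le> K * exp (- t * (x - a) / 2)" if "x > a"
    proof -
      have "std_normal_density x * (max 0 (x - a)) powr p \<le> (exp (t\<^sup>2 / 2 - t * x) / 2) * ((p / t) powr p * exp (t * (x - a) / 2))"
        using that dens pw[of "x - a"] by (intro mult_mono) auto
      also have "\<dots> = (p / t) powr p / 2 * (exp (t\<^sup>2 / 2 - t * x) * exp (t * (x - a) / 2))" by simp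
      also have "exp (t\<^sup>2 / 2 - t * x) * exp (t * (x - a) / 2) = exp (t\<^sup>2 / 2 - t * a) * exp (- t * (x - a) / 2)"
        unfolding exp_add[symmetric] by (rule arg_cong[where f=exp]) (simp add: field_simps)
      finally show ?thesis by (simp add: K_def)
    qed
    then show "ennreal (std_normal_density x * (max 0 (x - a)) powr p) \<le> ennreal K * (ennreal (exp (- t * (x - a) / 2)) * indicator {a..} x)"
      using K0 by (cases "x > a") (auto simp flip: ennreal_mult' intro!: ennreal_leI)
  qed
  also have "\<dots> = ennreal K * (\<integral>\<^sup>+ x. ennreal (exp (- t * (x - a) / 2)) * indicator {a..} x \<partial>lborel)"
    by (rule nn_integral_cmult) measurable
  also have "(\<integral>\<^sup>+ x. ennreal (exp (- t * (x - a) / 2)) * indicator {a..} x \<partial>lborel) = ennreal (0 - (- (2 / t) * exp (- t * (a - a) / 2)))"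
  proof (rule nn_integral_FTC_atLeast[where F="\<lambda>x. - (2 / t) * exp (- t * (x - a) / 2)"])
    show "((\<lambda>x. - (2 / t) * exp (- t * (x - a) / 2)) \<longlongrightarrow> 0) at_top"
      using t by real_asymp
  qed (use t in \<open>auto intro!: derivative_eq_intros\<close>)
  also have "ennreal K * \<dots> = ennreal ((p / t) powr p / t * exp (t\<^sup>2 / 2 - t * a))"
    using K0 t by (simp add: ennreal_mult'[symmetric] K_def)
  finally show ?thesis .
qed

text \<open>Keeps only the interval of length \<open>d\<close> above \<open>u\<close>. The width is
  left free because both 1 and the natural decay length \<open>1 / t\<close> are used.\<close>

lemma gauss1_upper_tail:
  assumes "u \<ge> 0" "d > 0"
  shows "emeasure gauss1 {u..} \<ge> ennreal (d / 3 * exp (- (u + d)\<^sup>2 / 2))"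
proof -
  have s: "sqrt (2 * pi) \<le> 3"
    using pi_less_4 by (intro real_le_lsqrt) auto
  have "ennreal (d / 3 * exp (- (u + d)\<^sup>2 / 2)) = (\<integral>\<^sup>+ x. ennreal (1 / 3 * exp (- (u + d)\<^sup>2 / 2)) * indicator {u..u + d} x \<partial>lborel)"
    using assms by (subst nn_integral_cmult_indicator) (auto simp: ennreal_mult'[symmetric])
  also have "\<dots> \<le> (\<integral>\<^sup>+ x. ennreal (std_normal_density x) * indicator {u..} x \<partial>lborel)"
  proof (intro nn_integral_mono)
    fix x
    have "1 / 3 * exp (- (u + d)\<^sup>2 / 2) \<le> std_normal_density x" if "u \<le> x" "x \<le> u + d"
    proof -
      have "x\<^sup>2 \<le> (u + d)\<^sup>2" using that assms by (intro power_mono) auto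
      then show ?thesis unfolding std_normal_density_def
        using s by (intro mult_mono) (auto simp: field_simps)
    qed
    then show "ennreal (1 / 3 * exp (- (u + d)\<^sup>2 / 2)) * indicator {u..u + d} x \<le> ennreal (std_normal_density x) * indicator {u..} x"
      by (auto simp: indicator_def intro!: ennreal_leI)
  qed
  also have "\<dots> = emeasure gauss1 {u..}"
    by (subst emeasure_density) auto
  finally show ?thesis .
qed

lemma std_gaussian_prod_nn_integral:
  assumes n: "n \<ge> 1" and [measurable]: "g \<in> borel_measurable borel" "h \<in> borel_measurable borel"
  shows "(\<integral>\<^sup>+ x. g (x 0) * (\<Prod>i\<in>{1..<n}. h (x i)) \<partial>std_gaussian n) =
    (\<integral>\<^sup>+ x. g x \<partial>gauss1) * (\<integral>\<^sup>+ x. h x \<partial>gauss1) ^ (n - 1)"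
proof -
  interpret product_sigma_finite "\<lambda>_::nat. gauss1" by (rule product_sigma_finite_gauss1)
  have s: "(\<Prod>i<n. k i) = k 0 * (\<Prod>i\<in>{1..<n}. k i)" for k :: "nat \<Rightarrow> ennreal"
    using n unfolding lessThan_atLeast0 by (subst prod.atLeast_Suc_lessThan) auto
  define k where "k i = (if i = 0 then g else h)" for i :: nat
  have "(\<integral>\<^sup>+ x. g (x 0) * (\<Prod>i\<in>{1..<n}. h (x i)) \<partial>std_gaussian n) = (\<integral>\<^sup>+ x. (\<Prod>i<n. k i (x i)) \<partial>std_gaussian n)"
    unfolding s by (intro nn_integral_cong arg_cong2[where f="(*)"] prod.cong) (auto simp: k_def)
  also have "\<dots> = (\<Prod>i<n. integral\<^sup>N gauss1 (k i))"
    unfolding std_gaussian_eq by (rule product_nn_integral_prod) (auto simp: k_def)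
  also have "\<dots> = (\<integral>\<^sup>+ x. g x \<partial>gauss1) * (\<integral>\<^sup>+ x. h x \<partial>gauss1) ^ (n - 1)"
    unfolding s by (auto simp: k_def intro!: arg_cong2[where f="(*)"] prod.cong[THEN trans, OF refl _ prod_constant])
  finally show ?thesis .
qed

text \<open>The two conditions are independent. Chernoff's bound with
  \<open>\<mu> = 1 / sqrt n\<close> for the sum of moduli has exponent at most 36 - 37 = -1, and
  \<open>exp (- 1)\<close> is below 1/2; this is the origin of the 37.\<close>

lemma cone_event_prob:
  assumes n: "n \<ge> 1"
  shows "emeasure (std_gaussian n) {x \<in> vec_space n. u \<le> x 0 \<and> (\<Sum>i\<in>{1..<n}. \<bar>x i\<bar>) \<le> gauss_abs_mean * n + 37 * sqrt n}
     \<ge> ennreal (1 / 2) * emeasure gauss1 {u..}"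
proof -
  interpret prob_space "std_gaussian n" by (rule prob_space_std_gaussian)
  interpret G: prob_space gauss1 by (rule prob_space_gauss1)
  define S where "S x = (\<Sum>i\<in>{1..<n}. \<bar>x i :: real\<bar>)" for x
  define m where "m = gauss_abs_mean * n + 37 * sqrt n"
  define \<mu> where "\<mu> = 1 / sqrt n"
  have \<mu>: "0 \<le> \<mu>" "\<mu> \<le> 1" using n by (auto simp: \<mu>_def)
  have [measurable]: "(\<lambda>x. x 0) \<in> borel_measurable (std_gaussian n)" "S \<in> borel_measurable (std_gaussian n)"
    using n unfolding std_gaussian_def S_def by auto
  let ?V = "space (std_gaussian n)"
  have sm [measurable]: "{x \<in> ?V. u \<le> x 0 \<and> S x \<le> m} \<in> sets (std_gaussian n)" "{x \<in> ?V. u \<le> x 0 \<and> m < S x} \<in> sets (std_gaussian n)"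
    "{x \<in> ?V. u \<le> x 0} \<in> sets (std_gaussian n)"
    by measurable
  define A B where "A = prob {x \<in> ?V. u \<le> x 0 \<and> S x \<le> m}" and "B = prob {x \<in> ?V. u \<le> x 0 \<and> m < S x}"
  define t where "t = measure gauss1 {u..}"
  have "ennreal (prob {x \<in> ?V. u \<le> x 0}) = (\<integral>\<^sup>+ x. indicator {u..} (x 0) * (\<Prod>i\<in>{1..<n}. (\<lambda>_. 1) (x i)) \<partial>std_gaussian n)"
    unfolding emeasure_eq_measure[symmetric] nn_integral_indicator[symmetric, OF sm(3)]
    by (intro nn_integral_cong) (auto simp: indicator_def)
  also have "\<dots> = ennreal t"
    using G.emeasure_space_1 by (subst std_gaussian_prod_nn_integral[OF n]) (auto simp: t_def G.emeasure_eq_measure)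
  finally have tot: "prob {x \<in> ?V. u \<le> x 0} = t" by (simp add: t_def)
  have "{x \<in> ?V. u \<le> x 0} = {x \<in> ?V. u \<le> x 0 \<and> S x \<le> m} \<union> {x \<in> ?V. u \<le> x 0 \<and> m < S x}" by auto
  then have AB: "t \<le> A + B" unfolding tot[symmetric] A_def B_def by (simp only: measure_Un_le sm)
  have "ennreal B = (\<integral>\<^sup>+ x. indicator {x \<in> ?V. u \<le> x 0 \<and> m < S x} x \<partial>std_gaussian n)"
    unfolding B_def emeasure_eq_measure[symmetric] nn_integral_indicator[OF sm(2)] ..
  also have "\<dots> \<le> (\<integral>\<^sup>+ x. (ennreal (exp (- \<mu> * m)) * indicator {u..} (x 0)) * (\<Prod>i\<in>{1..<n}. ennreal (exp (\<mu> * \<bar>x i\<bar>))) \<partial>std_gaussian n)"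
  proof (intro nn_integral_mono)
    fix x
    have "(\<Prod>i\<in>{1..<n}. ennreal (exp (\<mu> * \<bar>x i\<bar>))) = ennreal (exp (\<mu> * S x))"
      by (subst prod_ennreal) (auto simp: S_def exp_sum[symmetric] sum_distrib_left)
    moreover have "1 \<le> ennreal (exp (- \<mu> * m)) * ennreal (exp (\<mu> * S x))" if "m < S x"
    proof -
      have "0 \<le> - \<mu> * m + \<mu> * S x"
        using mult_left_mono[of m "S x" \<mu>] that \<mu> by simp
      then have "1 \<le> exp (- \<mu> * m) * exp (\<mu> * S x)" unfolding exp_add[symmetric] by (rule one_le_exp_iff[THEN iffD2])
      then have "ennreal 1 \<le> ennreal (exp (- \<mu> * m) * exp (\<mu> * S x))" by (rule ennreal_leI)
      then show ?thesis by (simp only: ennreal_mult' exp_ge_zero ennreal_1)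
    qed
    ultimately show "indicator {x \<in> ?V. u \<le> x 0 \<and> m < S x} x \<le> (ennreal (exp (- \<mu> * m)) * indicator {u..} (x 0)) * (\<Prod>i\<in>{1..<n}. ennreal (exp (\<mu> * \<bar>x i\<bar>)))"
      by (auto simp: indicator_def)
  qed
  also have "\<dots> = (ennreal (exp (- \<mu> * m)) * ennreal t) * (\<integral>\<^sup>+ x. ennreal (exp (\<mu> * \<bar>x\<bar>)) \<partial>gauss1) ^ (n - 1)"
    by (subst std_gaussian_prod_nn_integral[OF n]) (auto simp: nn_integral_cmult t_def G.emeasure_eq_measure)
  also have "\<dots> \<le> (ennreal (exp (- \<mu> * m)) * ennreal t) * ennreal (exp (\<mu> * gauss_abs_mean + 36 * \<mu>\<^sup>2)) ^ (n - 1)"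
    by (intro mult_left_mono power_mono_ennreal gauss1_exp_pos_abs \<mu>) auto
  also have "\<dots> = ennreal (exp (- \<mu> * m) * t * exp (\<mu> * gauss_abs_mean + 36 * \<mu>\<^sup>2) ^ (n - 1))"
    by (simp add: ennreal_mult ennreal_power t_def)
  also have "\<dots> \<le> ennreal (t / 2)"
  proof (intro ennreal_leI)
    have "exp (\<mu> * gauss_abs_mean + 36 * \<mu>\<^sup>2) ^ (n - 1) \<le> exp (\<mu> * gauss_abs_mean + 36 * \<mu>\<^sup>2) ^ n"
      using \<mu> by (intro power_increasing) auto
    also have "\<dots> = exp (n * (\<mu> * gauss_abs_mean + 36 * \<mu>\<^sup>2))" by (simp add: exp_of_nat_mult)
    also have "n * (\<mu> * gauss_abs_mean + 36 * \<mu>\<^sup>2) = \<mu> * m - 1"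
    proof -
      have "n * \<mu>\<^sup>2 = 1" "\<mu> * sqrt n = 1" using n by (auto simp: \<mu>_def power_divide)
      then show ?thesis by (simp add: m_def algebra_simps)
    qed
    finally have "exp (- \<mu> * m) * t * exp (\<mu> * gauss_abs_mean + 36 * \<mu>\<^sup>2) ^ (n - 1) \<le> exp (- \<mu> * m) * t * exp (\<mu> * m - 1)"
      by (intro mult_left_mono) (auto simp: t_def)
    also have "\<dots> = t * exp (- 1)" by (simp add: mult_ac flip: exp_add)
    also have "\<dots> \<le> t * (1 / 2)"
      using exp_ge_add_one_self[of "1::real"] by (intro mult_left_mono) (auto simp: exp_minus field_simps t_def)
    finally show "exp (- \<mu> * m) * t * exp (\<mu> * gauss_abs_mean + 36 * \<mu>\<^sup>2) ^ (n - 1) \<le> t / 2" by simp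
  qed
  finally have "B \<le> t / 2" by (simp add: t_def)
  then have "t / 2 \<le> A" using AB by simp
  have "ennreal (1 / 2) * ennreal t \<le> ennreal A"
  proof -
    have "ennreal (1 / 2) * ennreal t = ennreal (1 / 2 * t)"
      by (rule ennreal_mult[symmetric]) (simp_all add: t_def)
    also have "\<dots> \<le> ennreal A" using \<open>t / 2 \<le> A\<close> by (intro ennreal_leI) simp
    finally show ?thesis .
  qed
  then show ?thesis
    unfolding A_def t_def S_def m_def by (simp add: emeasure_eq_measure G.emeasure_eq_measure)
qed

text \<open>Integrate over \<open>x 0\<close> first, for the threshold determined by the other
  coordinates. The result is exponential in their sum of moduli, so the remaining integral
  factorizes.\<close>

lemma cone_excess_moment:
  assumes n: "n \<ge> 1" and t: "t > 0" and p: "p > 0" and b: "b \<ge> 0"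
  shows "(\<integral>\<^sup>+ x. ennreal ((max 0 (x 0 - b * (\<Sum>i\<in>{1..<n}. \<bar>x i\<bar>) + k)) powr p) \<partial>std_gaussian n)
     \<le> ennreal ((p / t) powr p / t * exp (t\<^sup>2 / 2 + t * k + (real n - 1) * (- (t * b) * gauss_abs_mean + (t * b)\<^sup>2 / 2)))"
proof -
  interpret product_sigma_finite "\<lambda>_::nat. gauss1" by (rule product_sigma_finite_gauss1)
  have ins: "{..<n} = insert 0 {1..<n}" using n by auto
  define S where "S x = (\<Sum>i\<in>{1..<n}. \<bar>x i :: real\<bar>)" for x
  define c where "c = (p / t) powr p / t"
  have c0: "c \<ge> 0" using t by (simp add: c_def)
  have [measurable]: "S \<in> borel_measurable (gaussPi (insert 0 {1..<n}))" unfolding S_def by measurable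
  have "(\<integral>\<^sup>+ x. ennreal ((max 0 (x 0 - b * S x + k)) powr p) \<partial>std_gaussian n) =
     (\<integral>\<^sup>+ x. (\<integral>\<^sup>+ y. ennreal ((max 0 ((x(0 := y)) 0 - b * S (x(0 := y)) + k)) powr p) \<partial>gauss1) \<partial>(gaussPi {1..<n}))"
    unfolding std_gaussian_eq ins by (intro product_nn_integral_insert) (auto simp del: One_nat_def)
  also have "\<dots> = (\<integral>\<^sup>+ x. (\<integral>\<^sup>+ y. ennreal ((max 0 (y - (b * S x - k))) powr p) \<partial>gauss1) \<partial>(gaussPi {1..<n}))"
    by (simp add: S_def algebra_simps)
  also have "\<dots> \<le> (\<integral>\<^sup>+ x. ennreal (c * exp (t\<^sup>2 / 2 - t * (b * S x - k))) \<partial>(gaussPi {1..<n}))"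
    unfolding c_def by (intro nn_integral_mono gauss1_excess_moment t p)
  also have "\<dots> = (\<integral>\<^sup>+ x. ennreal (c * exp (t\<^sup>2 / 2 + t * k)) * (\<Prod>i\<in>{1..<n}. ennreal (exp (- (t * b) * \<bar>x i\<bar>))) \<partial>(gaussPi {1..<n}))"
  proof (intro nn_integral_cong)
    fix x :: "nat \<Rightarrow> real"
    have "(\<Prod>i\<in>{1..<n}. ennreal (exp (- (t * b) * \<bar>x i\<bar>))) = ennreal (exp (- (t * b) * S x))"
      by (subst prod_ennreal) (auto simp: S_def exp_sum[symmetric] sum_distrib_left)
    then show "ennreal (c * exp (t\<^sup>2 / 2 - t * (b * S x - k))) = ennreal (c * exp (t\<^sup>2 / 2 + t * k)) * (\<Prod>i\<in>{1..<n}. ennreal (exp (- (t * b) * \<bar>x i\<bar>)))"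
      using c0 by (simp add: ennreal_mult'[symmetric] mult.assoc algebra_simps flip: exp_add)
  qed
  also have "\<dots> = ennreal (c * exp (t\<^sup>2 / 2 + t * k)) * (\<integral>\<^sup>+ x. (\<Prod>i\<in>{1..<n}. ennreal (exp (- (t * b) * \<bar>x i\<bar>))) \<partial>(gaussPi {1..<n}))"
    by (rule nn_integral_cmult) measurable
  also have "(\<integral>\<^sup>+ x. (\<Prod>i\<in>{1..<n}. ennreal (exp (- (t * b) * \<bar>x i\<bar>))) \<partial>(gaussPi {1..<n})) =
     (\<Prod>i\<in>{1..<n}. (\<integral>\<^sup>+ x. ennreal (exp (- (t * b) * \<bar>x\<bar>)) \<partial>gauss1))"
    by (rule product_nn_integral_prod) auto
  also have "\<dots> \<le> (\<Prod>i\<in>{1..<n}. ennreal (exp (- (t * b) * gauss_abs_mean + (t * b)\<^sup>2 / 2)))"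
    unfolding prod_constant using t b by (intro power_mono_ennreal gauss1_exp_neg_abs) auto
  also have "\<dots> = ennreal (exp ((real n - 1) * (- (t * b) * gauss_abs_mean + (t * b)\<^sup>2 / 2)))"
    using n by (simp add: ennreal_power of_nat_diff flip: exp_of_nat_mult)
  also have "ennreal (c * exp (t\<^sup>2 / 2 + t * k)) * ennreal (exp ((real n - 1) * (- (t * b) * gauss_abs_mean + (t * b)\<^sup>2 / 2))) =
      ennreal (c * exp (t\<^sup>2 / 2 + t * k + (real n - 1) * (- (t * b) * gauss_abs_mean + (t * b)\<^sup>2 / 2)))"
    using c0 by (simp add: exp_add ennreal_mult'[symmetric] mult_ac)
  finally show ?thesis unfolding S_def c_def by (simp add: mult_left_mono)
qed

section \<open>The lower bound\<close>

lemma cone_moment_upper: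
  assumes n: "n \<ge> 1" and L: "L > 0" and b: "b \<ge> 0" and t: "t > 0" and p: "p \<ge> 1"
  shows "proj_moment n (cube_cone n L b) p
    \<le> ennreal ((2 * (b * L * sqrt n)) powr p +
        (2 * p / t) powr p / t * exp (t\<^sup>2 / 2 + t * (b\<^sup>2 * n * L) + (real n - 1) * (- (t * b) * gauss_abs_mean + (t * b)\<^sup>2 / 2)))"
proof -
  interpret prob_space "std_gaussian n" by (rule prob_space_std_gaussian)
  define a where "a = b * L * sqrt n"
  have a0: "a \<ge> 0" using b L by (simp add: a_def)
  define z where "z x = max 0 (x 0 - b * (\<Sum>i\<in>{1..<n}. \<bar>x i\<bar>) + b\<^sup>2 * n * L)" for x :: "nat \<Rightarrow> real"
  have z0: "z x \<ge> 0" for x by (simp add: z_def)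
  have [measurable]: "z \<in> borel_measurable (std_gaussian n)"
    using n unfolding z_def std_gaussian_def by (auto simp del: One_nat_def)
  define E where "E = exp (t\<^sup>2 / 2 + t * (b\<^sup>2 * n * L) + (real n - 1) * (- (t * b) * gauss_abs_mean + (t * b)\<^sup>2 / 2))"
  have zm: "(\<integral>\<^sup>+ x. ennreal (z x powr p) \<partial>std_gaussian n) \<le> ennreal ((p / t) powr p / t * E)"
    unfolding z_def E_def using p by (intro cone_excess_moment n t b) auto
  have "proj_moment n (cube_cone n L b) p
     \<le> (\<integral>\<^sup>+ x. ennreal ((2 * a) powr p) + ennreal (2 powr p) * ennreal (z x powr p) \<partial>std_gaussian n)"
  proof (intro nn_integral_mono)
    fix x
    have "vec_norm n (metric_proj n (cube_cone n L b) x) \<le> a + z x"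
      unfolding a_def z_def by (rule metric_proj_cube_cone_upper[OF n L b])
    then have "vec_norm n (metric_proj n (cube_cone n L b) x) powr p \<le> (2 * max a (z x)) powr p"
      using p by (intro powr_mono2) auto
    also have "\<dots> \<le> (2 * a) powr p + 2 powr p * z x powr p"
      using a0 z0[of x] by (cases "a \<le> z x") (auto simp: max_def powr_mult)
    finally show "ennreal (vec_norm n (metric_proj n (cube_cone n L b) x) powr p) \<le> ennreal ((2 * a) powr p) + ennreal (2 powr p) * ennreal (z x powr p)"
      by (simp flip: ennreal_plus ennreal_mult')
  qed
  also have "\<dots> = ennreal ((2 * a) powr p) + ennreal (2 powr p) * (\<integral>\<^sup>+ x. ennreal (z x powr p) \<partial>std_gaussian n)"
    using emeasure_space_1 by (subst nn_integral_add) (auto simp: nn_integral_cmult)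
  also have "\<dots> \<le> ennreal ((2 * a) powr p) + ennreal (2 powr p) * ennreal ((p / t) powr p / t * E)"
    by (intro add_left_mono mult_left_mono zm) auto
  also have "\<dots> = ennreal ((2 * a) powr p + 2 powr p * ((p / t) powr p / t * E))"
    using t by (simp add: E_def flip: ennreal_plus ennreal_mult')
  also have "2 powr p * ((p / t) powr p / t * E) = (2 * p / t) powr p / t * E"
    using p t by (simp add: powr_mult powr_divide)
  finally show ?thesis by (simp add: a_def E_def)
qed

lemma cone_moment_lower:
  assumes n: "n \<ge> 1" and L: "L > 0" and b: "b \<ge> 0" and d: "d > 0" and q: "q > 0"
    and u: "L + b * (gauss_abs_mean * n + 37 * sqrt n) \<le> u"
  shows "ennreal (L powr q * (d / 6 * exp (- (u + d)\<^sup>2 / 2)))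
    \<le> proj_moment n (cube_cone n L b) q"
proof -
  let ?A = "{x \<in> vec_space n. u \<le> x 0 \<and> (\<Sum>i\<in>{1..<n}. \<bar>x i\<bar>) \<le> gauss_abs_mean * n + 37 * sqrt n}"
  have "(\<lambda>x. x 0) \<in> borel_measurable (std_gaussian n)" "(\<lambda>x. \<Sum>i\<in>{1..<n}. \<bar>x i :: real\<bar>) \<in> borel_measurable (std_gaussian n)"
    using n unfolding std_gaussian_def by (auto simp del: One_nat_def)
  note [measurable] = this
  have As: "?A \<in> sets (std_gaussian n)"
    unfolding space_std_gaussian[symmetric] by measurable
  have u0: "u \<ge> 0"
  proof -
    have "0 \<le> b * (gauss_abs_mean * n + 37 * sqrt n)"
      using b by (intro mult_nonneg_nonneg add_nonneg_nonneg) auto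
    then show ?thesis using u L by linarith
  qed
  have "ennreal (L powr q * (d / 6 * exp (- (u + d)\<^sup>2 / 2))) = ennreal (L powr q) * (ennreal (1 / 2) * ennreal (d / 3 * exp (- (u + d)\<^sup>2 / 2)))"
  proof -
    have eq: "ennreal (1 / 2) * ennreal (d / 3 * exp (- (u + d)\<^sup>2 / 2)) = ennreal (d / 6 * exp (- (u + d)\<^sup>2 / 2))"
      using d by (subst ennreal_mult[symmetric]) auto
    show ?thesis unfolding eq using d by (intro ennreal_mult) auto
  qed
  also have "\<dots> \<le> ennreal (L powr q) * (ennreal (1 / 2) * emeasure gauss1 {u..})"
    by (intro mult_left_mono gauss1_upper_tail u0 d) auto
  also have "\<dots> \<le> ennreal (L powr q) * emeasure (std_gaussian n) ?A"
    by (intro mult_left_mono cone_event_prob n) auto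
  also have "\<dots> = (\<integral>\<^sup>+ x. ennreal (L powr q) * indicator ?A x \<partial>std_gaussian n)"
    by (rule nn_integral_cmult_indicator[symmetric, OF As])
  also have "\<dots> \<le> proj_moment n (cube_cone n L b) q"
  proof (intro nn_integral_mono)
    fix x
    have "L powr q \<le> vec_norm n (metric_proj n (cube_cone n L b) x) powr q" if "x \<in> ?A"
    proof (intro powr_mono2)
      have "b * (\<Sum>i\<in>{1..<n}. \<bar>x i\<bar>) \<le> b * (gauss_abs_mean * n + 37 * sqrt n)"
        using that b by (intro mult_left_mono) auto
      then show "L \<le> vec_norm n (metric_proj n (cube_cone n L b) x)"
        using that u by (intro metric_proj_cube_cone_lower[OF n L b]) auto
    qed (use L q in auto)
    then show "ennreal (L powr q) * indicator ?A x \<le> ennreal (vec_norm n (metric_proj n (cube_cone n L b) x) powr q)"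
      by (cases "x \<in> ?A") (auto intro!: ennreal_leI)
  qed
  finally show ?thesis .
qed

text \<open>A positive finite p-th moment makes the denominator a positive real number, so that the
  quotient in \<open>ennreal\<close> is the usual one.\<close>

lemma A_star_ge:
  assumes C: "C \<in> closed_convex_sets n" "C \<noteq> {vec_zero n}" and p: "p > 0" and q: "q > 0" and U: "U > 0" and V: "V > 0"
    and pos: "proj_moment n C p > 0"
    and up: "proj_moment n C p \<le> ennreal (U powr p)"
    and lo: "ennreal (V powr q) \<le> proj_moment n C q"
  shows "ennreal (V / U) \<le> A_star n p q (std_gaussian n)"
proof -
  define Ip where "Ip = proj_moment n C p"
  define Iq where "Iq = proj_moment n C q"
  have Ipt: "Ip < \<infinity>" using le_less_trans[OF up] by (simp add: Ip_def)
  have Np: "Lp_norm n (std_gaussian n) p (metric_proj n C) = ennreal (enn2real Ip powr (1 / p))"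
    using Ipt unfolding Lp_norm_def Let_def Ip_def[symmetric] by auto
  have Ip0: "enn2real Ip > 0" using pos Ipt by (simp add: enn2real_positive_iff Ip_def)
  have NpU: "enn2real Ip powr (1 / p) \<le> U"
  proof -
    have "enn2real Ip \<le> U powr p" using up by (intro enn2real_leI) (auto simp: Ip_def)
    then have "enn2real Ip powr (1 / p) \<le> (U powr p) powr (1 / p)" using p by (intro powr_mono2) auto
    then show ?thesis using p U by (simp add: powr_powr)
  qed
  have Nq: "ennreal V \<le> Lp_norm n (std_gaussian n) q (metric_proj n C)"
  proof (cases "Iq = \<infinity>")
    case True
    then show ?thesis unfolding Lp_norm_def Let_def Iq_def[symmetric] by simp
  next
    case False
    then have "V powr q \<le> enn2real Iq" using lo unfolding Iq_def[symmetric]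
      by (metis enn2real_ennreal enn2real_mono infinity_ennreal_def less_top powr_ge_zero)
    then have "(V powr q) powr (1 / q) \<le> enn2real Iq powr (1 / q)" using q by (intro powr_mono2) auto
    then have "V \<le> enn2real Iq powr (1 / q)" using q V by (simp add: powr_powr)
    then show ?thesis using False unfolding Lp_norm_def Let_def Iq_def[symmetric] by (simp add: ennreal_leI)
  qed
  have "ennreal (V / U) \<le> ennreal (V / enn2real Ip powr (1 / p))"
    using NpU Ip0 V U by (intro ennreal_leI divide_left_mono) auto
  also have "\<dots> = ennreal V / Lp_norm n (std_gaussian n) p (metric_proj n C)"
    unfolding Np using V Ip0 by (simp add: divide_ennreal)
  also have "\<dots> \<le> Lp_norm n (std_gaussian n) q (metric_proj n C) / Lp_norm n (std_gaussian n) p (metric_proj n C)"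
    by (rule divide_right_mono_ennreal[OF Nq])
  also have "\<dots> \<le> A_star n p q (std_gaussian n)"
    unfolding A_star_def using C Ip0 by (intro SUP_upper) (auto simp: Np)
  finally show ?thesis .
qed

lemma powr_ge_self: "0 \<le> x \<Longrightarrow> x \<le> 1 \<Longrightarrow> 1 \<le> q \<Longrightarrow> x powr q \<le> x" for x q :: real
  using powr_mono'[of 1 q x] by simp

lemma A_star_ge_cone:
  assumes n: "n \<ge> 1" and L: "L > 0" and b: "b \<ge> 0" and p: "p \<ge> 1" "p < q" and U: "U > 0" and V: "V > 0"
    and u: "L + b * (gauss_abs_mean * n + 37 * sqrt n) \<le> u" and d: "d > 0"
    and up: "proj_moment n (cube_cone n L b) p \<le> ennreal (U powr p)"
    and lo: "V powr q \<le> L powr q * (d / 6 * exp (- (u + d)\<^sup>2 / 2))"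
  shows "ennreal (V / U) \<le> A_star n p q (std_gaussian n)"
proof (rule A_star_ge[OF cube_cone_closed_convex[OF n L b] cube_cone_nontrivial[OF n L] _ _ U V _ up])
  have "0 < ennreal (L powr p * (d / 6 * exp (- (u + d)\<^sup>2 / 2)))" using L d by simp
  also have "\<dots> \<le> proj_moment n (cube_cone n L b) p"
    using p by (intro cone_moment_lower[OF n L b d _ u]) auto
  finally show "proj_moment n (cube_cone n L b) p > 0" .
  show "ennreal (V powr q) \<le> proj_moment n (cube_cone n L b) q"
    using p by (intro order_trans[OF ennreal_leI[OF lo]] cone_moment_lower[OF n L b d _ u]) auto
qed (use p in auto)

text \<open>As long as \<open>n\<close> is at most a constant times \<open>q\<close>, the dimension
  drops out and the rate is O(sqrt (q / p)), which segments achieve. The threshold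
  \<open>exp 19\<close> makes \<open>l \<ge> 20\<close> in the opposite case; its root is rounded up
  to \<open>exp 10\<close>.\<close>

lemma rate_le_segment:
  assumes n: "n \<ge> 1" and p: "1 \<le> p" "p < q" and nq: "real n \<le> exp 19 * q"
  shows "rate n p q \<le> exp 10 * sqrt (q / p)"
proof (cases "real n \<le> q")
  case True
  define \<kappa> where "\<kappa> = real n / min p (real n)"
  have \<kappa>1: "\<kappa> \<ge> 1" using n p by (simp add: \<kappa>_def)
  have mm: "max p (real n) = p * \<kappa>" using n p by (auto simp: \<kappa>_def max_def min_def)
  have "rate n p q = sqrt (q / (p * \<kappa>)) * \<kappa> powr (1 / 2 * (1 - p / q))"
    unfolding rate_ge[OF n p True] mm \<kappa>_def[symmetric] using True by (simp add: max_absorb1)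
  also have "\<dots> \<le> sqrt (q / (p * \<kappa>)) * \<kappa> powr (1 / 2)"
    using \<kappa>1 p by (intro mult_left_mono powr_mono) auto
  also have "\<dots> = 1 * sqrt (q / p)" using \<kappa>1 p by (simp add: powr_half_sqrt real_sqrt_divide real_sqrt_mult)
  also have "\<dots> \<le> exp 10 * sqrt (q / p)" using p by (intro mult_right_mono) auto
  finally show ?thesis .
next
  case False
  then have nq': "q < n" by simp
  define l where "l = 1 + ln (real n / q)"
  have l1: "l \<ge> 1" using p nq' by (simp add: l_def)
  define W where "W = real n / (p * l)"
  have ql: "q * l \<le> n"
    using ln_le_minus_one[of "real n / q"] p nq' by (simp add: l_def field_simps)
  have pl: "p * l \<le> q * l" using p l1 by (intro mult_right_mono) auto
  have W1: "W \<ge> 1" using p l1 order_trans[OF pl ql] by (simp add: W_def)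
  have "rate n p q = W powr (1 / 2 * (1 - p / q))"
    unfolding rate_less[OF n p nq'] W_def l_def ..
  also have "\<dots> \<le> W powr (1 / 2)" using W1 p by (intro powr_mono) auto
  also have "\<dots> = sqrt W" using W1 by (simp add: powr_half_sqrt)
  also have "\<dots> \<le> sqrt ((exp 10)\<^sup>2 * (q / p))"
  proof (intro real_sqrt_le_mono)
    have "W \<le> real n / (p * 1)" unfolding W_def using p l1 by (intro divide_left_mono mult_left_mono) auto
    also have "\<dots> \<le> (exp 19 * q) / p" using nq p by (simp add: divide_right_mono)
    also have "\<dots> \<le> ((exp 10)\<^sup>2 * q) / p"
      using p by (intro divide_right_mono mult_right_mono) (auto simp flip: exp_of_nat_mult)
    finally show "W \<le> (exp 10)\<^sup>2 * (q / p)" by simp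
  qed
  also have "\<dots> = exp 10 * sqrt (q / p)" by (simp only: real_sqrt_mult real_sqrt_abs abs_exp_cancel)
  finally show ?thesis .
qed

text \<open>A segment of length \<open>sqrt q\<close> is filled with probability
  \<open>exp (- O(q))\<close>, so its L^q norm is of order \<open>sqrt q\<close>, while tilting by
  \<open>t = sqrt p\<close> bounds the L^p norm by a multiple of \<open>sqrt p\<close>.\<close>

lemma A_star_ge_segment:
  assumes n: "n \<ge> 1" and p: "1 \<le> p" "p < q"
  shows "ennreal (exp (- 2) / 24 * sqrt (q / p)) \<le> A_star n p q (std_gaussian n)"
proof -
  have "ennreal ((sqrt q * (exp (- 2) / 6)) / (4 * sqrt p)) \<le> A_star n p q (std_gaussian n)"
  proof (rule A_star_ge_cone[OF n _ _ p, where L="sqrt q" and b=0 and u="sqrt q" and d=1])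
    have "proj_moment n (cube_cone n (sqrt q) 0) p
       \<le> ennreal ((2 * (0 * sqrt q * sqrt n)) powr p + (2 * p / sqrt p) powr p / sqrt p *
          exp ((sqrt p)\<^sup>2 / 2 + sqrt p * ((0::real)\<^sup>2 * real n * sqrt q) + (real n - 1) * (- (sqrt p * 0) * gauss_abs_mean + (sqrt p * 0)\<^sup>2 / 2)))"
      using p by (intro cone_moment_upper n) auto
    also have "\<dots> = ennreal ((2 * p / sqrt p) powr p / sqrt p * exp (p / 2))" using p by simp
    also have "\<dots> \<le> ennreal ((4 * sqrt p) powr p)"
    proof (intro ennreal_leI)
      have "(2 * p / sqrt p) powr p / sqrt p * exp (p / 2) \<le> (2 * p / sqrt p) powr p / 1 * exp (p / 2)"
        using p by (intro mult_right_mono divide_left_mono) auto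
      also have "\<dots> = (2 * sqrt p * exp (1 / 2)) powr p"
      proof -
        have "p / sqrt p = sqrt p" using p by (intro real_div_sqrt) simp
        then have "2 * p / sqrt p = 2 * sqrt p" by (metis times_divide_eq_right)
        then show ?thesis using p by (simp add: powr_mult exp_powr_real)
      qed
      also have "\<dots> \<le> (4 * sqrt p) powr p"
        using p exp_half_le_2 by (intro powr_mono2) auto
      finally show "(2 * p / sqrt p) powr p / sqrt p * exp (p / 2) \<le> (4 * sqrt p) powr p" .
    qed
    finally show "proj_moment n (cube_cone n (sqrt q) 0) p \<le> ennreal ((4 * sqrt p) powr p)" .
    have "(sqrt q * (exp (- 2) / 6)) powr q = sqrt q powr q * ((1 / 6) powr q * exp (- 2 * q))"
      using p by (simp add: powr_mult powr_divide exp_powr_real)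
    also have "\<dots> \<le> sqrt q powr q * (1 / 6 * exp (- (sqrt q + 1)\<^sup>2 / 2))"
    proof (intro mult_left_mono mult_mono powr_ge_self)
      have "(sqrt q + 1)\<^sup>2 \<le> (2 * sqrt q)\<^sup>2" using p by (intro power_mono) auto
      then show "exp (- 2 * q) \<le> exp (- (sqrt q + 1)\<^sup>2 / 2)" using p by (simp add: power_mult_distrib)
    qed (use p in auto)
    finally show "(sqrt q * (exp (- 2) / 6)) powr q \<le> sqrt q powr q * (1 / 6 * exp (- (sqrt q + 1)\<^sup>2 / 2))" .
  qed (use p in auto)
  also have "(sqrt q * (exp (- 2) / 6)) / (4 * sqrt p) = exp (- 2) / 24 * sqrt (q / p)"
    by (simp add: real_sqrt_divide)
  finally show ?thesis .
qed

text \<open>With this opening the mean push over the other coordinates contributes about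
  \<open>- t\<^sup>2\<close> to the exponent, which turns \<open>t\<^sup>2 / 2\<close> into
  \<open>- t\<^sup>2 / 2\<close>, as for a deterministic threshold \<open>t\<close>. The hypotheses
  bound the errors: \<open>t2\<close> the replacement of \<open>n - 1\<close> by \<open>n\<close>
  (cost \<open>p\<close>), \<open>t4\<close> the quadratic term (cost \<open>2 * p\<close>),
  \<open>tL\<close> the finite height (cost \<open>4 * p\<close>). The total \<open>7 * p\<close>
  becomes \<open>exp 7\<close> in the base.\<close>

lemma calibrated_cone_upper:
  assumes n: "n \<ge> 1" and L: "L > 0" and t: "t > 0" and p: "p \<ge> 1"
    and t2: "t\<^sup>2 \<le> n * p" and t4: "(t\<^sup>2)\<^sup>2 \<le> n * p" and tL: "t\<^sup>2 * (t * L) \<le> n * p"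
  shows "(\<integral>\<^sup>+ x. ennreal (vec_norm n (metric_proj n (cube_cone n L (t / (gauss_abs_mean * n))) x) powr p) \<partial>std_gaussian n)
    \<le> ennreal ((4 * (t * L) / sqrt n) powr p + (2 * exp 7 * p / t) powr p / t * exp (- t\<^sup>2 / 2))"
proof -
  define c where "c = gauss_abs_mean"
  have c: "1 / 2 \<le> c" "c \<le> 1" using gauss_abs_mean_bounds by (auto simp: c_def)
  then have c0: "c > 0" by simp
  have ic: "1 / c \<le> 2" using c by (simp add: field_simps)
  have ic2: "1 / c\<^sup>2 \<le> 4" using power_mono[OF ic, of 2] c by (simp add: power_divide)
  define b where "b = t / (c * n)"
  have b: "b > 0" using t c n by (simp add: b_def)
  have n0: "real n > 0" using n by simp
  have A: "2 * (b * L * sqrt n) \<le> 4 * (t * L) / sqrt n"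
  proof -
    have "b * L * sqrt n = (1 / c) * ((t * L) / sqrt n)"
      using n0 c0 by (simp add: b_def field_simps)
    also have "\<dots> \<le> 2 * ((t * L) / sqrt n)" using ic t L by (intro mult_right_mono) auto
    finally show ?thesis by simp
  qed
  have e1: "t * (b\<^sup>2 * n * L) \<le> 4 * p"
  proof -
    have "t * (b\<^sup>2 * n * L) = (1 / c\<^sup>2) * (t\<^sup>2 * (t * L) / n)"
      using n0 c0 by (simp add: b_def power2_eq_square field_simps)
    also have "\<dots> \<le> 4 * p"
    proof (rule mult_mono[OF ic2])
      show "t\<^sup>2 * (t * L) / n \<le> p" using tL n0 by (simp add: field_simps)
    qed (use t L in auto)
    finally show ?thesis .
  qed
  have e2: "(real n - 1) * (- (t * b) * c + (t * b)\<^sup>2 / 2) \<le> - t\<^sup>2 + 3 * p"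
  proof -
    have "(real n - 1) * (- (t * b) * c) = - t\<^sup>2 + t\<^sup>2 / n"
      using n0 c0 by (simp add: b_def power2_eq_square field_simps)
    also have "t\<^sup>2 / n \<le> p" using t2 n0 by (simp add: field_simps)
    finally have 1: "(real n - 1) * (- (t * b) * c) \<le> - t\<^sup>2 + p" by simp
    have "(real n - 1) * ((t * b)\<^sup>2 / 2) \<le> n * ((t * b)\<^sup>2 / 2)" by (intro mult_right_mono) auto
    also have "\<dots> = (1 / c\<^sup>2) * ((t\<^sup>2)\<^sup>2 / n) / 2"
      using n0 c0 by (simp add: b_def power2_eq_square field_simps)
    also have "\<dots> \<le> 4 * p / 2"
    proof (intro divide_right_mono mult_mono[OF ic2])
      show "(t\<^sup>2)\<^sup>2 / n \<le> p" using t4 n0 by (simp add: field_simps)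
    qed auto
    finally have "(real n - 1) * ((t * b)\<^sup>2 / 2) \<le> 2 * p" by simp
    with 1 show ?thesis by (simp only: distrib_left)
  qed
  have "proj_moment n (cube_cone n L b) p
    \<le> ennreal ((2 * (b * L * sqrt n)) powr p +
        (2 * p / t) powr p / t * exp (t\<^sup>2 / 2 + t * (b\<^sup>2 * n * L) + (real n - 1) * (- (t * b) * c + (t * b)\<^sup>2 / 2)))"
    unfolding c_def using b by (intro cone_moment_upper n L t p) auto
  also have "\<dots> \<le> ennreal ((4 * (t * L) / sqrt n) powr p + (2 * p / t) powr p / t * exp (7 * p + - t\<^sup>2 / 2))"
    using A e1 e2 b L t p by (intro ennreal_leI add_mono powr_mono2 mult_left_mono) auto
  also have "(2 * p / t) powr p / t * exp (7 * p + - t\<^sup>2 / 2) = (2 * exp 7 * p / t) powr p / t * exp (- t\<^sup>2 / 2)"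
    unfolding exp_add using p t by (simp add: powr_mult powr_divide exp_powr_real mult_ac)
  finally show ?thesis by (simp add: b_def c_def)
qed

text \<open>Fluctuations of order \<open>sqrt n\<close> in the sum of moduli raise the threshold
  \<open>t\<close> only by a multiple of \<open>t / sqrt n\<close>; 74 is 37 times the bound 2 on
  the reciprocal of \<open>gauss_abs_mean\<close>.\<close>

lemma calibrated_cone_threshold:
  fixes n :: nat
  assumes n: "n \<ge> 1" and t: "t > 0"
  shows "t / (gauss_abs_mean * n) * (gauss_abs_mean * n + 37 * sqrt n) \<le> t + 74 * (t / sqrt n)"
proof -
  define c where "c = gauss_abs_mean"
  have c: "1 / 2 \<le> c" using gauss_abs_mean_bounds by (auto simp: c_def)
  have ic: "1 / c \<le> 2" using c by (simp add: field_simps)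
  have "t / (c * n) * (c * n + 37 * sqrt n) = t + 37 * (1 / c) * (t / sqrt n)"
    using n c by (simp add: field_simps)
  also have "\<dots> \<le> t + 37 * 2 * (t / sqrt n)"
    using ic t by (intro add_left_mono mult_right_mono) auto
  finally show ?thesis by (simp add: c_def)
qed

text \<open>The tangent of \<open>ln\<close> at 16 suffices. As \<open>n = q * exp (l - 1)\<close>,
  the second claim means \<open>l ^ 4 * q \<le> n\<close>: powers of the logarithm are negligible
  against \<open>n / q\<close>.\<close>

lemma log_fourth_power_le:
  fixes l :: real
  assumes "l \<ge> 20"
  shows "4 * ln l \<le> l - 1" "l ^ 4 \<le> exp (l - 1)"
proof -
  have "ln (l / 16) \<le> l / 16 - 1" using assms by (intro ln_le_minus_one) auto
  moreover have "ln (l / 16) = ln l - 4 * ln 2"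
    using assms ln_realpow[of 2 4] by (simp add: ln_div)
  moreover have "ln 2 \<le> (1::real)" using ln_2_less_1 by simp
  ultimately show 1: "4 * ln l \<le> l - 1" using assms by linarith
  have "l ^ 4 = exp (4 * ln l)" using assms by (simp add: exp_of_nat_mult[of 4, simplified])
  also have "\<dots> \<le> exp (l - 1)" using 1 by simp
  finally show "l ^ 4 \<le> exp (l - 1)" .
qed

section \<open>Cones when \<open>n\<close> exceeds \<open>exp 19 * q\<close>\<close>

context
  fixes n :: nat and p q l W :: real
  assumes n: "n \<ge> 1" and p: "1 \<le> p" "p < q" and nq: "exp 19 * q < real n"
    and l_def: "l = 1 + ln (real n / q)" and W_def: "W = real n / (p * l)"
begin

lemma cone_parameters:
  shows "q < n" "l \<ge> 20" "real n = q * exp (l - 1)" "l ^ 4 * q \<le> n" "l * q \<le> n" "l\<^sup>2 * q \<le> n" "l\<^sup>2 * q * 4 \<le> n" "l \<le> sqrt n"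
    "W \<ge> 1" "sqrt W = sqrt n / sqrt (p * l)"
proof -
  show qn: "q < n"
  proof -
    have "1 * q \<le> exp 19 * q" using p by (intro mult_right_mono) auto
    then show ?thesis using nq by simp
  qed
  have "exp 19 \<le> real n / q" using nq p by (simp add: field_simps)
  then have "19 \<le> ln (real n / q)" using p qn by (subst ln_ge_iff) auto
  then show l: "l \<ge> 20" by (simp add: l_def)
  show nl: "real n = q * exp (l - 1)" using p qn by (simp add: l_def)
  show l4: "l ^ 4 * q \<le> n" unfolding nl using log_fourth_power_le(2)[OF l] p by (simp add: mult.commute)
  have "l * 1 \<le> l * l ^ 3" using l by (intro mult_left_mono) auto
  then have "l \<le> l ^ 4" by (simp add: power_eq_if)
  then have "l * q \<le> l ^ 4 * q" using p by (intro mult_right_mono) auto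
  then show lq: "l * q \<le> n" using l4 by simp
  have l2: "4 \<le> l\<^sup>2" using power_mono[of 2 l 2] l by simp
  then have "l\<^sup>2 * 4 \<le> l\<^sup>2 * l\<^sup>2" by (intro mult_left_mono) auto
  then have "l\<^sup>2 * 4 \<le> l ^ 4" by (simp flip: power_add)
  then have "l\<^sup>2 * 4 * q \<le> l ^ 4 * q" using p by (intro mult_right_mono) auto
  then show l24: "l\<^sup>2 * q * 4 \<le> n" using l4 by simp
  have l2q: "0 \<le> l\<^sup>2 * q" using p by simp
  then show l2q': "l\<^sup>2 * q \<le> n" using l24 by simp
  have "l\<^sup>2 * 1 \<le> l\<^sup>2 * q" using p by (intro mult_left_mono) auto
  then show "l \<le> sqrt n" using l2q' by (intro real_le_rsqrt) simp
  have "p * l \<le> q * l" using p l by (intro mult_right_mono) auto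
  also have "\<dots> \<le> n" using lq by (simp add: mult.commute)
  finally show "W \<ge> 1" using p l by (simp add: W_def)
  show "sqrt W = sqrt n / sqrt (p * l)" by (simp add: W_def real_sqrt_divide)
qed

lemma rate_eq_W: "rate n p q = W powr (1 / 2 * (1 - p / q))"
  unfolding rate_less[OF n p cone_parameters(1)] W_def l_def ..

text \<open>For the threshold \<open>t = sqrt (p * l)\<close> the excess contributes a factor
  \<open>exp (- l / 2)\<close> to the L^p norm, at most \<open>sqrt (q / n)\<close>, so the base
  term \<open>X\<close> dominates. As \<open>t \<le> sqrt q\<close>, the height
  \<open>sqrt q\<close> costs only a constant in L^q. The ratio is of order \<open>sqrt W\<close>,
  which is at least the rate.\<close>

lemma A_star_ge_cone_wide:
  assumes plq: "p * l \<le> q"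
  shows "ennreal (exp (- 2972) / 24 * rate n p q) \<le> A_star n p q (std_gaussian n)"
proof -
  note par = cone_parameters
  define t where "t = sqrt (p * l)"
  have t2: "t\<^sup>2 = p * l" using p par(2) by (simp add: t_def)
  have pp: "p * 1 \<le> p * l" using p par(2) by (intro mult_left_mono) auto
  have "p * l \<ge> 1" using pp p(1) by linarith
  then have t1: "t \<ge> 1" unfolding t_def by simp
  have tq: "t \<le> sqrt q" unfolding t_def using plq by simp
  define X where "X = t * sqrt q / sqrt n"
  have X: "X > 0" using t1 p n by (simp add: X_def)
  have E7: "exp 7 \<ge> (8::real)" using exp_ge_add_one_self[of 7] by simp
  have "ennreal ((sqrt q * (exp (- 2965) / 6)) / (4 * exp 7 * X)) \<le> A_star n p q (std_gaussian n)"
  \<comment> \<open>\<open>u\<close> collects 1 for the height, 1 for \<open>t\<close> and 74 for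
    the fluctuations, in units of \<open>sqrt q\<close>. Adding \<open>d = 1 \<le> sqrt q\<close>
    gives 77, and half of its square is below 2965.\<close>
  proof (rule A_star_ge_cone[OF n _ _ p, where L="sqrt q" and b="t / (gauss_abs_mean * n)" and u="76 * sqrt q" and d=1])
    have "(\<integral>\<^sup>+ x. ennreal (vec_norm n (metric_proj n (cube_cone n (sqrt q) (t / (gauss_abs_mean * n))) x) powr p) \<partial>std_gaussian n)
       \<le> ennreal ((4 * (t * sqrt q) / sqrt n) powr p + (2 * exp 7 * p / t) powr p / t * exp (- t\<^sup>2 / 2))"
    proof (intro calibrated_cone_upper n)
      have "l * 1 \<le> l * q" using p par(2) by (intro mult_left_mono) auto
      then have "p * l \<le> p * n" using p par(5) by (intro mult_left_mono) auto
      then show "t\<^sup>2 \<le> n * p" by (simp add: t2 mult.commute)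
      have "p * l\<^sup>2 \<le> q * l\<^sup>2" using p by (intro mult_right_mono) auto
      then have "p * (p * l\<^sup>2) \<le> p * n" using par(6) p by (intro mult_left_mono) (auto simp: mult.commute)
      then show "(t\<^sup>2)\<^sup>2 \<le> n * p" unfolding t2 by (simp add: power2_eq_square mult_ac)
      have "t * sqrt q \<le> sqrt q * sqrt q" using tq p by (intro mult_right_mono) auto
      then have "t * sqrt q \<le> q" using p by simp
      then have "t\<^sup>2 * (t * sqrt q) \<le> t\<^sup>2 * q" by (intro mult_left_mono) auto
      also have "\<dots> = p * (l * q)" by (simp add: t2)
      also have "\<dots> \<le> p * n" using par(5) p by (intro mult_left_mono) auto
      finally show "t\<^sup>2 * (t * sqrt q) \<le> n * p" by (simp add: mult.commute)
    qed (use t1 p in auto)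
    also have "\<dots> \<le> ennreal ((2 * exp 7 * X) powr p + (2 * exp 7 * X) powr p)"
    proof (intro ennreal_leI add_mono)
      have "4 * X \<le> 2 * exp 7 * X" using E7 X by (intro mult_right_mono) auto
      then show "(4 * (t * sqrt q) / sqrt n) powr p \<le> (2 * exp 7 * X) powr p"
        using p X by (intro powr_mono2) (auto simp: X_def)
      have "(2 * exp 7 * p / t) powr p / t * exp (- t\<^sup>2 / 2) \<le> (2 * exp 7 * p / t) powr p / 1 * exp (- t\<^sup>2 / 2)"
        using t1 by (intro mult_right_mono divide_left_mono) auto
      also have "\<dots> = (2 * exp 7 * (p / t * exp (- l / 2))) powr p"
        using p t1 by (simp add: t2 powr_mult powr_divide exp_powr_real mult_ac)
      also have "\<dots> \<le> (2 * exp 7 * X) powr p"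
      proof (intro powr_mono2 mult_left_mono)
        have "p \<le> t * t" using pp t2 by (simp add: power2_eq_square)
        then have "p / t \<le> t" using t1 by (simp add: field_simps)
        moreover have "exp (- l / 2) \<le> sqrt q / sqrt n"
        proof -
          have "sqrt n = sqrt q * sqrt (exp (l - 1))" by (subst par(3)) (simp add: real_sqrt_mult)
          also have "sqrt (exp (l - 1)) = exp ((l - 1) / 2)"
            by (intro real_sqrt_unique) (simp_all flip: exp_of_nat_mult)
          also have "\<dots> \<le> exp (l / 2)" by simp
          finally have "sqrt n \<le> sqrt q * exp (l / 2)" using p by simp
          then show ?thesis using n by (simp add: exp_minus field_simps)
        qed
        ultimately have "p / t * exp (- l / 2) \<le> t * (sqrt q / sqrt n)" using t1 by (intro mult_mono) auto
        then show "p / t * exp (- l / 2) \<le> X" by (simp add: X_def)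
      qed (use p t1 in auto)
      finally show "(2 * exp 7 * p / t) powr p / t * exp (- t\<^sup>2 / 2) \<le> (2 * exp 7 * X) powr p" .
    qed
    also have "\<dots> \<le> ennreal ((4 * exp 7 * X) powr p)"
    proof (intro ennreal_leI)
      have "2 * (2 * exp 7 * X) powr p \<le> 2 powr p * (2 * exp 7 * X) powr p"
        using p powr_mono[of 1 p 2] by (intro mult_right_mono) auto
      also have "\<dots> = (4 * exp 7 * X) powr p" using X by (simp add: powr_mult[symmetric] mult.assoc)
      finally show "(2 * exp 7 * X) powr p + (2 * exp 7 * X) powr p \<le> (4 * exp 7 * X) powr p" by simp
    qed
    finally show "(\<integral>\<^sup>+ x. ennreal (vec_norm n (metric_proj n (cube_cone n (sqrt q) (t / (gauss_abs_mean * n))) x) powr p) \<partial>std_gaussian n)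
       \<le> ennreal ((4 * exp 7 * X) powr p)" .
    have "t / sqrt n \<le> t / 1" using n t1 by (intro divide_left_mono) auto
    then show "sqrt q + t / (gauss_abs_mean * n) * (gauss_abs_mean * n + 37 * sqrt n) \<le> 76 * sqrt q"
      using order_trans[OF calibrated_cone_threshold[OF n, of t], of "75 * sqrt q"] t1 tq by simp
    have "(sqrt q * (exp (- 2965) / 6)) powr q = sqrt q powr q * ((1 / 6) powr q * exp (- 2965 * q))"
      using p by (simp add: powr_mult powr_divide exp_powr_real)
    also have "\<dots> \<le> sqrt q powr q * (1 / 6 * exp (- (76 * sqrt q + 1)\<^sup>2 / 2))"
    proof (intro mult_left_mono mult_mono powr_ge_self)
      have "(76 * sqrt q + 1)\<^sup>2 \<le> (77 * sqrt q)\<^sup>2" using p by (intro power_mono) auto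
      then show "exp (- 2965 * q) \<le> exp (- (76 * sqrt q + 1)\<^sup>2 / 2)" using p by (simp add: power_mult_distrib)
    qed (use p in auto)
    finally show "(sqrt q * (exp (- 2965) / 6)) powr q \<le> sqrt q powr q * (1 / 6 * exp (- (76 * sqrt q + 1)\<^sup>2 / 2))" .
  qed (use p t1 X gauss_abs_mean_bounds in auto)
  also have "(sqrt q * (exp (- 2965) / 6)) / (4 * exp 7 * X) = exp (- 2972) / 24 * sqrt W"
  proof -
    have "(sqrt q * (a / 6)) / (4 * b * X) = a / b / 24 * sqrt W" if "b > 0" for a b :: real
      using p n t1 that unfolding par(10) X_def t_def by (simp add: field_simps)
    from this[of "exp 7" "exp (- 2965)"] show ?thesis by (simp flip: exp_diff)
  qed
  finally have 1: "ennreal (exp (- 2972) / 24 * sqrt W) \<le> A_star n p q (std_gaussian n)" .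
  have "rate n p q \<le> W powr (1 / 2)" unfolding rate_eq_W using par(9) p by (intro powr_mono) auto
  then have "rate n p q \<le> sqrt W" using par(9) by (simp add: powr_half_sqrt)
  then have "exp (- 2972) / 24 * rate n p q \<le> exp (- 2972) / 24 * sqrt W" by (intro mult_left_mono) auto
  then show ?thesis using 1 by (meson ennreal_leI order_trans)
qed

text \<open>The height \<open>q / t\<close> is the largest, up to constants, for which raising the
  level from \<open>t\<close> to \<open>t + L\<close> costs only \<open>exp (- O(q))\<close>. The
  base term is then \<open>Y = q / sqrt n\<close>, and \<open>t\<close> is chosen so that the excess
  is of no larger order. In L^q the factor \<open>exp (- t\<^sup>2 / 2)\<close> leaves
  \<open>W powr (- p / (2 * q))\<close>, and \<open>(q / t) / Y\<close> is of order
  \<open>sqrt W\<close>; together these give the rate.\<close>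

lemma A_star_ge_cone_narrow:
  assumes plq: "q < p * l"
  shows "ennreal (exp (- 45157) / 384 * rate n p q) \<le> A_star n p q (std_gaussian n)"
proof -
  note par = cone_parameters
  have pl1: "p * l \<ge> 1" using plq p by simp
  \<comment> \<open>This makes \<open>exp (- T / 2)\<close> equal to
    \<open>W powr (- p / 2) * sqrt (p * l)\<close>. The root cancels, up to a factor 2, the
    prefactor \<open>1 / t\<close> that occurs in both the excess moment and the tail bound.\<close>
  define T where "T = p * ln W - ln (p * l)"
  have lnW: "ln W = l - 1 + ln (q / p) - ln l"
  proof -
    have "W = exp (l - 1) * (q / p) / l" using p par(2) unfolding W_def by (subst par(3)) (simp add: field_simps)
    then show ?thesis using p par(2) by (simp add: ln_mult ln_div)
  qed
  have T2: "T \<le> 2 * (p * l)"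
  proof -
    have "q / p \<le> l" using plq p by (simp add: field_simps)
    then have "ln (q / p) \<le> ln l" using p by (intro ln_mono) auto
    then have "p * ln W \<le> p * l" unfolding lnW using p by (intro mult_left_mono) auto
    moreover have "0 \<le> ln (p * l)" using pl1 by simp
    ultimately show ?thesis unfolding T_def using p par(2) mult_nonneg_nonneg[of p l] by linarith
  qed
  have T4: "T \<ge> p * l / 4"
  proof -
    have "ln (q / p) \<ge> 0" using p by simp
    then have "p * (l - 1 - ln l) \<le> p * ln W" unfolding lnW using p by (intro mult_left_mono) auto
    then have "p * l - p - p * ln l \<le> p * ln W" by (simp add: right_diff_distrib)
    moreover have "ln (p * l) = ln p + ln l" using p par(2) by (subst ln_mult) auto
    moreover have "ln p \<le> p" using p ln_le_minus_one[of p] by simp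
    moreover have "1 * ln l \<le> p * ln l" using p par(2) by (intro mult_right_mono) auto
    moreover have "4 * (p * ln l) \<le> p * l - p"
      using mult_left_mono[OF log_fourth_power_le(1)[OF par(2)], of p] p by (simp add: right_diff_distrib mult.left_commute)
    moreover have "p * 20 \<le> p * l" using p par(2) by (intro mult_left_mono) auto
    ultimately show ?thesis unfolding T_def using p(1) by linarith
  qed
  define t where "t = sqrt T"
  have Tpos: "T > 0" using T4 pl1 by simp
  have t0: "t > 0" and t2: "t\<^sup>2 = T" using Tpos by (auto simp: t_def)
  have tle: "t \<le> 2 * sqrt (p * l)"
  proof -
    have "t \<le> sqrt (4 * (p * l))" unfolding t_def using T2 pl1 by simp
    also have "\<dots> = 2 * sqrt (p * l)" by (simp add: real_sqrt_mult)
    finally show ?thesis .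
  qed
  have tge: "sqrt (p * l) \<le> 2 * t"
  proof -
    have "sqrt (p * l) \<le> sqrt (4 * T)" using T4 by simp
    also have "\<dots> = 2 * t" by (simp add: real_sqrt_mult t_def)
    finally show ?thesis .
  qed
  have eT: "exp (- T / 2) = W powr (- p / 2) * sqrt (p * l)"
  proof -
    have "- T / 2 = (- p / 2) * ln W + ln (sqrt (p * l))" using pl1 by (simp add: T_def ln_sqrt field_simps)
    then show ?thesis using pl1 par(9) by (simp only: exp_add powr_def) simp
  qed
  define Y where "Y = q / sqrt n"
  have Y: "Y > 0" using p n by (simp add: Y_def)
  have E7: "exp 7 \<ge> (8::real)" using exp_ge_add_one_self[of 7] by simp
  define V where "V = (q / t) * (exp (- 45150) / 12) * W powr (- p / (2 * q))"
  have "ennreal (V / (16 * exp 7 * Y)) \<le> A_star n p q (std_gaussian n)"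
  proof (rule A_star_ge_cone[OF n _ _ p, where L="q / t" and b="t / (gauss_abs_mean * n)" and u="q / t + (t + 74 * (t / sqrt n))" and d="1 / t"])
    have "(\<integral>\<^sup>+ x. ennreal (vec_norm n (metric_proj n (cube_cone n (q / t) (t / (gauss_abs_mean * n))) x) powr p) \<partial>std_gaussian n)
       \<le> ennreal ((4 * (t * (q / t)) / sqrt n) powr p + (2 * exp 7 * p / t) powr p / t * exp (- t\<^sup>2 / 2))"
    proof (intro calibrated_cone_upper n)
      have l2: "2 * l \<le> n"
      proof -
        have "2 * l \<le> l * l" using par(2) by simp
        also have "\<dots> \<le> l\<^sup>2 * q" using p by (simp add: power2_eq_square mult_left_mono[of 1 q "l*l", simplified])
        finally show ?thesis using par(6) by simp
      qed
      have "T \<le> p * (2 * l)" using T2 by simp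
      also have "\<dots> \<le> p * n" using l2 p by (intro mult_left_mono) auto
      finally show "t\<^sup>2 \<le> n * p" by (simp add: t2 mult.commute)
      have "(t\<^sup>2)\<^sup>2 \<le> (2 * (p * l))\<^sup>2" unfolding t2 using T2 Tpos by (intro power_mono) auto
      also have "\<dots> = p * (l\<^sup>2 * p * 4)" by (simp add: power2_eq_square)
      also have "\<dots> \<le> p * (l\<^sup>2 * q * 4)" using p by (intro mult_left_mono mult_right_mono) auto
      also have "\<dots> \<le> p * n" using par(7) p by (intro mult_left_mono) auto
      finally show "(t\<^sup>2)\<^sup>2 \<le> n * p" by (simp add: mult.commute)
      have "t\<^sup>2 * (t * (q / t)) = T * q" using t0 by (simp add: t2)
      also have "\<dots> \<le> 2 * (p * l) * q" using T2 p by (intro mult_right_mono) auto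
      also have "\<dots> = p * (2 * l * q)" by simp
      also have "\<dots> \<le> p * (l\<^sup>2 * q)"
      proof (intro mult_left_mono mult_right_mono)
        show "2 * l \<le> l\<^sup>2" using par(2) by (simp add: power2_eq_square)
      qed (use p in auto)
      also have "\<dots> \<le> p * n" using par(6) p by (intro mult_left_mono) auto
      finally show "t\<^sup>2 * (t * (q / t)) \<le> n * p" by (simp add: mult.commute)
    qed (use t0 p in auto)
    also have "\<dots> \<le> ennreal ((8 * exp 7 * Y) powr p + (8 * exp 7 * Y) powr p)"
    proof (intro ennreal_leI add_mono)
      have "4 * Y \<le> 8 * exp 7 * Y" using E7 Y by (intro mult_right_mono) auto
      then show "(4 * (t * (q / t)) / sqrt n) powr p \<le> (8 * exp 7 * Y) powr p"
        using p Y t0 by (intro powr_mono2) (auto simp: Y_def)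
      have "(2 * exp 7 * p / t) powr p / t * exp (- t\<^sup>2 / 2) = (2 * exp 7 * p / t) powr p * W powr (- p / 2) * (sqrt (p * l) / t)"
        unfolding t2 eT by simp
      also have "\<dots> \<le> (2 * exp 7 * p / t) powr p * W powr (- p / 2) * 2"
        using tge t0 by (intro mult_left_mono) (auto simp: field_simps)
      also have "\<dots> \<le> (2 * exp 7 * p / t) powr p * W powr (- p / 2) * 2 powr p"
        using p powr_mono[of 1 p 2] by (intro mult_left_mono) auto
      also have "\<dots> = (4 * exp 7 * (p / t / sqrt W)) powr p"
      proof -
        have "W powr (- p / 2) = (1 / sqrt W) powr p"
          using par(9) by (simp add: powr_half_sqrt[symmetric] powr_powr powr_minus_divide powr_divide)
        then have "(2 * exp 7 * p / t) powr p * W powr (- p / 2) * 2 powr p = ((2 * exp 7 * p / t) * (1 / sqrt W) * 2) powr p"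
          using p t0 par(9) by (simp only:) (subst powr_mult; (subst powr_mult)?; simp)
        then show ?thesis by (simp add: field_simps)
      qed
      also have "\<dots> \<le> (8 * exp 7 * Y) powr p"
      proof (intro powr_mono2)
        have "p / t / sqrt W = p * (sqrt (p * l) / t) / sqrt n" unfolding par(10) by simp
        also have "\<dots> \<le> q * 2 / sqrt n"
        proof (intro divide_right_mono mult_mono)
          show "sqrt (p * l) / t \<le> 2" using tge t0 by (simp add: pos_divide_le_eq)
          show "0 \<le> sqrt (p * l) / t" using pl1 t0 by (intro divide_nonneg_pos) auto
        qed (use p in auto)
        also have "\<dots> = 2 * Y" by (simp add: Y_def)
        finally have "p / t / sqrt W \<le> 2 * Y" .
        then have "4 * exp 7 * (p / t / sqrt W) \<le> 4 * exp 7 * (2 * Y)" by (intro mult_left_mono) auto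
        then show "4 * exp 7 * (p / t / sqrt W) \<le> 8 * exp 7 * Y" by simp
      qed (use p t0 par(9) in auto)
      finally show "(2 * exp 7 * p / t) powr p / t * exp (- t\<^sup>2 / 2) \<le> (8 * exp 7 * Y) powr p" .
    qed
    also have "\<dots> \<le> ennreal ((16 * exp 7 * Y) powr p)"
    proof (intro ennreal_leI)
      have "2 * (8 * exp 7 * Y) powr p \<le> 2 powr p * (8 * exp 7 * Y) powr p"
        using p powr_mono[of 1 p 2] by (intro mult_right_mono) auto
      also have "\<dots> = (16 * exp 7 * Y) powr p" using Y by (simp add: powr_mult[symmetric] mult.assoc)
      finally show "(8 * exp 7 * Y) powr p + (8 * exp 7 * Y) powr p \<le> (16 * exp 7 * Y) powr p" by simp
    qed
    finally show "(\<integral>\<^sup>+ x. ennreal (vec_norm n (metric_proj n (cube_cone n (q / t) (t / (gauss_abs_mean * n))) x) powr p) \<partial>std_gaussian n)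
       \<le> ennreal ((16 * exp 7 * Y) powr p)" .
    show "q / t + t / (gauss_abs_mean * n) * (gauss_abs_mean * n + 37 * sqrt n) \<le> q / t + (t + 74 * (t / sqrt n))"
      using calibrated_cone_threshold[OF n t0] by simp
    \<comment> \<open>\<open>\<delta>\<close> is everything by which the level exceeds
      \<open>t\<close>. Both \<open>t * \<delta>\<close> and \<open>\<delta>\<^sup>2\<close> are
      O(q), so squaring the level gives \<open>T\<close> plus at most
      \<open>(2 * 150 + 90000) * q\<close>; half of 90300 is the 45150 in \<open>V\<close>.\<close>
    define \<delta> where "\<delta> = q / t + 74 * (t / sqrt n) + 1 / t"
    have \<delta>0: "\<delta> \<ge> 0" using p t0 by (simp add: \<delta>_def)
    have td: "t * \<delta> \<le> 150 * q"
    proof -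
      have "t * \<delta> = q + 74 * (T / sqrt n) + 1" using t0 by (simp add: \<delta>_def t2[symmetric] power2_eq_square field_simps)
      moreover have "T / sqrt n \<le> 2 * q"
      proof -
        have "T \<le> 2 * (q * sqrt n)" using T2 mult_mono[of p q l "sqrt n"] p par(2,8) by simp
        then show ?thesis using n by (simp add: field_simps)
      qed
      ultimately show ?thesis using p by simp
    qed
    have d2: "\<delta>\<^sup>2 \<le> 90000 * q"
    proof -
      have "T * \<delta>\<^sup>2 = (t * \<delta>)\<^sup>2" by (simp add: power_mult_distrib t2)
      also have "\<dots> \<le> (150 * q)\<^sup>2" using td t0 \<delta>0 by (intro power_mono) auto
      also have "\<dots> = q * (22500 * q)" by (simp add: power2_eq_square)
      also have "\<dots> \<le> (4 * T) * (22500 * q)" using T4 plq p by (intro mult_right_mono) auto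
      also have "\<dots> = T * (90000 * q)" by simp
      finally show ?thesis using Tpos by simp
    qed
    have "(q / t + (t + 74 * (t / sqrt n)) + 1 / t)\<^sup>2 = (t + \<delta>)\<^sup>2" by (simp add: \<delta>_def algebra_simps)
    also have "\<dots> = T + 2 * (t * \<delta>) + \<delta>\<^sup>2" by (simp add: power2_sum t2)
    also have "\<dots> \<le> T + 90300 * q" using td d2 by simp
    finally have ud: "(q / t + (t + 74 * (t / sqrt n)) + 1 / t)\<^sup>2 \<le> T + 90300 * q" .
    have "V powr q = (q / t) powr q * (exp (- 45150 * q) * ((1 / 12) powr q * W powr (- p / 2)))"
    proof -
      have "(W powr (- p / (2 * q))) powr q = W powr (- p / 2)" using p by (simp add: powr_powr)
      then show ?thesis unfolding V_def using p t0 by (simp add: powr_mult powr_divide exp_powr_real)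
    qed
    also have "\<dots> \<le> (q / t) powr q * (exp (- 45150 * q) * (1 / (6 * t) * exp (- T / 2)))"
    proof (intro mult_left_mono)
      have "(1 / 12) powr q * W powr (- p / 2) \<le> 1 / 12 * W powr (- p / 2)"
        using p by (intro mult_right_mono powr_ge_self) auto
      also have "\<dots> \<le> (sqrt (p * l) / t / 6) * W powr (- p / 2)"
        using tle t0 by (intro mult_right_mono) (auto simp: field_simps)
      also have "\<dots> = 1 / (6 * t) * exp (- T / 2)" unfolding eT by (simp add: mult.commute)
      finally show "(1 / 12) powr q * W powr (- p / 2) \<le> 1 / (6 * t) * exp (- T / 2)" .
    qed auto
    also have "\<dots> = (q / t) powr q * (1 / t / 6 * exp (- (T + 90300 * q) / 2))"
    proof -
      have "exp (- (T + 90300 * q) / 2) = exp (- 45150 * q) * exp (- T / 2)" by (simp add: field_simps flip: exp_add)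
      then show ?thesis by simp
    qed
    also have "\<dots> \<le> (q / t) powr q * (1 / t / 6 * exp (- (q / t + (t + 74 * (t / sqrt n)) + 1 / t)\<^sup>2 / 2))"
      using ud t0 by (intro mult_left_mono) auto
    finally show "V powr q \<le> (q / t) powr q * (1 / t / 6 * exp (- (q / t + (t + 74 * (t / sqrt n)) + 1 / t)\<^sup>2 / 2))" .
    show "V > 0" using p t0 par(9) by (simp add: V_def)
  qed (use p t0 Y gauss_abs_mean_bounds in auto)
  moreover have "exp (- 45157) / 384 * rate n p q \<le> V / (16 * exp 7 * Y)"
  proof -
    have r: "rate n p q = sqrt W * W powr (- p / (2 * q))"
    proof -
      have "1 / 2 * (1 - p / q) = 1 / 2 + (- p / (2 * q))" using p by (simp add: field_simps)
      then show ?thesis unfolding rate_eq_W using par(9) by (simp only: powr_add) (simp add: powr_half_sqrt)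
    qed
    have "(q / t) * (a / 12) * W powr (- p / (2 * q)) / (16 * b * Y) = a / b / 192 * (sqrt n / t) * W powr (- p / (2 * q))"
      if "b > 0" for a b :: real
      unfolding Y_def using p n t0 that by (simp add: field_simps)
    from this[of "exp 7" "exp (- 45150)"]
    have "V / (16 * exp 7 * Y) = exp (- 45157) / 192 * (sqrt n / t) * W powr (- p / (2 * q))"
      unfolding V_def by (simp flip: exp_diff)
    also have "\<dots> \<ge> exp (- 45157) / 192 * (sqrt W / 2) * W powr (- p / (2 * q))"
    proof (intro mult_right_mono mult_left_mono)
      have "sqrt W / 2 = sqrt n / (2 * sqrt (p * l))" unfolding par(10) by simp
      also have "\<dots> \<le> sqrt n / t" using tle t0 pl1 by (intro divide_left_mono mult_pos_pos) (auto intro: less_le_trans[OF zero_less_one])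
      finally show "sqrt W / 2 \<le> sqrt n / t" .
    qed auto
    finally show ?thesis unfolding r by simp
  qed
  ultimately show ?thesis by (meson ennreal_leI order_trans)
qed

end

lemma A_star_ge_rate:
  assumes n: "n \<ge> 1" and p: "1 \<le> p" "p < q"
  shows "ennreal (exp (- 45157) / 384 * rate n p q) \<le> A_star n p q (std_gaussian n)"
proof -
  have r0: "rate n p q \<ge> 0" by (simp add: rate_def)
  have mono: "exp (- 45157) / 384 * rate n p q \<le> c * rate n p q" if "exp (- 45157) / 384 \<le> c" for c
    using that r0 by (rule mult_right_mono)
  show ?thesis
  proof (cases "real n \<le> exp 19 * q")
    case True
    have "exp (- 45157) / 384 * rate n p q \<le> exp (- 12) / 24 * rate n p q"
    proof (rule mono)
      have "exp (- 45157 :: real) \<le> exp (- 12)" by simp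
      then show "exp (- 45157) / 384 \<le> exp (- 12) / (24::real)" using exp_gt_zero[of "- 12 :: real"] by linarith
    qed
    also have "\<dots> \<le> exp (- 12) / 24 * (exp 10 * sqrt (q / p))"
      by (intro mult_left_mono rate_le_segment n p True) auto
    also have "\<dots> = exp (- 2) / 24 * sqrt (q / p)"
    proof -
      have "exp (- 12) * exp 10 = exp (- 2 :: real)" by (simp flip: exp_add)
      then show ?thesis by simp
    qed
    finally show ?thesis using A_star_ge_segment[OF n p] by (meson ennreal_leI order_trans)
  next
    case False
    then have nq: "exp 19 * q < real n" by simp
    show ?thesis
    proof (cases "p * (1 + ln (real n / q)) \<le> q")
      case True
      have "exp (- 45157) / 384 * rate n p q \<le> exp (- 2972) / 24 * rate n p q"
      proof (rule mono)
        have "exp (- 45157 :: real) \<le> exp (- 2972)" by simp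
        then show "exp (- 45157) / 384 \<le> exp (- 2972) / (24::real)" using exp_gt_zero[of "- 2972 :: real"] by linarith
      qed
      then show ?thesis
        using A_star_ge_cone_wide[OF n p nq refl refl True] by (meson ennreal_leI order_trans)
    next
      case False
      then show ?thesis using A_star_ge_cone_narrow[OF n p nq refl refl] by simp
    qed
  qed
qed

lemma A_star_le_rate:
  assumes n: "n \<ge> 1" and p: "1 \<le> p" "p < q"
  shows "A_star n p q (std_gaussian n) \<le> ennreal (512 * (1600 * exp 129) * rate n p q)"
  unfolding A_star_def
proof (intro SUP_least)
  fix C assume "C \<in> {C \<in> closed_convex_sets n. C \<noteq> {vec_zero n} \<and> 0 < Lp_norm n (std_gaussian n) p (metric_proj n C)}"
  then have C: "C \<in> closed_convex_sets n" and pos: "0 < Lp_norm n (std_gaussian n) p (metric_proj n C)" by auto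
  define c :: real where "c = 512 * (1600 * exp 129)"
  have r0: "rate n p q \<ge> 0" by (simp add: rate_def)
  define Ip where "Ip = proj_moment n C p"
  define Iq where "Iq = proj_moment n C q"
  show "Lp_norm n (std_gaussian n) q (metric_proj n C) / Lp_norm n (std_gaussian n) p (metric_proj n C) \<le> ennreal (512 * (1600 * exp 129) * rate n p q)"
  proof (cases "Ip = \<infinity>")
    case True
    \<comment> \<open>Division by \<open>top\<close> in \<open>ennreal\<close> gives 0, whatever the
      numerator, so this case satisfies the bound.\<close>
    then have "Lp_norm n (std_gaussian n) p (metric_proj n C) = top" unfolding Lp_norm_def Let_def Ip_def[symmetric] by simp
    then show ?thesis by simp
  next
    case False
    define m where "m = enn2real Ip powr (1 / p)"
    have Np: "Lp_norm n (std_gaussian n) p (metric_proj n C) = ennreal m"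
      using False unfolding Lp_norm_def Let_def Ip_def[symmetric] m_def by simp
    have m: "m > 0" using pos by (simp add: Np)
    have "m powr p = enn2real Ip" using p by (simp add: m_def powr_powr)
    then have I: "Ip \<le> ennreal (m powr p)" using False by (simp add: less_top)
    have "Iq \<le> ennreal ((c * rate n p q * m) powr q)"
    proof (cases "real n \<le> q")
      case True
      have "Iq \<le> ennreal ((48 * 128 * exp 64 * rate n p q * m) powr q)"
        unfolding Iq_def using I unfolding Ip_def by (intro rate_upper_large n p True C m)
      also have "\<dots> \<le> ennreal ((c * rate n p q * m) powr q)"
      proof (intro ennreal_leI powr_mono2 mult_right_mono)
        have "exp 64 \<le> exp (129::real)" by simp
        then show "48 * 128 * exp 64 \<le> c" unfolding c_def using exp_gt_zero[of "64 :: real"] by linarith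
      qed (use p m r0 in auto)
      finally show ?thesis .
    next
      case False
      then show ?thesis unfolding Iq_def c_def using I unfolding Ip_def by (intro rate_upper_small n p C m) auto
    qed
    moreover from this have Iqt: "Iq < \<infinity>" using le_less_trans by fastforce
    ultimately have "enn2real Iq \<le> (c * rate n p q * m) powr q" by (intro enn2real_leI) auto
    then have "enn2real Iq powr (1 / q) \<le> ((c * rate n p q * m) powr q) powr (1 / q)" using p by (intro powr_mono2) auto
    also have "\<dots> = c * rate n p q * m" using p r0 m by (simp add: powr_powr c_def)
    finally have "Lp_norm n (std_gaussian n) q (metric_proj n C) \<le> ennreal (c * rate n p q * m)"
      using Iqt unfolding Lp_norm_def Let_def Iq_def[symmetric] by (auto intro: ennreal_leI)
    then have "Lp_norm n (std_gaussian n) q (metric_proj n C) / ennreal m \<le> ennreal (c * rate n p q * m) / ennreal m"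
      by (rule divide_right_mono_ennreal)
    also have "\<dots> = ennreal (c * rate n p q)" using m r0 by (subst divide_ennreal) (auto simp: c_def)
    finally show ?thesis unfolding Np c_def .
  qed
qed

theorem theorem1p2:
  shows "\<exists>c c' :: real. 0 < c \<and> c \<le> c' \<and>
    (\<forall>(n::nat) (p::real) (q::real). n \<ge> 1 \<longrightarrow> 1 \<le> p \<longrightarrow> p < q \<longrightarrow>
      (let \<tau> = 1 / 2 * (1 - p / q);
           R = sqrt (max q (real n) / max p (real n)) *
               (real n / (min p (real n) * ln (exp 1 * (real n / min q (real n))))) powr \<tau>
       in ennreal (c * R) \<le> A_star n p q (std_gaussian n) \<and>
          A_star n p q (std_gaussian n) \<le> ennreal (c' * R)))"
proof (intro exI conjI allI impI)
  show "0 < exp (- 45157) / (384 :: real)" by simp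
  have "exp (- 45157 :: real) \<le> 1" "1 \<le> exp (129 :: real)" by simp_all
  then show "exp (- 45157) / 384 \<le> 512 * (1600 * exp (129 :: real))" by linarith
  fix n :: nat and p q :: real
  assume "n \<ge> 1" "1 \<le> p" "p < q"
  then show "let \<tau> = 1 / 2 * (1 - p / q);
           R = sqrt (max q (real n) / max p (real n)) *
               (real n / (min p (real n) * ln (exp 1 * (real n / min q (real n))))) powr \<tau>
       in ennreal (exp (- 45157) / 384 * R) \<le> A_star n p q (std_gaussian n) \<and>
          A_star n p q (std_gaussian n) \<le> ennreal (512 * (1600 * exp 129) * R)"
    using A_star_ge_rate A_star_le_rate by (simp only: Let_def rate_def[symmetric])
qed

end
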